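(* Let $\mathbb F$ be a field of characteristic other than $2$ and let $\alpha,\beta\in\mathbb F$ be such that $0,1,\alpha,\beta$ are pairwise distinct. If $(\alpha,\beta)\neq(2,\tfrac12)$, then every $2$-generated primitive axial algebra of Monster type $(\alpha,\beta)$ over $\mathbb F$ has dimension at most $8$.
   Context: For a commutative, not necessarily associative $\mathbb F$-algebra $V$, $a\in V$ and $\lambda\in\mathbb F$, let $V_\lambda^a=\{v\in V : va=\lambda v\}$. The Monster fusion law $\mathcal M(\alpha,\beta)$ is the symmetric map $\star$ from $\{1,0,\alpha,\beta\}^2$ to the set of subsets of $\{1,0,\alpha,\beta\}$ given by $1\star1=\{1\}$, $1\star0=\emptyset$, $1\star\alpha=\{\alpha\}$, $1\star\beta=\{\beta\}$, $0\star0=\{0\}$, $0\star\alpha=\{\alpha\}$, $0\star\beta=\{\beta\}$, $\alpha\star\alpha=\{1,0\}$, $\alpha\star\beta=\{\beta\}$, $\beta\star\beta=\{1,0,\alpha\}$. A primitive axis of Monster type $(\alpha,\beta)$ in $V$ is a nonzero idempotent $a$ such that $V=V_1^a\oplus V_0^a\oplus V_\alpha^a\oplus V_\beta^a$, $V_\lambda^aV_\mu^a\subseteq\sum_{\nu\in\lambda\star\mu}V_\nu^a$ for all $\lambda,\mu\in\{1,0,\alpha,\beta\}$, and $V_1^a=\mathbb Fa$. A $2$-generated primitive axial algebra of Monster type $(\alpha,\beta)$ over $\mathbb F$ is a commutative non-associative $\mathbb F$-algebra generated, as an algebra, by two (not necessarily distinct) primitive axes of Monster type $(\alpha,\beta)$.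 *)

theory Defs
  imports "HOL-Computational_Algebra.Computational_Algebra"
begin

locale comm_algebra = vector_space scale
  for scale :: "'f::field \<Rightarrow> 'v::ab_group_add \<Rightarrow> 'v" (infixr "*s" 75) +
  fixes mult :: "'v \<Rightarrow> 'v \<Rightarrow> 'v" (infixl "\<bullet>" 70)
  assumes mult_commute: "u \<bullet> v = v \<bullet> u"
    and mult_add_left: "(u + v) \<bullet> w = u \<bullet> w + v \<bullet> w"
    and mult_scale_left: "(c *s u) \<bullet> v = c *s (u \<bullet> v)"
begin

definition eigenspace :: "'v \<Rightarrow> 'f \<Rightarrow> 'v set" where
  "eigenspace a l = {v. v \<bullet> a = l *s v}"

text \<open>The sum of the \<open>l\<close>-eigenspaces of \<open>a\<close> over \<open>l \<in> L\<close>, for finite \<open>L\<close>;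
  it is \<open>{0}\<close> when \<open>L\<close> is empty.\<close>

definition eigen_sum :: "'v \<Rightarrow> 'f set \<Rightarrow> 'v set" where
  "eigen_sum a L = {(\<Sum>l\<in>L. w l) | w. \<forall>l\<in>L. w l \<in> eigenspace a l}"

definition eigenspaces_independent :: "'v \<Rightarrow> 'f set \<Rightarrow> bool" where
  "eigenspaces_independent a L \<longleftrightarrow>
     (\<forall>w. (\<forall>l\<in>L. w l \<in> eigenspace a l) \<and> (\<Sum>l\<in>L. w l) = 0 \<longrightarrow> (\<forall>l\<in>L. w l = 0))"

definition subalgebra :: "'v set \<Rightarrow> bool" where
  "subalgebra S \<longleftrightarrow> subspace S \<and> (\<forall>u\<in>S. \<forall>v\<in>S. u \<bullet> v \<in> S)"

end

text \<open>The unordered pair \<open>{l, m}\<close> makes the law symmetric by construction.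
  The clauses are the intended ones only if \<open>1\<close>, \<open>0\<close>, \<open>\<alpha>\<close>, \<open>\<beta>\<close> are pairwise
  distinct; the remaining case on \<open>{1, 0, \<alpha>, \<beta>}\<close> is \<open>{l, m} = {1, 0}\<close>.
  Values outside that set are irrelevant.\<close>

definition monster_law :: "'f::field \<Rightarrow> 'f \<Rightarrow> 'f \<Rightarrow> 'f \<Rightarrow> 'f set" where
  "monster_law \<alpha> \<beta> l m =
    (if {l, m} = {1} then {1}
     else if {l, m} = {1, \<alpha>} then {\<alpha>}
     else if {l, m} = {1, \<beta>} then {\<beta>}
     else if {l, m} = {0} then {0}
     else if {l, m} = {0, \<alpha>} then {\<alpha>}
     else if {l, m} = {0, \<beta>} then {\<beta>}
     else if {l, m} = {\<alpha>} then {1, 0}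
     else if {l, m} = {\<alpha>, \<beta>} then {\<beta>}
     else if {l, m} = {\<beta>} then {1, 0, \<alpha>}
     else {})"

definition (in comm_algebra) monster_axis :: "'f \<Rightarrow> 'f \<Rightarrow> 'v \<Rightarrow> bool" where
  "monster_axis \<alpha> \<beta> a \<longleftrightarrow>
     a \<noteq> 0 \<and> a \<bullet> a = a \<and>
     eigen_sum a {1, 0, \<alpha>, \<beta>} = UNIV \<and>
     eigenspaces_independent a {1, 0, \<alpha>, \<beta>} \<and>
     (\<forall>l\<in>{1, 0, \<alpha>, \<beta>}. \<forall>m\<in>{1, 0, \<alpha>, \<beta>}.
        \<forall>u\<in>eigenspace a l. \<forall>v\<in>eigenspace a m.
          u \<bullet> v \<in> eigen_sum a (monster_law \<alpha> \<beta> l m)) \<and>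
     eigenspace a 1 = {c *s a | c. True}"

locale two_generated_monster_algebra = comm_algebra scale mult
  for scale :: "'f::field \<Rightarrow> 'v::ab_group_add \<Rightarrow> 'v" (infixr "*s" 75)
    and mult :: "'v \<Rightarrow> 'v \<Rightarrow> 'v" (infixl "\<bullet>" 70) +
  fixes \<alpha> \<beta> :: 'f
  assumes two_generated:
    "\<exists>a b. monster_axis \<alpha> \<beta> a \<and> monster_axis \<alpha> \<beta> b \<and> subalgebra hull {a, b} = UNIV"

end

theory Submission
  imports Defs
begin

text \<open>
  An axis \<open>a\<close> grades the algebra: the Miyamoto map \<open>\<tau>\<close>, which negates the \<open>\<beta>\<close>-eigenspace and fixes
  the other three, is an involutive automorphism. Let \<open>\<tau>\<^sub>0\<close>, \<open>\<tau>\<^sub>1\<close> belong to the generating axes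
  \<open>a\<^sub>0\<close>, \<open>a\<^sub>1\<close>. The dihedral group that they generate moves these axes along a sequence \<open>a\<^sub>i\<close>,
  \<open>i \<in> \<int>\<close>, with \<open>\<tau>\<^sub>0 a\<^sub>i = a\<^bsub>-i\<^esub>\<close> and \<open>\<tau>\<^sub>1 a\<^sub>i = a\<^bsub>2-i\<^esub>\<close>. The shifted product
  \<open>sig x y = x y - \<beta> (x + y)\<close> of an axis \<open>x\<close> with any vector is fixed by the involution of \<open>x\<close>;
  hence \<open>s = sig a\<^sub>0 a\<^sub>1\<close>, \<open>e = sig a\<^sub>0 a\<^sub>2\<close> and \<open>d = sig a\<^sub>1 a\<^bsub>-1\<^esub>\<close> are fixed by the whole group.

  On the vectors fixed by \<open>\<tau>\<close> only the eigenvalues \<open>1, 0, \<alpha>\<close> occur, and there the \<open>0\<close>-part and the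
  \<open>\<alpha>\<close>-part of \<open>x\<close> are combinations of \<open>x\<close>, \<open>a x\<close> and \<open>a\<close>. Fusion thus becomes two identities
  between products (\<open>mult_a_U\<close> and \<open>mult_a_V_mult\<close>): if \<open>y\<close> is a vector by which one can multiply,
  then they determine the products with \<open>a y\<close>. This has two consequences.

  First, a closure principle: a subspace that contains the generators, is invariant under both
  involutions and under multiplication by \<open>a\<^sub>0\<close> and \<open>a\<^sub>1\<close>, and is spanned by axes and by some
  vectors \<open>sig a\<^sub>j a\<^sub>i\<close>, \<open>j \<in> {0, 1}\<close>, each of them fixed by every \<open>\<tau>\<^sub>j\<close> that occurs, is the whole
  algebra (\<open>stable_mult_sig_a0\<close>, \<open>stable_eq_UNIV\<close>). It therefore suffices to find such a subspace
  spanned by eight vectors, which amounts to expressing far members of the sequence by near ones.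

  Second, for \<open>x = y = a\<^sub>1 + a\<^bsub>-1\<^esub>\<close> the two identities give \<open>(\<alpha> - 2 \<beta>) (a\<^sub>0 d)\<close> in terms of
  \<open>a\<^bsub>-2\<^esub>, \<dots>, a\<^sub>2, s, e\<close> (\<open>a0_mult_d\<close>), and \<open>s s\<close> in terms of these, \<open>d\<close> and \<open>a\<^sub>0 d\<close> (\<open>s_mult_s\<close>).
  The product \<open>s s\<close> can be computed from \<open>a\<^sub>0\<close> and from \<open>a\<^sub>1\<close>, and the comparison of the results
  drives the case distinction.

  If \<open>\<alpha> \<noteq> 2 \<beta>\<close> and \<open>\<alpha> \<noteq> 4 \<beta>\<close>, then \<open>a\<^sub>2 + a\<^bsub>-2\<^esub>\<close> has a nonzero coefficient, a multiple of
  \<open>\<alpha> - 4 \<beta>\<close>, so \<open>a\<^sub>3\<close> is a combination of \<open>a\<^bsub>-2\<^esub>, \<dots>, a\<^sub>2, s, e, d\<close>, and these eight vectors span.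

  If \<open>\<alpha> = 2 \<beta>\<close>, then the left-hand side of \<open>a0_mult_d\<close> vanishes. What remains expresses \<open>e\<close> by
  axes and \<open>s\<close>; its image under \<open>\<tau>\<^sub>1\<close> gives \<open>a\<^sub>4\<close>, and \<open>a\<^bsub>-2\<^esub>, \<dots>, a\<^sub>3, s, s s\<close> span.

  If \<open>\<alpha> = 4 \<beta>\<close>, then the comparison gives \<open>d - e\<close> as a combination of axes and \<open>s\<close> (\<open>d_minus_e\<close>).
  If this combination is nonzero, then multiplying it by \<open>a\<^sub>0\<close>, or moving it by the involutions,
  yields enough relations between the axes. Otherwise \<open>e = d\<close>, and the formula for
  \<open>a\<^sub>0 d - a\<^sub>0 e = 0\<close> contains \<open>a\<^sub>1 + a\<^bsub>-1\<^esub>\<close> with a coefficient proportional to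
  \<open>(12 \<beta> - 1) (2 \<beta> - 1)\<close>. The factor \<open>2 \<beta> - 1\<close> vanishes only for the excluded parameters. For
  \<open>12 \<beta> = 1\<close> the structure constants that enter so far are determined; the identities for
  \<open>x = a\<^sub>1 + a\<^bsub>-1\<^esub>\<close> and \<open>y = a\<^sub>2 + a\<^bsub>-2\<^esub>\<close>, again compared between \<open>a\<^sub>0\<close> and \<open>a\<^sub>1\<close>, give a relation
  between \<open>a\<^bsub>-3\<^esub>, \<dots>, a\<^sub>4\<close> whose products with axes force \<open>a\<^sub>4\<close> into the span of
  \<open>a\<^bsub>-2\<^esub>, \<dots>, a\<^sub>3, s, e\<close>.
\<close>

section \<open>Bilinear products and linear functionals\<close>

context comm_algebra
begin

lemma mult_add_right: "u \<bullet> (v + w) = u \<bullet> v + u \<bullet> w"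
  using mult_add_left[of v w u] by (simp add: mult_commute)

lemma mult_scale_right: "u \<bullet> (c *s v) = c *s (u \<bullet> v)"
  using mult_scale_left[of c v u] by (simp add: mult_commute)

lemma product_zero_left [simp]: "0 \<bullet> v = 0"
  using mult_scale_left[of 0 0 v] by simp

lemma product_zero_right [simp]: "v \<bullet> 0 = 0"
  using mult_scale_right[of v 0 0] by simp

lemma product_minus_left: "(- u) \<bullet> v = - (u \<bullet> v)"
  using mult_scale_left[of "- 1" u v] by simp

lemma product_minus_right: "u \<bullet> (- v) = - (u \<bullet> v)"
  using mult_scale_right[of u "- 1" v] by simp

lemma product_diff_left: "(u - v) \<bullet> w = u \<bullet> w - v \<bullet> w"
  using mult_add_left[of u "- v" w] by (simp add: product_minus_left)

lemma product_diff_right: "u \<bullet> (v - w) = u \<bullet> v - u \<bullet> w"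
  using mult_add_right[of u v "- w"] by (simp add: product_minus_right)

lemmas bilinear_simps = mult_add_left mult_add_right mult_scale_left mult_scale_right
  product_diff_left product_diff_right product_minus_left product_minus_right

text \<open>
  Linear functionals turn an identity between vectors into an identity in the field, where the
  Groebner basis procedure applies. Over an arbitrary field there are enough of them to separate
  vectors.
\<close>

definition functional :: "('v \<Rightarrow> 'f) \<Rightarrow> bool" where
  "functional f \<longleftrightarrow> Vector_Spaces.linear scale (*) f"

lemma functional_simps:
  assumes "functional f"
  shows "f (u + v) = f u + f v" "f (u - v) = f u - f v" "f (- u) = - f u"
    "f (c *s u) = c * f u" "f 0 = 0"
proof -
  interpret f: Vector_Spaces.linear scale "(*)" f
    using assms by (simp add: functional_def)
  show "f (u + v) = f u + f v" "f (u - v) = f u - f v" "f (- u) = - f u"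
    "f (c *s u) = c * f u" "f 0 = 0"
    by (simp_all add: f.add f.diff f.neg f.scale f.zero)
qed

lemma functional_mult: "functional f \<Longrightarrow> functional (\<lambda>x. f (v \<bullet> x))"
  by (auto simp: functional_def Vector_Spaces.linear_iff bilinear_simps)

lemma eq_if_functionals_eq:
  assumes "\<And>f. functional f \<Longrightarrow> f u = f v"
  shows "u = v"
proof (rule ccontr)
  assume "u \<noteq> v"
  have vs: "vector_space ((*) :: 'f \<Rightarrow> 'f \<Rightarrow> 'f)"
    by unfold_locales (simp_all add: algebra_simps)
  interpret pair: vector_space_pair scale "(*) :: 'f \<Rightarrow> 'f \<Rightarrow> 'f"
    using vs by (simp add: vector_space_pair_def vector_space_axioms)
  have "independent {u - v}"
    using \<open>u \<noteq> v\<close> by (simp add: dependent_single)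
  then obtain f where f: "Vector_Spaces.linear scale (*) f" "f (u - v) = 1"
    using pair.linear_independent_extend[of "{u - v}" "\<lambda>_. 1"] by auto
  have "functional f" using f by (simp add: functional_def)
  with assms[of f] f(2) show False by (simp add: functional_simps)
qed

lemma subspace_eigenspace: "subspace (eigenspace a l)"
  by (simp add: subspace_def eigenspace_def bilinear_simps scale_right_distrib mult.commute)

end

section \<open>The eigenspace decomposition of an axis\<close>

locale axis_algebra = comm_algebra scale mult
  for scale :: "'f::field \<Rightarrow> 'v::ab_group_add \<Rightarrow> 'v" (infixr "*s" 75)
    and mult :: "'v \<Rightarrow> 'v \<Rightarrow> 'v" (infixl "\<bullet>" 70) +
  fixes \<alpha> \<beta> :: 'f and a :: 'v
  assumes two_nz: "(2::'f) \<noteq> 0"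
    and params: "distinct [0, 1, \<alpha>, \<beta>]"
    and axis: "monster_axis \<alpha> \<beta> a"
begin

lemma a_nz: "a \<noteq> 0" and a_idem: "a \<bullet> a = a"
  using axis by (auto simp: monster_axis_def)

lemma params_nz: "\<alpha> \<noteq> 0" "\<beta> \<noteq> 0" "\<alpha> \<noteq> 1" "\<beta> \<noteq> 1" "\<alpha> \<noteq> \<beta>"
  using params by auto

abbreviation E :: "'f \<Rightarrow> 'v set" where "E \<equiv> eigenspace a"

lemma E_add: "u \<in> E l \<Longrightarrow> v \<in> E l \<Longrightarrow> u + v \<in> E l"
  and E_scale: "u \<in> E l \<Longrightarrow> c *s u \<in> E l"
  and E_diff: "u \<in> E l \<Longrightarrow> v \<in> E l \<Longrightarrow> u - v \<in> E l"
  and E_zero: "0 \<in> E l"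
  using subspace_eigenspace[of a l]
  by (auto intro: subspace_add subspace_scale subspace_diff subspace_0)

lemma E_mult: "u \<in> E l \<Longrightarrow> a \<bullet> u = l *s u"
  by (simp add: eigenspace_def mult_commute)

lemma E_one: "E 1 = {c *s a | c. True}"
  using axis by (simp add: monster_axis_def)

lemma eigen_sum_insert:
  assumes "finite L" "l \<notin> L"
  shows "v \<in> eigen_sum a (insert l L) \<longleftrightarrow> (\<exists>x\<in>E l. \<exists>y\<in>eigen_sum a L. v = x + y)"
proof
  assume "v \<in> eigen_sum a (insert l L)"
  then show "\<exists>x\<in>E l. \<exists>y\<in>eigen_sum a L. v = x + y"
    using assms by (fastforce simp: eigen_sum_def)
next
  assume "\<exists>x\<in>E l. \<exists>y\<in>eigen_sum a L. v = x + y"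
  then obtain x w where x: "x \<in> E l" "\<forall>l\<in>L. w l \<in> E l" "v = x + (\<Sum>l\<in>L. w l)"
    by (auto simp: eigen_sum_def)
  have "(\<Sum>k\<in>L. (w(l := x)) k) = (\<Sum>k\<in>L. w k)"
    using assms by (intro sum.cong) auto
  then have "v = (\<Sum>k\<in>insert l L. (w(l := x)) k)" "\<forall>k\<in>insert l L. (w(l := x)) k \<in> E k"
    using assms x by auto
  then show "v \<in> eigen_sum a (insert l L)"
    unfolding eigen_sum_def by blast
qed

lemma eigen_sum_empty: "eigen_sum a {} = {0}"
  by (auto simp: eigen_sum_def)

lemma ex_decomposition: "\<exists>c. \<exists>x\<in>E 0. \<exists>y\<in>E \<alpha>. \<exists>z\<in>E \<beta>. v = c *s a + x + y + z"
proof -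
  have "v \<in> eigen_sum a {1, 0, \<alpha>, \<beta>}"
    using axis by (simp add: monster_axis_def)
  then show ?thesis
    using params by (auto simp: eigen_sum_insert eigen_sum_empty E_one) (metis add.assoc)
qed

lemma decomposition_zero:
  assumes "x \<in> E 0" "y \<in> E \<alpha>" "z \<in> E \<beta>" "c *s a + x + y + z = 0"
  shows "c = 0 \<and> x = 0 \<and> y = 0 \<and> z = 0"
proof -
  let ?w = "\<lambda>l. if l = 1 then c *s a else if l = 0 then x else if l = \<alpha> then y else z"
  have "eigenspaces_independent a {1, 0, \<alpha>, \<beta>}"
    using axis by (simp add: monster_axis_def)
  then have "(\<forall>l\<in>{1, 0, \<alpha>, \<beta>}. ?w l \<in> E l) \<and> (\<Sum>l\<in>{1, 0, \<alpha>, \<beta>}. ?w l) = 0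
      \<longrightarrow> (\<forall>l\<in>{1, 0, \<alpha>, \<beta>}. ?w l = 0)"
    unfolding eigenspaces_independent_def by (rule spec)
  moreover have "\<forall>l\<in>{1, 0, \<alpha>, \<beta>}. ?w l \<in> E l"
    using params assms E_one by auto
  moreover have "(\<Sum>l\<in>{1, 0, \<alpha>, \<beta>}. ?w l) = 0"
    using params assms(4) by (auto simp: add.assoc)
  ultimately have "\<forall>l\<in>{1, 0, \<alpha>, \<beta>}. ?w l = 0" by blast
  then show ?thesis using params a_nz by auto
qed

lemma decomposition_unique:
  assumes "x \<in> E 0" "y \<in> E \<alpha>" "z \<in> E \<beta>" "x' \<in> E 0" "y' \<in> E \<alpha>" "z' \<in> E \<beta>"
    "c *s a + x + y + z = c' *s a + x' + y' + z'"
  shows "c = c' \<and> x = x' \<and> y = y' \<and> z = z'"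
proof -
  have "(c - c') *s a + (x - x') + (y - y') + (z - z') = 0"
    using assms(7) by (simp add: scale_left_diff_distrib algebra_simps)
  then have "c - c' = 0 \<and> x - x' = 0 \<and> y - y' = 0 \<and> z - z' = 0"
    using assms by (intro decomposition_zero) (auto intro: E_diff)
  then show ?thesis by simp
qed

text \<open>
  The four components of a vector are chosen simultaneously; the first one is recorded as the
  coefficient of \<open>a\<close>, which is meaningful since the axis is primitive.
\<close>

definition parts :: "'v \<Rightarrow> 'f \<times> 'v \<times> 'v \<times> 'v" where
  "parts v = (SOME (c, x, y, z). x \<in> E 0 \<and> y \<in> E \<alpha> \<and> z \<in> E \<beta> \<and> v = c *s a + x + y + z)"

definition lam :: "'v \<Rightarrow> 'f" where "lam v = fst (parts v)"
definition zero_part :: "'v \<Rightarrow> 'v" where "zero_part v = fst (snd (parts v))"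
definition alpha_part :: "'v \<Rightarrow> 'v" where "alpha_part v = fst (snd (snd (parts v)))"
definition beta_part :: "'v \<Rightarrow> 'v" where "beta_part v = snd (snd (snd (parts v)))"
definition tau :: "'v \<Rightarrow> 'v" where "tau v = v - 2 *s beta_part v"

lemma zero_part: "zero_part v \<in> E 0"
  and alpha_part: "alpha_part v \<in> E \<alpha>"
  and beta_part: "beta_part v \<in> E \<beta>"
  and decomposition: "v = lam v *s a + zero_part v + alpha_part v + beta_part v"
proof -
  have "\<exists>t. case t of (c, x, y, z) \<Rightarrow> x \<in> E 0 \<and> y \<in> E \<alpha> \<and> z \<in> E \<beta> \<and> v = c *s a + x + y + z"
    using ex_decomposition[of v] by auto
  from someI_ex[OF this]
  have "case parts v of (c, x, y, z) \<Rightarrow> x \<in> E 0 \<and> y \<in> E \<alpha> \<and> z \<in> E \<beta> \<and> v = c *s a + x + y + z"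
    by (simp only: parts_def)
  then show "zero_part v \<in> E 0" "alpha_part v \<in> E \<alpha>" "beta_part v \<in> E \<beta>"
      "v = lam v *s a + zero_part v + alpha_part v + beta_part v"
    by (auto simp: zero_part_def alpha_part_def beta_part_def lam_def split: prod.splits)
qed

lemma parts_eqI:
  assumes "x \<in> E 0" "y \<in> E \<alpha>" "z \<in> E \<beta>" "v = c *s a + x + y + z"
  shows "lam v = c" "zero_part v = x" "alpha_part v = y" "beta_part v = z"
proof -
  have "lam v *s a + zero_part v + alpha_part v + beta_part v = c *s a + x + y + z"
    using decomposition[of v] assms(4) by simp
  from decomposition_unique[OF zero_part alpha_part beta_part assms(1-3) this]
  show "lam v = c" "zero_part v = x" "alpha_part v = y" "beta_part v = z" by auto
qed

lemma parts_add:
  "lam (u + v) = lam u + lam v" "beta_part (u + v) = beta_part u + beta_part v"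
proof -
  have "u + v = (lam u + lam v) *s a + (zero_part u + zero_part v)
      + (alpha_part u + alpha_part v) + (beta_part u + beta_part v)"
    by (subst decomposition[of u], subst decomposition[of v])
       (simp only: scale_left_distrib ac_simps)
  from parts_eqI[OF E_add[OF zero_part zero_part] E_add[OF alpha_part alpha_part]
      E_add[OF beta_part beta_part] this]
  show "lam (u + v) = lam u + lam v" "beta_part (u + v) = beta_part u + beta_part v" by auto
qed

lemma parts_scale:
  "lam (c *s v) = c * lam v" "beta_part (c *s v) = c *s beta_part v"
proof -
  have "c *s v = (c * lam v) *s a + c *s zero_part v + c *s alpha_part v + c *s beta_part v"
    by (subst decomposition[of v]) (simp only: scale_right_distrib scale_scale)
  from parts_eqI[OF E_scale[OF zero_part] E_scale[OF alpha_part] E_scale[OF beta_part] this]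
  show "lam (c *s v) = c * lam v" "beta_part (c *s v) = c *s beta_part v" by auto
qed

lemma lam_diff: "lam (u - v) = lam u - lam v"
  using parts_add(1)[of u "- 1 *s v"] parts_scale(1)[of "- 1" v] by simp

lemma lam_a: "lam a = 1"
  by (rule parts_eqI[where x = 0 and y = 0 and z = 0]) (auto simp: E_zero)

lemma lam_E: "v \<in> E 0 \<Longrightarrow> lam v = 0" "v \<in> E \<alpha> \<Longrightarrow> lam v = 0" "v \<in> E \<beta> \<Longrightarrow> lam v = 0"
  using parts_eqI(1)[of v 0 0 v 0] parts_eqI(1)[of 0 v 0 v 0] parts_eqI(1)[of 0 0 v v 0]
  by (auto simp: E_zero)

lemma beta_part_E: "v \<in> E 0 \<Longrightarrow> beta_part v = 0" "v \<in> E \<alpha> \<Longrightarrow> beta_part v = 0"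
    "v \<in> E \<beta> \<Longrightarrow> beta_part v = v" "beta_part a = 0"
  using parts_eqI(4)[of v 0 0 v 0] parts_eqI(4)[of 0 v 0 v 0] parts_eqI(4)[of 0 0 v v 0]
    parts_eqI(4)[of 0 0 0 a 1]
  by (auto simp: E_zero)

lemma mult_a: "a \<bullet> v = lam v *s a + \<alpha> *s alpha_part v + \<beta> *s beta_part v"
  by (subst decomposition[of v])
     (simp add: bilinear_simps a_idem E_mult[OF zero_part] E_mult[OF alpha_part] E_mult[OF
         beta_part])

lemma lam_mult_a: "lam (a \<bullet> v) = lam v"
  by (simp add: mult_a[of v] parts_add parts_scale lam_a lam_E alpha_part beta_part)

lemma fusion:
  assumes "l \<in> {1, 0, \<alpha>, \<beta>}" "k \<in> {1, 0, \<alpha>, \<beta>}" "u \<in> E l" "v \<in> E k"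
  shows "u \<bullet> v \<in> eigen_sum a (monster_law \<alpha> \<beta> l k)"
  using axis assms unfolding monster_axis_def by blast

lemma monster_law_values:
  "monster_law \<alpha> \<beta> 0 0 = {0}" "monster_law \<alpha> \<beta> 0 \<alpha> = {\<alpha>}"
  "monster_law \<alpha> \<beta> 0 \<beta> = {\<beta>}" "monster_law \<alpha> \<beta> \<alpha> \<beta> = {\<beta>}"
  "monster_law \<alpha> \<beta> \<alpha> \<alpha> = {1, 0}" "monster_law \<alpha> \<beta> \<beta> \<beta> = {1, 0, \<alpha>}"
  using params by (auto simp: monster_law_def doubleton_eq_iff)

lemma fusion_0_0: "u \<in> E 0 \<Longrightarrow> v \<in> E 0 \<Longrightarrow> u \<bullet> v \<in> E 0"
  and fusion_0_alpha: "u \<in> E 0 \<Longrightarrow> v \<in> E \<alpha> \<Longrightarrow> u \<bullet> v \<in> E \<alpha>"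
  and fusion_0_beta: "u \<in> E 0 \<Longrightarrow> v \<in> E \<beta> \<Longrightarrow> u \<bullet> v \<in> E \<beta>"
  and fusion_alpha_beta: "u \<in> E \<alpha> \<Longrightarrow> v \<in> E \<beta> \<Longrightarrow> u \<bullet> v \<in> E \<beta>"
  using fusion[of 0 0 u v] fusion[of 0 \<alpha> u v] fusion[of 0 \<beta> u v] fusion[of \<alpha> \<beta> u v]
  by (simp_all add: monster_law_values eigen_sum_insert eigen_sum_empty)

lemma fusion_alpha_alpha:
  assumes "u \<in> E \<alpha>" "v \<in> E \<alpha>"
  obtains c x where "x \<in> E 0" "u \<bullet> v = c *s a + x"
proof -
  have "u \<bullet> v \<in> eigen_sum a (insert 1 (insert 0 {}))"
    using fusion[of \<alpha> \<alpha> u v] assms by (simp add: monster_law_values)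
  then have "\<exists>c. \<exists>x\<in>E 0. u \<bullet> v = c *s a + x"
    by (auto simp: eigen_sum_insert eigen_sum_empty E_one; blast)
  then show thesis using that by blast
qed

lemma fusion_beta_beta:
  assumes "u \<in> E \<beta>" "v \<in> E \<beta>"
  obtains c x y where "x \<in> E 0" "y \<in> E \<alpha>" "u \<bullet> v = c *s a + x + y"
proof -
  have "u \<bullet> v \<in> eigen_sum a (insert 1 (insert 0 (insert \<alpha> {})))"
    using fusion[of \<beta> \<beta> u v] assms by (simp add: monster_law_values)
  then have "\<exists>c. \<exists>x\<in>E 0. \<exists>y\<in>E \<alpha>. u \<bullet> v = c *s a + (x + y)"
    using params by (auto simp: eigen_sum_insert eigen_sum_empty E_one; blast)
  then show thesis using that by (metis add.assoc)
qed

lemma beta_part_diff: "beta_part (u - v) = beta_part u - beta_part v"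
  using parts_add(2)[of u "- 1 *s v"] parts_scale(2)[of "- 1" v] by simp

lemma tau_add: "tau (u + v) = tau u + tau v"
  by (simp add: tau_def parts_add scale_right_distrib)

lemma tau_scale: "tau (c *s v) = c *s tau v"
  by (simp add: tau_def parts_scale scale_right_diff_distrib mult.commute)

lemma tau_tau: "tau (tau v) = v"
  by (simp add: tau_def beta_part_diff parts_scale beta_part_E beta_part scale_right_diff_distrib
      flip: scale_left_distrib)
     (simp flip: scale_left_distrib add: algebra_simps)

lemma tau_fixed_iff: "tau v = v \<longleftrightarrow> beta_part v = 0"
  using two_nz by (auto simp: tau_def)

lemma tau_negated_iff: "tau v = - v \<longleftrightarrow> v \<in> E \<beta>"
proof
  assume "tau v = - v"
  then have "2 *s v = 2 *s beta_part v"
    by (simp add: tau_def algebra_simps scale_left_distrib[of 1 1, simplified])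
  then have "v = beta_part v" using two_nz by simp
  then show "v \<in> E \<beta>" using beta_part[of v] by simp
next
  assume "v \<in> E \<beta>"
  then show "tau v = - v"
    by (simp add: tau_def beta_part_E scale_left_distrib[of 1 1, simplified])
qed

lemma tau_a: "tau a = a"
  by (simp add: tau_fixed_iff beta_part_E)

text \<open>
  Call \<open>1 + 0 + \<alpha>\<close> even and \<open>\<beta>\<close> odd. The next three lemmas say that the fusion law is graded by
  \<open>\<int>/2\<close>, which is why the Miyamoto map is an automorphism.
\<close>

lemma beta_part_even_mult:
  assumes "beta_part u = 0" "beta_part v = 0"
  shows "beta_part (u \<bullet> v) = 0"
proof -
  obtain c x where c: "x \<in> E 0" "alpha_part u \<bullet> alpha_part v = c *s a + x"
    using fusion_alpha_alpha alpha_part by blast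
  have "u \<bullet> v = (lam u *s a + zero_part u + alpha_part u) \<bullet> (lam v *s a + zero_part v
      + alpha_part v)"
    using decomposition[of u] decomposition[of v] assms by simp
  also have "\<dots> = lam u *s (a \<bullet> v) + lam v *s (a \<bullet> u) - (lam u * lam v) *s a
     + zero_part u \<bullet> zero_part v + zero_part u \<bullet> alpha_part v + zero_part v \<bullet> alpha_part u
     + (c *s a + x)"
    by (rule eq_if_functionals_eq)
       (simp add: functional_simps mult_a[of u] mult_a[of v] assms bilinear_simps a_idem E_mult[OF
           zero_part]
        E_mult[OF alpha_part] c(2) mult_commute[of "zero_part u" a] mult_commute[of
            "alpha_part u" a]
        mult_commute[of "alpha_part u" "zero_part v"] algebra_simps)
  finally show ?thesis
    using assms c(1) fusion_0_0[OF zero_part[of u] zero_part[of v]]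
      fusion_0_alpha[OF zero_part[of u] alpha_part[of v]]
      fusion_0_alpha[OF zero_part[of v] alpha_part[of u]]
    by (simp add: parts_add parts_scale beta_part_diff mult_a[of u] mult_a[of v] beta_part_E
        alpha_part)
qed

lemma even_mult_odd:
  assumes "beta_part u = 0" "v \<in> E \<beta>"
  shows "u \<bullet> v \<in> E \<beta>"
proof -
  have "u \<bullet> v = (lam u *s a + zero_part u + alpha_part u) \<bullet> v"
    using decomposition[of u] assms by simp
  also have "\<dots> = (lam u * \<beta>) *s v + zero_part u \<bullet> v + alpha_part u \<bullet> v"
    using assms by (simp add: bilinear_simps E_mult)
  also have "\<dots> \<in> E \<beta>"
    using assms by (intro E_add E_scale fusion_0_beta fusion_alpha_beta zero_part alpha_part)
  finally show ?thesis .
qed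

lemma beta_part_odd_mult:
  assumes "u \<in> E \<beta>" "v \<in> E \<beta>"
  shows "beta_part (u \<bullet> v) = 0"
proof -
  obtain c x y where "x \<in> E 0" "y \<in> E \<alpha>" "u \<bullet> v = c *s a + x + y"
    using fusion_beta_beta[OF assms] by blast
  then show ?thesis by (simp add: parts_add parts_scale beta_part_E)
qed

lemma tau_mult: "tau (u \<bullet> v) = tau u \<bullet> tau v"
proof -
  define u0 u1 v0 v1 where "u0 = u - beta_part u" "u1 = beta_part u"
    "v0 = v - beta_part v" "v1 = beta_part v"
  note defs = this
  have uv: "u = u0 + u1" "v = v0 + v1" "tau u = u0 - u1" "tau v = v0 - v1"
    by (simp_all add: defs tau_def scale_left_distrib[of 1 1, simplified])
  have even: "beta_part u0 = 0" "beta_part v0 = 0" and odd: "u1 \<in> E \<beta>" "v1 \<in> E \<beta>"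
    by (simp_all add: defs beta_part_diff beta_part_E beta_part)
  have 1: "tau (u0 \<bullet> v0) = u0 \<bullet> v0" "tau (u1 \<bullet> v1) = u1 \<bullet> v1"
    using even odd by (simp_all add: tau_fixed_iff beta_part_even_mult beta_part_odd_mult)
  have 2: "tau (u0 \<bullet> v1) = - (u0 \<bullet> v1)" "tau (u1 \<bullet> v0) = - (u1 \<bullet> v0)"
    using even odd even_mult_odd by (simp_all add: tau_negated_iff mult_commute[of u1])
  have "tau (u \<bullet> v) = tau ((u0 + u1) \<bullet> (v0 + v1))" by (simp only: uv(1,2))
  also have "\<dots> = (u0 - u1) \<bullet> (v0 - v1)" by (simp add: bilinear_simps tau_add 1 2)
  finally show ?thesis by (simp only: uv(3,4))
qed

text \<open>
  For a vector fixed by \<open>\<tau>\<close> these are \<open>\<alpha>\<close> times its \<open>\<alpha>\<close>-part and \<open>\<alpha>\<close> times its \<open>0\<close>-part. The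
  factor \<open>\<alpha>\<close> keeps all formulas free of denominators.
\<close>

definition V :: "'v \<Rightarrow> 'v" where "V x = a \<bullet> x - lam x *s a"
definition U :: "'v \<Rightarrow> 'v" where "U x = \<alpha> *s x - a \<bullet> x - ((\<alpha> - 1) * lam x) *s a"

lemma V_eq: "tau x = x \<Longrightarrow> V x = \<alpha> *s alpha_part x"
  by (simp add: V_def mult_a[of x] tau_fixed_iff)

lemma U_eq:
  assumes "tau x = x"
  shows "U x = \<alpha> *s zero_part x"
proof -
  have "x = lam x *s a + zero_part x + alpha_part x"
    using decomposition[of x] assms by (simp add: tau_fixed_iff)
  from this[symmetric] have "zero_part x = x - lam x *s a - alpha_part x"
    by (simp add: algebra_simps)
  moreover have "a \<bullet> x = lam x *s a + \<alpha> *s alpha_part x"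
    using mult_a[of x] assms by (simp add: tau_fixed_iff)
  ultimately show ?thesis
    by (simp add: U_def scale_right_diff_distrib scale_left_diff_distrib left_diff_distrib)
qed

lemma mult_a_V: "tau x = x \<Longrightarrow> a \<bullet> V x = \<alpha> *s V x"
  by (simp add: V_eq mult_scale_right E_mult[OF alpha_part])

lemma zero_part_mult:
  assumes "tau y = y"
  shows "zero_part x \<bullet> y = zero_part x \<bullet> zero_part y + zero_part x \<bullet> alpha_part y"
proof -
  have "y = lam y *s a + zero_part y + alpha_part y"
    using decomposition[of y] assms by (simp add: tau_fixed_iff)
  then have "zero_part x \<bullet> y = zero_part x \<bullet> (lam y *s a + zero_part y + alpha_part y)"
    by simp
  then show ?thesis
    by (simp add: bilinear_simps mult_commute[of "zero_part x" a] E_mult[OF zero_part])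
qed

text \<open>
  The product of the \<open>0\<close>-part of \<open>x\<close> with \<open>y\<close> has a \<open>0\<close>-component and an \<open>\<alpha>\<close>-component, and
  multiplication by \<open>a\<close> keeps only the latter. So the product of a \<open>0\<close>-part with an \<open>\<alpha>\<close>-part is
  known as soon as multiplication by \<open>y\<close> and by \<open>a\<close> is.
\<close>

lemma mult_a_U:
  assumes "tau x = x" "tau y = y"
  shows "a \<bullet> (U x \<bullet> y) = U x \<bullet> V y"
proof -
  have "a \<bullet> (zero_part x \<bullet> y) = \<alpha> *s (zero_part x \<bullet> alpha_part y)"
    unfolding zero_part_mult[OF assms(2)]
    by (simp add: mult_add_right E_mult[OF fusion_0_0[OF zero_part zero_part]]
        E_mult[OF fusion_0_alpha[OF zero_part alpha_part]])
  then show ?thesis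
    by (simp add: U_eq[OF assms(1)] V_eq[OF assms(2)] mult_scale_left mult_scale_right)
qed

text \<open>
  The analogue for the \<open>\<alpha>\<close>-part of \<open>x\<close>. The product of two \<open>\<alpha>\<close>-parts lies in \<open>1 + 0\<close>, so
  multiplication by \<open>a\<close> leaves only a multiple of \<open>a\<close>; the coefficient is recovered from the
  coefficient function, because \<open>0\<close>-parts contribute nothing to it.
\<close>

lemma mult_a_V_mult:
  assumes "tau x = x" "tau y = y"
  shows "a \<bullet> (V x \<bullet> y) = V x \<bullet> U y + (\<alpha>\<^sup>2 * lam y) *s V x
    + (\<alpha> * (lam (x \<bullet> y) - lam x * lam y)) *s a"
proof -
  have x: "x = lam x *s a + zero_part x + alpha_part x"
   and y: "y = lam y *s a + zero_part y + alpha_part y"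
    using decomposition[of x] decomposition[of y] assms by (simp_all add: tau_fixed_iff)
  obtain c z where c: "z \<in> E 0" "alpha_part x \<bullet> alpha_part y = c *s a + z"
    using fusion_alpha_alpha alpha_part by blast
  have "alpha_part x \<bullet> y = alpha_part x \<bullet> (lam y *s a + zero_part y + alpha_part y)"
    using y by simp
  then have 1: "alpha_part x \<bullet> y
      = (lam y * \<alpha>) *s alpha_part x + zero_part y \<bullet> alpha_part x + (c *s a + z)"
    by (simp add: mult_add_right mult_scale_right mult_commute[of "alpha_part x" a]
        E_mult[OF alpha_part] c mult_commute[of "alpha_part x" "zero_part y"])
  have 2: "a \<bullet> (alpha_part x \<bullet> y)
      = (lam y * \<alpha>\<^sup>2) *s alpha_part x + \<alpha> *s (zero_part y \<bullet> alpha_part x) + c *s a"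
    unfolding 1
    by (simp add: mult_add_right mult_scale_right E_mult[OF alpha_part] E_mult[OF c(1)]
        E_mult[OF fusion_0_alpha[OF zero_part alpha_part]] a_idem power2_eq_square mult.assoc)
  have 3: "lam (zero_part x \<bullet> y) = 0"
    unfolding zero_part_mult[OF assms(2)]
    by (simp add: parts_add lam_E fusion_0_0[OF zero_part zero_part]
        fusion_0_alpha[OF zero_part alpha_part])
  have 4: "lam (alpha_part x \<bullet> y) = c"
    unfolding 1
    by (simp add: parts_add parts_scale lam_E lam_a alpha_part c
        fusion_0_alpha[OF zero_part alpha_part])
  have "x \<bullet> y = (lam x *s a + zero_part x + alpha_part x) \<bullet> y"
    using x by simp
  then have "lam (x \<bullet> y) = lam x * lam y + c"
    by (simp add: mult_add_left mult_scale_left parts_add parts_scale lam_mult_a 3 4)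
  then have lam_xy: "lam (x \<bullet> y) - lam x * lam y = c" by simp
  have "a \<bullet> (V x \<bullet> y) = \<alpha> *s (a \<bullet> (alpha_part x \<bullet> y))"
    using assms by (simp add: V_eq mult_scale_left mult_scale_right)
  moreover have "V x \<bullet> U y = \<alpha>\<^sup>2 *s (zero_part y \<bullet> alpha_part x)"
    using assms
    by (simp add: V_eq U_eq mult_scale_left mult_scale_right mult_commute[of "alpha_part x"]
        power2_eq_square)
  ultimately show ?thesis
    unfolding lam_xy 2 V_eq[OF assms(1)]
    by (simp add: scale_right_distrib power2_eq_square ac_simps)
qed

text \<open>
  On the \<open>\<beta>\<close>-part of \<open>x\<close> the operator \<open>x \<mapsto> a x - \<beta> x\<close> vanishes.
\<close>

lemma tau_mult_a_diff: "tau (a \<bullet> x - \<beta> *s (a + x)) = a \<bullet> x - \<beta> *s (a + x)"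
  by (simp add: tau_fixed_iff beta_part_diff parts_add parts_scale mult_a[of x] beta_part_E
      alpha_part beta_part)

end

context comm_algebra
begin

lemma additive_span_subset:
  assumes "\<And>u v. g (u + v) = g u + g v" "\<And>c v. g (c *s v) = c *s g v"
    and "subspace W" "\<And>x. x \<in> S \<Longrightarrow> g x \<in> W" "v \<in> span S"
  shows "g v \<in> W"
proof -
  have "g 0 = 0" using assms(2)[of 0 0] by simp
  then have "subspace {v. g v \<in> W}"
    using assms(1-3) by (simp add: subspace_def)
  then show ?thesis
    using span_minimal[of S "{v. g v \<in> W}"] assms(4,5) by blast
qed

lemma finite_spanning_list:
  assumes "span (set xs) = UNIV" "length xs \<le> n"
  shows "(\<exists>B. finite B \<and> span B = UNIV) \<and> dim UNIV \<le> n"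
proof -
  have "dim UNIV \<le> card (set xs)"
    using assms(1) by (intro dim_le_card) auto
  also have "\<dots> \<le> n"
    using card_length[of xs] assms(2) by linarith
  finally show ?thesis using assms(1) by blast
qed

end

section \<open>The dihedral sequence of axes\<close>

locale monster_pair = comm_algebra scale mult
  for scale :: "'f::field \<Rightarrow> 'v::ab_group_add \<Rightarrow> 'v" (infixr "*s" 75)
    and mult :: "'v \<Rightarrow> 'v \<Rightarrow> 'v" (infixl "\<bullet>" 70) +
  fixes \<alpha> \<beta> :: 'f and a0 a1 :: 'v
  assumes two_nz: "(2::'f) \<noteq> 0"
    and params: "distinct [0, 1, \<alpha>, \<beta>]"
    and axis0: "monster_axis \<alpha> \<beta> a0"
    and axis1: "monster_axis \<alpha> \<beta> a1"
    and generated: "subalgebra hull {a0, a1} = UNIV"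
begin

sublocale A0: axis_algebra scale mult \<alpha> \<beta> a0
  using two_nz params axis0 by unfold_locales

sublocale A1: axis_algebra scale mult \<alpha> \<beta> a1
  using two_nz params axis1 by unfold_locales

text \<open>
  The two generators play the same role. Every statement below comes with its mirror image, in
  which \<open>a\<^sub>i\<close> becomes \<open>a\<^bsub>1-i\<^esub>\<close> and \<open>e\<close> is exchanged with \<open>d\<close> (\<open>ax_swap\<close>, \<open>swap_simps\<close>). The swap
  is a change of the locale parameters; it need not come from an automorphism of the algebra.
\<close>

lemma swapped: "monster_pair scale mult \<alpha> \<beta> a1 a0"
  using two_nz params axis0 axis1 generated by unfold_locales (simp_all add: insert_commute)

lemmas params_nz = A0.params_nz

abbreviation t0 :: "'v \<Rightarrow> 'v" where "t0 \<equiv> A0.tau"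
abbreviation t1 :: "'v \<Rightarrow> 'v" where "t1 \<equiv> A1.tau"

definition translate :: "int \<Rightarrow> 'v \<Rightarrow> 'v" where
  "translate k = (if 0 \<le> k then (t1 \<circ> t0) ^^ nat k else (t0 \<circ> t1) ^^ nat (- k))"

definition ax :: "int \<Rightarrow> 'v" where
  "ax i = translate (i div 2) (if even i then a0 else a1)"

lemma ax_0: "ax 0 = a0" and ax_1: "ax 1 = a1"
  by (simp_all add: ax_def translate_def)

lemma translate_Suc: "t1 (t0 (translate k v)) = translate (k + 1) v"
proof (cases "0 \<le> k")
  case True
  then show ?thesis by (simp add: translate_def nat_add_distrib)
next
  case False
  define n where "n = nat (- k - 1)"
  have k: "k = - int (Suc n)" using False by (simp add: n_def)
  have "translate k v = t0 (t1 (((t0 \<circ> t1) ^^ n) v))"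
    by (simp add: k translate_def nat_add_distrib)
  moreover have "translate (k + 1) v = ((t0 \<circ> t1) ^^ n) v"
    by (cases n) (simp_all add: k translate_def nat_add_distrib)
  ultimately show ?thesis by (simp add: A0.tau_tau A1.tau_tau)
qed

lemma translate_pred: "t0 (t1 (translate k v)) = translate (k - 1) v"
  using translate_Suc[of "k - 1" v] by (metis A0.tau_tau A1.tau_tau diff_add_cancel)

lemma t0_translate: "t0 (translate k v) = translate (- k) (t0 v)"
proof (induction k rule: int_induct[where k = 0])
  case base
  then show ?case by (simp add: translate_def)
next
  case (step1 k)
  have "t0 (translate (k + 1) v) = t0 (t1 (translate (- k) (t0 v)))"
    using step1 by (simp flip: translate_Suc)
  then show ?case by (simp add: translate_pred)
next
  case (step2 k)
  have "t0 (translate (k - 1) v) = t1 (t0 (translate (- k) (t0 v)))"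
    using step2 by (simp add: A0.tau_tau flip: translate_pred) (metis A0.tau_tau)
  then show ?case by (simp add: translate_Suc)
qed

lemma t1_translate: "t1 (translate k v) = translate (- k) (t1 v)"
proof (induction k rule: int_induct[where k = 0])
  case base
  then show ?case by (simp add: translate_def)
next
  case (step1 k)
  have "t1 (translate (k + 1) v) = t0 (t1 (translate (- k) (t1 v)))"
    using step1 by (simp add: A1.tau_tau flip: translate_Suc) (metis A1.tau_tau)
  then show ?case by (simp add: translate_pred)
next
  case (step2 k)
  have "t1 (translate (k - 1) v) = t1 (t0 (translate (- k) (t1 v)))"
    using step2 by (simp flip: translate_pred)
  then show ?case by (simp add: translate_Suc)
qed

lemma t0_ax: "t0 (ax i) = ax (- i)"
proof (cases "even i")
  case True
  then obtain k where i: "i = 2 * k" by blast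
  have "(- (2 * k)) div 2 = - k" by presburger
  then show ?thesis by (simp add: ax_def i t0_translate A0.tau_a)
next
  case False
  then obtain k where i: "i = 2 * k + 1" by (elim oddE)
  have "translate k a1 = t1 (translate (- k) a1)"
    by (simp add: t1_translate A1.tau_a)
  then have "t0 (translate k a1) = translate (- k - 1) a1"
    by (simp add: translate_pred)
  moreover have "(- (2 * k) - 1) div 2 = - k - 1" by presburger
  ultimately show ?thesis by (simp add: ax_def i)
qed

lemma t1_ax: "t1 (ax i) = ax (2 - i)"
proof (cases "even i")
  case True
  then obtain k where i: "i = 2 * k" by blast
  have "translate k a0 = t0 (translate (- k) a0)"
    by (simp add: t0_translate A0.tau_a)
  then have "t1 (translate k a0) = translate (1 - k) a0"
    by (simp add: translate_Suc)
  moreover have "(2 - 2 * k) div 2 = 1 - k" by presburger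
  ultimately show ?thesis by (simp add: ax_def i)
next
  case False
  then obtain k where i: "i = 2 * k + 1" by (elim oddE)
  have "(1 - 2 * k) div 2 = - k" by presburger
  then show ?thesis by (simp add: ax_def i t1_translate A1.tau_a)
qed

lemma ax_swap: "monster_pair.ax scale mult \<alpha> \<beta> a1 a0 i = ax (1 - i)"
proof -
  interpret sw: monster_pair scale mult \<alpha> \<beta> a1 a0 by (rule swapped)
  have "sw.translate k = translate (- k)" for k
    by (auto simp: sw.translate_def translate_def)
  moreover have "(1 - i) div 2 = - (i div 2)" by presburger
  ultimately show ?thesis by (simp add: sw.ax_def ax_def)
qed

lemma ax_induct:
  assumes "P a0" "P a1" "\<And>v. P v \<Longrightarrow> P (t0 v)" "\<And>v. P v \<Longrightarrow> P (t1 v)"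
  shows "P (ax i)"
proof -
  have "P (ax i) \<and> P (ax (i + 1))"
  proof (induction i rule: int_induct[where k = 0])
    case base
    then show ?case using assms by (simp add: ax_0 ax_1)
  next
    case (step1 i)
    then have "P (t1 (t0 (ax i)))" using assms by blast
    then show ?case using step1 by (simp add: t0_ax t1_ax add.commute)
  next
    case (step2 i)
    then have "P (t0 (t1 (ax (i + 1))))" using assms by blast
    then show ?case using step2 by (simp add: t0_ax t1_ax)
  qed
  then show ?thesis ..
qed

definition sig :: "'v \<Rightarrow> 'v \<Rightarrow> 'v" where
  "sig x y = x \<bullet> y - \<beta> *s (x + y)"

lemma sig_commute: "sig x y = sig y x"
  by (simp add: sig_def mult_commute add.commute)

lemma mult_eq_sig: "x \<bullet> y = sig x y + \<beta> *s (x + y)"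
  by (simp add: sig_def)

lemma t_linear_simps:
  "t0 (u + v) = t0 u + t0 v" "t0 (u - v) = t0 u - t0 v" "t0 (- u) = - t0 u"
      "t0 (c *s u) = c *s t0 u"
  "t1 (u + v) = t1 u + t1 v" "t1 (u - v) = t1 u - t1 v" "t1 (- u) = - t1 u"
      "t1 (c *s u) = c *s t1 u"
proof -
  show 0: "t0 (u + v) = t0 u + t0 v" "t0 (c *s u) = c *s t0 u" for u v c
    by (simp_all add: A0.tau_add A0.tau_scale)
  show 1: "t1 (u + v) = t1 u + t1 v" "t1 (c *s u) = c *s t1 u" for u v c
    by (simp_all add: A1.tau_add A1.tau_scale)
  show "t0 (- u) = - t0 u" "t1 (- u) = - t1 u" for u
    using 0(2)[of "- 1" u] 1(2)[of "- 1" u] by simp_all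
  then show "t0 (u - v) = t0 u - t0 v" "t1 (u - v) = t1 u - t1 v"
    using 0(1)[of u "- v"] 1(1)[of u "- v"] by simp_all
qed

lemma t0_sig: "t0 (sig x y) = sig (t0 x) (t0 y)" and t1_sig: "t1 (sig x y) = sig (t1 x) (t1 y)"
  by (simp_all add: sig_def t_linear_simps A0.tau_mult A1.tau_mult)

lemma t0_sig_a0: "t0 (sig a0 x) = sig a0 x" and t1_sig_a1: "t1 (sig a1 x) = sig a1 x"
  unfolding sig_def by (rule A0.tau_mult_a_diff A1.tau_mult_a_diff)+

text \<open>
  This is invariance of \<open>sig a\<^sub>i v\<close> under the reflection that fixes \<open>a\<^sub>i\<close>. It is known for \<open>a\<^sub>0\<close>
  and \<open>a\<^sub>1\<close>, and it is carried along the sequence by the translation \<open>\<tau>\<^sub>1 \<tau>\<^sub>0\<close>, which shifts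
  indices by two.
\<close>

lemma sig_reflect: "sig (ax i) (ax (i - n)) = sig (ax i) (ax (i + n))"
proof -
  have "\<forall>n. sig (ax i) (ax (i - n)) = sig (ax i) (ax (i + n))
      \<and> sig (ax (i + 1)) (ax (i + 1 - n)) = sig (ax (i + 1)) (ax (i + 1 + n))"
  proof (induction i rule: int_induct[where k = 0])
    case base
    have "sig (ax 0) (ax (- n)) = sig (ax 0) (ax n)" for n
      using t0_sig_a0[of "ax n"] by (simp add: t0_sig t0_ax A0.tau_a ax_0)
    moreover have "sig (ax 1) (ax (1 - n)) = sig (ax 1) (ax (1 + n))" for n
      using t1_sig_a1[of "ax (1 + n)"] by (simp add: t1_sig t1_ax A1.tau_a ax_1)
    ultimately show ?case by simp
  next
    case (step1 i)
    have "sig (ax (i + 2)) (ax (i + 2 - n)) = sig (ax (i + 2)) (ax (i + 2 + n))" for n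
      using arg_cong[OF conjunct1[OF step1(2)[rule_format, of n]], of "\<lambda>v. t1 (t0 v)"]
      by (simp add: t0_sig t0_ax t1_sig t1_ax algebra_simps)
    then show ?case using step1(2) by (simp add: add.assoc)
  next
    case (step2 i)
    have "sig (ax (i - 1)) (ax (i - 1 - n)) = sig (ax (i - 1)) (ax (i - 1 + n))" for n
      using arg_cong[OF conjunct2[OF step2(2)[rule_format, of n]], of "\<lambda>v. t0 (t1 v)"]
      by (simp add: t0_sig t0_ax t1_sig t1_ax algebra_simps)
    then show ?case using step2(2) by simp
  qed
  then show ?thesis by blast
qed

definition s :: 'v where "s = sig a0 a1"
definition e :: 'v where "e = sig a0 (ax 2)"
definition d :: 'v where "d = sig a1 (ax (- 1))"

lemma sig_adjacent: "sig (ax i) (ax (i + 1)) = s"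
proof (induction i rule: int_induct[where k = 0])
  case base
  then show ?case by (simp add: s_def ax_0 ax_1)
next
  case (step1 i)
  then show ?case using sig_reflect[of "i + 1" 1] by (simp add: sig_commute)
next
  case (step2 i)
  then show ?case using sig_reflect[of i 1] by (simp add: sig_commute)
qed

lemma sig_even: "even i \<Longrightarrow> sig (ax i) (ax (i + 2)) = e"
proof (induction "i div 2" arbitrary: i rule: int_induct[where k = 0])
  case base
  then have "i = 0" by presburger
  then show ?case by (simp add: e_def ax_0)
next
  case (step1 k)
  then have "sig (ax (i - 2)) (ax (i - 2 + 2)) = e" by (intro step1(2)) presburger+
  then show ?case using sig_reflect[of i 2] by (simp add: sig_commute)
next
  case (step2 k)
  then have "sig (ax (i + 2)) (ax (i + 2 + 2)) = e" by (intro step2(2)) presburger+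
  then show ?case using sig_reflect[of "i + 2" 2] by (simp add: sig_commute add.assoc)
qed

lemma swap_simps:
  "monster_pair.s scale mult \<beta> a1 a0 = s"
  "monster_pair.e scale mult \<alpha> \<beta> a1 a0 = d"
  "monster_pair.d scale mult \<alpha> \<beta> a1 a0 = e"
proof -
  interpret sw: monster_pair scale mult \<alpha> \<beta> a1 a0 by (rule swapped)
  show "sw.s = s" "sw.e = d" "sw.d = e"
    by (simp_all add: sw.s_def s_def sw.e_def e_def sw.d_def d_def ax_swap sig_commute)
qed

lemma t_fixed: "t0 s = s" "t1 s = s" "t0 e = e" "t1 e = e" "t0 d = d" "t1 d = d"
proof -
  show "t0 s = s" "t0 e = e" "t1 d = d"
    unfolding s_def e_def d_def by (rule t0_sig_a0 t1_sig_a1)+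
  show "t1 s = s"
    unfolding s_def sig_commute[of a0] by (rule t1_sig_a1)
  have "t1 (sig (ax 0) (ax 2)) = sig (ax 0) (ax 2)"
    by (simp add: t1_sig t1_ax sig_commute[of "ax 2"])
  then show "t1 e = e" by (simp add: e_def ax_0)
  have "t0 (sig (ax 1) (ax (- 1))) = sig (ax 1) (ax (- 1))"
    by (simp add: t0_sig t0_ax sig_commute[of "ax (- 1)"])
  then show "t0 d = d" by (simp add: d_def ax_1)
qed

section \<open>Subspaces that exhaust the algebra\<close>

definition stable :: "'v set \<Rightarrow> bool" where
  "stable W \<longleftrightarrow> subspace W \<and> a0 \<in> W \<and> a1 \<in> W \<and>
     (\<forall>w\<in>W. t0 w \<in> W \<and> t1 w \<in> W \<and> a0 \<bullet> w \<in> W \<and> a1 \<bullet> w \<in> W)"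

definition multipliers :: "'v set \<Rightarrow> 'v set" where
  "multipliers W = {y. \<forall>x\<in>W. y \<bullet> x \<in> W}"

lemma subspace_multipliers: "subspace W \<Longrightarrow> subspace (multipliers W)"
  by (auto simp: multipliers_def subspace_def bilinear_simps)

lemma ax_in_multipliers:
  assumes "stable W"
  shows "ax i \<in> multipliers W"
proof (induction rule: ax_induct)
  case 1
  then show ?case using assms by (simp add: stable_def multipliers_def)
next
  case 2
  then show ?case using assms by (simp add: stable_def multipliers_def)
next
  case (3 v)
  have "t0 v \<bullet> x = t0 (v \<bullet> t0 x)" for x by (simp add: A0.tau_mult A0.tau_tau)
  then show ?case using 3 assms by (simp add: stable_def multipliers_def)
next
  case (4 v)
  have "t1 v \<bullet> x = t1 (v \<bullet> t1 x)" for x by (simp add: A1.tau_mult A1.tau_tau)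
  then show ?case using 4 assms by (simp add: stable_def multipliers_def)
qed

text \<open>
  The heart of the closure principle. With \<open>y\<close> a multiplier of \<open>W\<close>, the identities \<open>mult_a_U\<close> and
  \<open>mult_a_V_mult\<close> show that \<open>U x \<bullet> V y\<close> and \<open>V x \<bullet> U y\<close> lie in \<open>W\<close>. Since \<open>U y + V y\<close> is a
  combination of \<open>y\<close> and \<open>a\<^sub>0\<close>, so does \<open>V x \<bullet> V y\<close>; and \<open>U x + V x\<close> is a combination of \<open>x\<close> and
  \<open>a\<^sub>0\<close>, whence the product of \<open>x\<close> with \<open>V y\<close>, that is, with \<open>a\<^sub>0 y\<close>, lies in \<open>W\<close>.
\<close>

lemma stable_mult_a0_mult:
  assumes W: "stable W" and y: "y \<in> W" "y \<in> multipliers W" "t0 y = y" and x: "x \<in> W" "t0 x = x"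
  shows "x \<bullet> (a0 \<bullet> y) \<in> W"
proof -
  have sub: "subspace W" and a0: "a0 \<in> W" "\<And>w. w \<in> W \<Longrightarrow> a0 \<bullet> w \<in> W"
    using W by (auto simp: stable_def)
  note mem = subspace_add[OF sub] subspace_diff[OF sub] subspace_scale[OF sub]
  have ym: "w \<bullet> y \<in> W" if "w \<in> W" for w
    using y(2) that by (simp add: multipliers_def mult_commute)
  have UV: "A0.U x \<in> W" "A0.V x \<in> W" "A0.V y \<in> W"
    using x y by (auto simp: A0.U_def A0.V_def intro!: mem a0)
  have 1: "A0.U x \<bullet> A0.V y \<in> W"
    using A0.mult_a_U[OF x(2) y(3)] a0(2)[OF ym[OF UV(1)]] by simp
  have "A0.V x \<bullet> A0.U y = a0 \<bullet> (A0.V x \<bullet> y) - (\<alpha>\<^sup>2 * A0.lam y) *s A0.V x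
      - (\<alpha> * (A0.lam (x \<bullet> y) - A0.lam x * A0.lam y)) *s a0"
    using A0.mult_a_V_mult[OF x(2) y(3)] by simp
  then have 2: "A0.V x \<bullet> A0.U y \<in> W"
    using a0 UV ym by (simp add: mem)
  have sum: "A0.U z + A0.V z = \<alpha> *s (z - A0.lam z *s a0)" for z
    by (rule eq_if_functionals_eq) (simp add: functional_simps A0.U_def A0.V_def algebra_simps)
  have "A0.V x \<bullet> (A0.U y + A0.V y) \<in> W"
    unfolding sum using UV ym a0(2)[OF UV(2)]
    by (simp add: bilinear_simps mult_commute[of "A0.V x" a0] mem)
  then have "A0.V x \<bullet> A0.V y \<in> W"
    using 2 subspace_diff[OF sub] by (fastforce simp: mult_add_right)
  with 1 have "(A0.U x + A0.V x) \<bullet> A0.V y \<in> W"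
    by (simp add: mult_add_left mem)
  then have "\<alpha> *s ((x - A0.lam x *s a0) \<bullet> A0.V y) \<in> W"
    by (simp add: sum mult_scale_left)
  then have "inverse \<alpha> *s (\<alpha> *s ((x - A0.lam x *s a0) \<bullet> A0.V y)) \<in> W"
    by (rule subspace_scale[OF sub])
  then have "x \<bullet> A0.V y - A0.lam x *s (a0 \<bullet> A0.V y) \<in> W"
    using params_nz by (simp add: bilinear_simps)
  from subspace_add[OF sub this subspace_scale[OF sub a0(2)[OF UV(3)], of "A0.lam x"]]
  have "x \<bullet> A0.V y \<in> W" by simp
  moreover have "x \<bullet> (a0 \<bullet> y) = x \<bullet> A0.V y + A0.lam y *s (a0 \<bullet> x)"
    by (simp add: A0.V_def bilinear_simps mult_commute)
  ultimately show ?thesis using x a0 by (simp add: mem)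
qed

lemma stable_eq_UNIV:
  assumes W: "stable W" "W \<subseteq> span (range ax \<union> Z)" "Z \<subseteq> W"
    and Z: "\<And>z z'. z \<in> Z \<Longrightarrow> z' \<in> Z \<Longrightarrow> z \<bullet> z' \<in> W"
  shows "W = UNIV"
proof -
  have sub: "subspace W" using W(1) by (simp add: stable_def)
  have "z \<bullet> x \<in> W" if "z \<in> Z" "x \<in> W" for x z
  proof (rule additive_span_subset[where g = "\<lambda>x. z \<bullet> x" and S = "range ax \<union> Z"])
    fix y assume "y \<in> range ax \<union> Z"
    then show "z \<bullet> y \<in> W"
      using that W Z ax_in_multipliers by (fastforce simp: multipliers_def mult_commute)
  qed (use sub that W in \<open>auto simp: bilinear_simps\<close>)
  then have "range ax \<union> Z \<subseteq> multipliers W"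
    using ax_in_multipliers[OF W(1)] by (auto simp: multipliers_def)
  then have "W \<subseteq> multipliers W"
    using W(2) span_minimal[OF _ subspace_multipliers[OF sub]] by blast
  then have "subalgebra W"
    using sub by (auto simp: subalgebra_def multipliers_def)
  moreover have "{a0, a1} \<subseteq> W" using W(1) by (simp add: stable_def)
  ultimately show ?thesis using generated hull_minimal[of "{a0, a1}" W subalgebra] by blast
qed

text \<open>
  An automorphism that fixes both generators is the identity.
\<close>

lemma t0_id: "t0 a1 = a1 \<Longrightarrow> t0 v = v"
proof -
  assume a1: "t0 a1 = a1"
  have "subalgebra {v. t0 v = v}"
    using t_linear_simps(4)[of 0 0]
    by (auto simp: subalgebra_def subspace_def t_linear_simps A0.tau_mult)
  then have "subalgebra hull {a0, a1} \<subseteq> {v. t0 v = v}"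
    using a1 A0.tau_a by (intro hull_minimal) auto
  then show ?thesis using generated by auto
qed

end

context axis_algebra
begin

lemma lam_tau: "lam (tau v) = lam v"
  by (simp add: tau_def lam_diff parts_scale lam_E beta_part)

lemma mult_a_mult_a: "tau x = x \<Longrightarrow> a \<bullet> (a \<bullet> x) = \<alpha> *s (a \<bullet> x) + ((1 - \<alpha>) * lam x) *s a"
  using mult_a_V[of x]
  by (simp add: V_def product_diff_right mult_scale_right a_idem scale_right_diff_distrib
      scale_left_diff_distrib left_diff_distrib algebra_simps)

end

context monster_pair
begin

section \<open>Products with the axis \<open>a\<^sub>0\<close> and the square of \<open>s\<close>\<close>

definition p :: 'v where "p = ax 1 + ax (- 1)"
definition q :: 'v where "q = ax 2 + ax (- 2)"

abbreviation l :: 'f where "l \<equiv> A0.lam a1"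
abbreviation m :: 'f where "m \<equiv> A1.lam a0"

lemma p_fixed: "t0 p = p" and q_fixed: "t0 q = q"
  by (simp_all add: p_def q_def t_linear_simps t0_ax add.commute)

lemma lam_p: "A0.lam p = 2 * l"
proof -
  have "A0.lam (ax (- 1)) = A0.lam (t0 (ax 1))" by (simp add: t0_ax)
  then show ?thesis by (simp add: p_def A0.parts_add A0.lam_tau ax_1)
qed

lemma ax_idem: "ax i \<bullet> ax i = ax i"
  by (rule ax_induct) (simp_all add: A0.a_idem A1.a_idem flip: A0.tau_mult A1.tau_mult)

lemma a0_mult_add_t0: "a0 \<bullet> (x + t0 x) = 2 *s sig a0 x + (2 * \<beta>) *s a0 + \<beta> *s (x + t0 x)"
proof -
  have "sig a0 (t0 x) = sig a0 x"
    using t0_sig_a0[of x] by (simp add: t0_sig A0.tau_a)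
  then show ?thesis
    by (intro eq_if_functionals_eq)
       (simp add: functional_simps bilinear_simps mult_eq_sig[of a0 x] mult_eq_sig[of a0
           "t0 x"] algebra_simps)
qed

text \<open>
  For the fixed vector \<open>y = x + \<tau>\<^sub>0 x\<close> one has \<open>a\<^sub>0 y = 2 sig a\<^sub>0 x + 2 \<beta> a\<^sub>0 + \<beta> y\<close>. The
  quadratic relation \<open>mult_a_mult_a\<close> of multiplication by \<open>a\<^sub>0\<close> on fixed vectors then evaluates
  \<open>a\<^sub>0 (a\<^sub>0 y)\<close>.
\<close>

lemma a0_mult_sig:
  "2 *s (a0 \<bullet> sig a0 x) = (2 * (\<alpha> - \<beta>)) *s sig a0 x + (\<beta> * (\<alpha> - \<beta>)) *s (x + t0 x)
     + (2 * ((\<alpha> - 1) * (\<beta> - A0.lam x) - \<beta>\<^sup>2)) *s a0"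
proof (rule eq_if_functionals_eq)
  fix f assume f: "functional f"
  let ?y = "x + t0 x"
  have y: "t0 ?y = ?y" "A0.lam ?y = 2 * A0.lam x"
    by (simp_all add: t_linear_simps A0.tau_tau add.commute A0.parts_add A0.lam_tau)
  have "f (a0 \<bullet> (a0 \<bullet> ?y)) = f (\<alpha> *s (a0 \<bullet> ?y) + ((1 - \<alpha>) * A0.lam ?y) *s a0)"
    by (simp only: A0.mult_a_mult_a[OF y(1)])
  moreover have "f (a0 \<bullet> (a0 \<bullet> ?y)) = f (a0 \<bullet> (2 *s sig a0 x + (2 * \<beta>) *s a0 + \<beta> *s ?y))"
    by (simp only: a0_mult_add_t0)
  moreover have "f (a0 \<bullet> ?y) = f (2 *s sig a0 x + (2 * \<beta>) *s a0 + \<beta> *s ?y)"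
    by (simp only: a0_mult_add_t0)
  ultimately show "f (2 *s (a0 \<bullet> sig a0 x)) = f ((2 * (\<alpha> - \<beta>)) *s sig a0 x + (\<beta> * (\<alpha> - \<beta>)) *s ?y
     + (2 * ((\<alpha> - 1) * (\<beta> - A0.lam x) - \<beta>\<^sup>2)) *s a0)"
    unfolding y(2) mult_add_right[of a0 "2 *s sig a0 x + (2 * \<beta>) *s a0" "\<beta> *s ?y"]
      mult_add_right[of a0 "2 *s sig a0 x" "(2 * \<beta>) *s a0"] mult_scale_right A0.a_idem
      functional_simps[OF f]
    by algebra
qed

lemma a0_mult_p: "a0 \<bullet> p = 2 *s s + (2 * \<beta>) *s a0 + \<beta> *s p"
  using a0_mult_add_t0[of a1] t0_ax[of 1] by (simp add: p_def s_def ax_1)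

lemma a0_mult_q: "a0 \<bullet> q = 2 *s e + (2 * \<beta>) *s a0 + \<beta> *s q"
  using a0_mult_add_t0[of "ax 2"] by (simp add: q_def e_def t0_ax)

lemma a0_mult_s: "2 *s (a0 \<bullet> s) = (2 * (\<alpha> - \<beta>)) *s s + (\<beta> * (\<alpha> - \<beta>)) *s p
     + (2 * ((\<alpha> - 1) * (\<beta> - l) - \<beta>\<^sup>2)) *s a0"
  using a0_mult_sig[of a1] t0_ax[of 1] by (simp add: p_def s_def ax_1)

lemma p_mult_p: "p \<bullet> p = (1 + 2 * \<beta>) *s p + 2 *s d"
proof -
  have 1: "ax 1 \<bullet> ax (- 1) = d + \<beta> *s (ax 1 + ax (- 1))"
    using mult_eq_sig[of a1 "ax (- 1)"] by (simp add: d_def ax_1)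
  show ?thesis
    by (rule eq_if_functionals_eq)
       (simp add: functional_simps p_def bilinear_simps ax_idem 1 mult_commute[of "ax (- 1)" "ax 1"]
         algebra_simps)
qed

lemma a1_mult_s: "2 *s (a1 \<bullet> s) = (2 * (\<alpha> - \<beta>)) *s s + (\<beta> * (\<alpha> - \<beta>)) *s (a0 + ax 2)
     + (2 * ((\<alpha> - 1) * (\<beta> - m) - \<beta>\<^sup>2)) *s a1"
proof -
  interpret sw: monster_pair scale mult \<alpha> \<beta> a1 a0 by (rule swapped)
  have "sig a1 a0 = s" by (simp add: s_def sig_commute)
  then show ?thesis using sw.a0_mult_sig[of a0] t1_ax[of 0] by (simp add: ax_0)
qed

lemma s_mult_p: "2 *s (s \<bullet> p) = (4 * (\<alpha> - \<beta>)) *s s + (\<beta> * (\<alpha> - \<beta>)) *s (2 *s a0 + q)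
     + (2 * ((\<alpha> - 1) * (\<beta> - m) - \<beta>\<^sup>2)) *s p"
proof -
  have "2 *s (s \<bullet> p) = 2 *s (a1 \<bullet> s) + t0 (2 *s (a1 \<bullet> s))"
    using t0_ax[of 1]
    by (simp add: p_def ax_1 t_linear_simps A0.tau_mult t_fixed bilinear_simps scale_right_distrib
        mult_commute[of s])
  also have "\<dots> = (4 * (\<alpha> - \<beta>)) *s s + (\<beta> * (\<alpha> - \<beta>)) *s (2 *s a0 + q)
     + (2 * ((\<alpha> - 1) * (\<beta> - m) - \<beta>\<^sup>2)) *s p"
    unfolding a1_mult_s
    using t0_ax[of 1] t0_ax[of 2]
    by (intro eq_if_functionals_eq)
       (simp add: functional_simps t_linear_simps t_fixed p_def q_def ax_1 A0.tau_a algebra_simps)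
  finally show ?thesis .
qed

lemma V_p: "A0.V p = 2 *s s + (2 * \<beta> - 2 * l) *s a0 + \<beta> *s p"
  by (simp add: A0.V_def lam_p a0_mult_p scale_left_diff_distrib)

lemma U_p: "A0.U p = (\<alpha> - \<beta>) *s p - 2 *s s - (2 * \<beta> + 2 * (\<alpha> - 1) * l) *s a0"
  by (rule eq_if_functionals_eq)
     (simp add: functional_simps A0.U_def lam_p a0_mult_p algebra_simps)

text \<open>
  The table of products that enter the two fusion identities for \<open>x = y = p\<close>. The unknown products
  are \<open>a\<^sub>0 d\<close>, which comes in through \<open>a\<^sub>0 (p p)\<close>, and \<open>s s\<close>.
\<close>

lemma functional_expansions:
  assumes f: "functional f"
  shows "f (a0 \<bullet> p) = 2 * f s + 2 * \<beta> * f a0 + \<beta> * f p"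
    "f (a0 \<bullet> q) = 2 * f e + 2 * \<beta> * f a0 + \<beta> * f q"
    "2 * f (a0 \<bullet> s) = 2 * (\<alpha> - \<beta>) * f s + \<beta> * (\<alpha> - \<beta>) * f p
      + 2 * ((\<alpha> - 1) * (\<beta> - l) - \<beta>\<^sup>2) * f a0"
    "f (p \<bullet> p) = (1 + 2 * \<beta>) * f p + 2 * f d"
    "2 * f (s \<bullet> p) = 4 * (\<alpha> - \<beta>) * f s + \<beta> * (\<alpha> - \<beta>) * (2 * f a0 + f q)
      + 2 * ((\<alpha> - 1) * (\<beta> - m) - \<beta>\<^sup>2) * f p"
    "f (a0 \<bullet> (p \<bullet> p)) = (1 + 2 * \<beta>) * f (a0 \<bullet> p) + 2 * f (a0 \<bullet> d)"
    "2 * f (a0 \<bullet> (s \<bullet> p)) = 4 * (\<alpha> - \<beta>) * f (a0 \<bullet> s) + \<beta> * (\<alpha> - \<beta>) * (2 * f a0 + f (a0 \<bullet> q))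
      + 2 * ((\<alpha> - 1) * (\<beta> - m) - \<beta>\<^sup>2) * f (a0 \<bullet> p)"
    "f (a0 \<bullet> (a0 \<bullet> p)) = \<alpha> * f (a0 \<bullet> p) + (1 - \<alpha>) * (2 * l) * f a0"
proof -
  note fs = functional_simps[OF f] and fs' = functional_simps[OF functional_mult[OF f, of a0]]
  show "f (a0 \<bullet> p) = 2 * f s + 2 * \<beta> * f a0 + \<beta> * f p"
    by (simp only: a0_mult_p fs)
  show "f (a0 \<bullet> q) = 2 * f e + 2 * \<beta> * f a0 + \<beta> * f q"
    by (simp only: a0_mult_q fs)
  show "2 * f (a0 \<bullet> s) = 2 * (\<alpha> - \<beta>) * f s + \<beta> * (\<alpha> - \<beta>) * f p
      + 2 * ((\<alpha> - 1) * (\<beta> - l) - \<beta>\<^sup>2) * f a0"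
    using arg_cong[OF a0_mult_s, of f] by (simp only: fs)
  show "f (p \<bullet> p) = (1 + 2 * \<beta>) * f p + 2 * f d"
    by (simp only: p_mult_p fs)
  show "2 * f (s \<bullet> p) = 4 * (\<alpha> - \<beta>) * f s + \<beta> * (\<alpha> - \<beta>) * (2 * f a0 + f q)
      + 2 * ((\<alpha> - 1) * (\<beta> - m) - \<beta>\<^sup>2) * f p"
    using arg_cong[OF s_mult_p, of f] by (simp only: fs)
  show "f (a0 \<bullet> (p \<bullet> p)) = (1 + 2 * \<beta>) * f (a0 \<bullet> p) + 2 * f (a0 \<bullet> d)"
    by (simp only: p_mult_p fs')
  show "2 * f (a0 \<bullet> (s \<bullet> p)) = 4 * (\<alpha> - \<beta>) * f (a0 \<bullet> s) + \<beta> * (\<alpha> - \<beta>) * (2 * f a0 + f (a0 \<bullet> q))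
      + 2 * ((\<alpha> - 1) * (\<beta> - m) - \<beta>\<^sup>2) * f (a0 \<bullet> p)"
    using arg_cong[OF s_mult_p, of "\<lambda>v. f (a0 \<bullet> v)"] by (simp only: fs' A0.a_idem)
  show "f (a0 \<bullet> (a0 \<bullet> p)) = \<alpha> * f (a0 \<bullet> p) + (1 - \<alpha>) * (2 * l) * f a0"
    by (simp only: A0.mult_a_mult_a[OF p_fixed] fs lam_p)
qed

lemma mult_U_p_p:
  "A0.U p \<bullet> x = (\<alpha> - \<beta>) *s (p \<bullet> x) - 2 *s (s \<bullet> x) - (2 * \<beta> + 2 * (\<alpha> - 1) * l) *s (a0 \<bullet> x)"
  "A0.V p \<bullet> x = 2 *s (s \<bullet> x) + (2 * \<beta> - 2 * l) *s (a0 \<bullet> x) + \<beta> *s (p \<bullet> x)"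
  unfolding U_p V_p by (simp_all add: bilinear_simps)

text \<open>
  Abbreviations for structure constants: \<open>U p - V p\<close> contains \<open>a\<^sub>0\<close> with coefficient \<open>- gam\<close>; \<open>c0\<close>
  and \<open>c1\<close> are the coefficients of the axis in \<open>a\<^sub>0 s\<close> and in \<open>a\<^sub>1 s\<close>; \<open>bb\<close> collects the
  contributions to \<open>a0_mult_d\<close> that are proportional to \<open>a\<^sub>0 p\<close>, and \<open>gg\<close> those to \<open>s_mult_s\<close>.
\<close>

definition gam where "gam = 4 * \<beta> + (2 * \<alpha> - 4) * l"
definition c0 where "c0 = (\<alpha> - 1) * (\<beta> - l) - \<beta>\<^sup>2"
definition c1 where "c1 = (\<alpha> - 1) * (\<beta> - m) - \<beta>\<^sup>2"
definition bb where "bb = 4 * c1 - (\<alpha> - 2 * \<beta>) * (1 + 2 * \<beta>) + \<alpha> * gam - 2 * \<alpha>\<^sup>2 * l"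

text \<open>
  The difference of the two fusion identities for \<open>x = y = p\<close>: it contains no \<open>s s\<close>, since
  \<open>U p \<bullet> V p\<close> occurs in both. Up to a common factor, \<open>a\<^sub>0 d\<close> enters with coefficient \<open>\<alpha> - \<beta>\<close> from
  the first identity and with \<open>\<beta>\<close> from the second, which explains \<open>\<alpha> - 2 \<beta>\<close>.
\<close>

lemma a0_mult_d:
  "(2 * (\<alpha> - 2 * \<beta>)) *s (a0 \<bullet> d) = (2 * \<beta> * (\<alpha> - \<beta>)) *s (2 *s e + \<beta> *s q)
     + (8 * (\<alpha> - \<beta>)\<^sup>2 + 2 * bb) *s s + (4 * \<beta> * (\<alpha> - \<beta>)\<^sup>2 + \<beta> * bb) *s p
     + (8 * (\<alpha> - \<beta>) * c0 + 4 * \<beta> * (\<alpha> - \<beta>) + 4 * \<beta>\<^sup>2 * (\<alpha> - \<beta>)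
        + 2 * \<beta> * (4 * c1 - (\<alpha> - 2 * \<beta>) * (1 + 2 * \<beta>)) + gam * (2 * \<alpha> * \<beta> + 2 * (1 - \<alpha>) * l)
        - 2 * \<alpha>\<^sup>2 * l * (2 * \<beta> - 2 * l)
        - \<alpha> * (2 * l * (1 + 2 * \<beta>) + 2 * A0.lam d - 4 * l\<^sup>2)) *s a0"
proof (rule eq_if_functionals_eq)
  fix f assume f: "functional f"
  note fs = functional_simps[OF f] and fx = functional_expansions[OF f]
  have lam_pp: "A0.lam (p \<bullet> p) = 2 * l * (1 + 2 * \<beta>) + 2 * A0.lam d"
    by (simp add: p_mult_p A0.parts_add A0.parts_scale lam_p)
  have "a0 \<bullet> (A0.V p \<bullet> p) = a0 \<bullet> (A0.U p \<bullet> p) + (\<alpha>\<^sup>2 * (2 * l)) *s A0.V p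
      + (\<alpha> * (2 * l * (1 + 2 * \<beta>) + 2 * A0.lam d - 2 * l * (2 * l))) *s a0"
    using A0.mult_a_V_mult[OF p_fixed p_fixed] A0.mult_a_U[OF p_fixed p_fixed]
    by (simp only: lam_pp lam_p mult_commute[of "A0.V p" "A0.U p"])
  from arg_cong[OF this, of f]
  have "2 * f (a0 \<bullet> (s \<bullet> p)) + (2 * \<beta> - 2 * l) * f (a0 \<bullet> (a0 \<bullet> p)) + \<beta> * f (a0 \<bullet> (p \<bullet> p))
     = (\<alpha> - \<beta>) * f (a0 \<bullet> (p \<bullet> p)) - 2 * f (a0 \<bullet> (s \<bullet> p)) - (2 * \<beta> + 2 * (\<alpha>
         - 1) * l) * f (a0 \<bullet> (a0 \<bullet> p))
      + \<alpha>\<^sup>2 * (2 * l) * (2 * f s + (2 * \<beta> - 2 * l) * f a0 + \<beta> * f p)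
      + \<alpha> * (2 * l * (1 + 2 * \<beta>) + 2 * A0.lam d - 2 * l * (2 * l)) * f a0"
    unfolding mult_U_p_p unfolding V_p
    by (simp only: mult_add_right product_diff_right mult_scale_right fs)
  then show "f ((2 * (\<alpha> - 2 * \<beta>)) *s (a0 \<bullet> d)) = f ((2 * \<beta> * (\<alpha> - \<beta>)) *s (2 *s e + \<beta> *s q)
     + (8 * (\<alpha> - \<beta>)\<^sup>2 + 2 * bb) *s s + (4 * \<beta> * (\<alpha> - \<beta>)\<^sup>2 + \<beta> * bb) *s p
     + (8 * (\<alpha> - \<beta>) * c0 + 4 * \<beta> * (\<alpha> - \<beta>) + 4 * \<beta>\<^sup>2 * (\<alpha> - \<beta>)
        + 2 * \<beta> * (4 * c1 - (\<alpha> - 2 * \<beta>) * (1 + 2 * \<beta>)) + gam * (2 * \<alpha> * \<beta> + 2 * (1 - \<alpha>) * l)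
        - 2 * \<alpha>\<^sup>2 * l * (2 * \<beta> - 2 * l)
        - \<alpha> * (2 * l * (1 + 2 * \<beta>) + 2 * A0.lam d - 4 * l\<^sup>2)) *s a0)"
    using fx
    unfolding fs bb_def gam_def c0_def c1_def
    by algebra
qed

definition gg where
  "gg = (2 * \<beta> - 2 * l) * (\<alpha> - \<beta>) + (2 * \<beta> + 2 * (\<alpha> - 1) * l) * (\<alpha> - \<beta>)
     - (\<alpha> - \<beta>) * (1 + 2 * \<beta>) + 2 * c1"

text \<open>
  The first fusion identity for \<open>x = y = p\<close>, solved for \<open>s s\<close>.
\<close>

lemma s_mult_s:
  "4 *s (s \<bullet> s) = (- 2 * (\<alpha> - \<beta>)) *s (a0 \<bullet> d) + (2 * \<beta> * (\<alpha> - \<beta>)) *s (d + e)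
     + (\<beta> * (\<alpha> - \<beta>)\<^sup>2) *s q
     + (4 * (\<alpha> - 2 * \<beta>) * (\<alpha> - \<beta>) + 2 * gg - 2 * gam * (\<alpha> - \<beta>) + 4 * (\<alpha> - \<beta>)\<^sup>2) *s s
     + ((2 * \<alpha> - 4 * \<beta>) * c1 + \<beta> * (\<alpha> - \<beta>) * (1 + 2 * \<beta>) + \<beta> * gg
        - gam * \<beta> * (\<alpha> - \<beta>) + 2 * \<beta> * (\<alpha> - \<beta>)\<^sup>2) *s p
     + ((2 * \<alpha> - 4 * \<beta>) * \<beta> * (\<alpha> - \<beta>) + 2 * \<beta> * gg - 2 * gam * c0
        - (2 * \<beta> + 2 * (\<alpha> - 1) * l) * (2 * \<beta> - 2 * l) + 4 * (\<alpha> - \<beta>) * c0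
        + \<beta> * (\<alpha> - \<beta>) * (2 + 2 * \<beta>) + (2 * \<beta> + 2 * (\<alpha> - 1) * l) * (1 - \<alpha>) * 2 * l) *s a0"
  (is "?L = ?R")
proof (rule eq_if_functionals_eq)
  fix f assume f: "functional f"
  note fs = functional_simps[OF f] and fx = functional_expansions[OF f]
  from arg_cong[OF A0.mult_a_U[OF p_fixed p_fixed], of f]
  have "(\<alpha> - \<beta>) * f (a0 \<bullet> (p \<bullet> p)) - 2 * f (a0 \<bullet> (s \<bullet> p)) - (2 * \<beta> + 2 * (\<alpha>
      - 1) * l) * f (a0 \<bullet> (a0 \<bullet> p))
     = (\<alpha> - \<beta>) * (2 * f (s \<bullet> p) + (2 * \<beta> - 2 * l) * f (a0 \<bullet> p) + \<beta> * f (p \<bullet> p))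
      - 2 * (2 * f (s \<bullet> s) + (2 * \<beta> - 2 * l) * f (a0 \<bullet> s) + \<beta> * f (s \<bullet> p))
      - (2 * \<beta> + 2 * (\<alpha> - 1) * l) * (2 * f (a0 \<bullet> s) + (2 * \<beta> - 2 * l) * f a0 + \<beta> * f (a0 \<bullet> p))"
    unfolding mult_U_p_p(1) unfolding V_p
    by (simp only: mult_add_right product_diff_right mult_scale_right fs A0.a_idem
        mult_commute[of p s] mult_commute[of p a0] mult_commute[of s a0])
  then show "f ?L = f ?R"
    using fx
    unfolding fs gam_def gg_def c0_def c1_def
    by algebra
qed

end

context comm_algebra
begin

lemma mem_span_if_scale:
  assumes "c *s v \<in> span S" "c \<noteq> 0"
  shows "v \<in> span S"
  using span_scale[OF assms(1), of "inverse c"] assms(2) by simp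

lemmas span_intros = span_add span_diff span_scale span_neg span_zero

end

context monster_pair
begin

lemma functional_t0: "functional f \<Longrightarrow> functional (\<lambda>v. f (t0 v))"
  by (auto simp: functional_def Vector_Spaces.linear_iff t_linear_simps)

abbreviation dim_le_8 :: bool where
  "dim_le_8 \<equiv> (\<exists>B. finite B \<and> span B = UNIV) \<and> dim UNIV \<le> 8"

lemma a0_mult_ax: "a0 \<bullet> ax 0 = ax 0" "a0 \<bullet> ax 1 = s + \<beta> *s (ax 0 + ax 1)"
  "a0 \<bullet> ax (- 1) = s + \<beta> *s (ax 0 + ax (- 1))"
  "a0 \<bullet> ax 2 = e + \<beta> *s (ax 0 + ax 2)" "a0 \<bullet> ax (- 2) = e + \<beta> *s (ax 0 + ax (- 2))"
proof -
  have "sig a0 (ax (- 1)) = s" "sig a0 (ax (- 2)) = e"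
    using sig_reflect[of 0 1] sig_reflect[of 0 2] by (simp_all add: s_def e_def ax_0 ax_1)
  then show "a0 \<bullet> ax 0 = ax 0" "a0 \<bullet> ax 1 = s + \<beta> *s (ax 0 + ax 1)"
    "a0 \<bullet> ax (- 1) = s + \<beta> *s (ax 0 + ax (- 1))"
    "a0 \<bullet> ax 2 = e + \<beta> *s (ax 0 + ax 2)" "a0 \<bullet> ax (- 2) = e + \<beta> *s (ax 0 + ax (- 2))"
    using mult_eq_sig[of a0 "ax 1"] mult_eq_sig[of a0 "ax (- 1)"] mult_eq_sig[of a0 "ax 2"]
      mult_eq_sig[of a0 "ax (- 2)"]
    by (simp_all add: A0.a_idem ax_0 ax_1 flip: s_def e_def)
qed

lemma a0_mult_d_short:
  obtains x y z where "(2 * (\<alpha> - 2 * \<beta>)) *s (a0 \<bullet> d)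
     = (2 * \<beta> * (\<alpha> - \<beta>)) *s (2 *s e + \<beta> *s q) + x *s s + y *s p + z *s ax 0"
  using a0_mult_d unfolding ax_0 by blast

lemma a0_mult_e_short:
  obtains z where "2 *s (a0 \<bullet> e) = (2 * (\<alpha> - \<beta>)) *s e + (\<beta> * (\<alpha> - \<beta>)) *s q + z *s ax 0"
proof -
  have "ax 2 + t0 (ax 2) = q" by (simp add: q_def t0_ax)
  then show thesis using that a0_mult_sig[of "ax 2"] unfolding ax_0 e_def by auto
qed

lemma a0_mult_s_short:
  obtains z where "2 *s (a0 \<bullet> s) = (2 * (\<alpha> - \<beta>)) *s s + (\<beta> * (\<alpha> - \<beta>)) *s p + z *s ax 0"
  using a0_mult_s unfolding ax_0 by blast

lemma s_mult_s_short:
  obtains x y z where "4 *s (s \<bullet> s) = (- 2 * (\<alpha> - \<beta>)) *s (a0 \<bullet> d)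
     + (2 * \<beta> * (\<alpha> - \<beta>)) *s (d + e) + (\<beta> * (\<alpha> - \<beta>)\<^sup>2) *s q + x *s s + y *s p + z *s ax 0"
  using s_mult_s unfolding ax_0 by blast

lemma a0_mult_s_in_span: "{ax 0, ax 1, ax (- 1), s} \<subseteq> span S \<Longrightarrow> a0 \<bullet> s \<in> span S"
  using a0_mult_s_short two_nz
  by (metis (no_types, opaque_lifting) insert_subset mem_span_if_scale p_def span_add span_scale)

lemma a0_mult_e_in_span: "{ax 0, ax 2, ax (- 2), e} \<subseteq> span S \<Longrightarrow> a0 \<bullet> e \<in> span S"
  using a0_mult_e_short two_nz
  by (metis (no_types, opaque_lifting) insert_subset mem_span_if_scale q_def span_add span_scale)

section \<open>Eight spanning vectors for generic parameters\<close>

text \<open>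
  The window around \<open>a\<^sub>0\<close> is invariant under everything that belongs to \<open>a\<^sub>0\<close>. The condition on
  the parameters makes \<open>a0_mult_d\<close> determine \<open>a\<^sub>0 d\<close>.
\<close>

lemma half_stable:
  assumes "\<alpha> \<noteq> 2 * \<beta>" and w: "w \<in> span {ax (- 2), ax (- 1), ax 0, ax 1, ax 2, s, e, d}"
  shows "t0 w \<in> span {ax (- 2), ax (- 1), ax 0, ax 1, ax 2, s, e, d}" (is "_ \<in> span ?S")
    and "a0 \<bullet> w \<in> span {ax (- 2), ax (- 1), ax 0, ax 1, ax 2, s, e, d}"
proof -
  have base: "x \<in> span ?S" if "x \<in> ?S" for x using that by (rule span_base)
  show "t0 w \<in> span ?S"
    by (rule additive_span_subset[where g = t0, OF _ _ subspace_span _ w])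
       (auto simp: t_linear_simps t0_ax t_fixed base)
  have "a0 \<bullet> s \<in> span ?S" "a0 \<bullet> e \<in> span ?S"
    by (rule a0_mult_s_in_span a0_mult_e_in_span, simp add: base)+
  moreover have "a0 \<bullet> d \<in> span ?S"
  proof -
    obtain x y z where X: "(2 * (\<alpha> - 2 * \<beta>)) *s (a0 \<bullet> d)
       = (2 * \<beta> * (\<alpha> - \<beta>)) *s (2 *s e + \<beta> *s q) + x *s s + y *s p + z *s ax 0"
      by (rule a0_mult_d_short)
    have "(2 * (\<alpha> - 2 * \<beta>)) *s (a0 \<bullet> d) \<in> span ?S"
      unfolding X by (simp add: p_def q_def span_intros base)
    then show ?thesis
      by (rule mem_span_if_scale)
        (use assms(1) two_nz in \<open>simp only: mult_eq_0_iff right_minus_eq simp_thms\<close>)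
  qed
  moreover have "a0 \<bullet> ax i \<in> span ?S" if "i \<in> {-2, -1, 0, 1, 2}" for i
    using that by (auto simp: a0_mult_ax span_intros base)
  ultimately have "a0 \<bullet> x \<in> span ?S" if "x \<in> ?S" for x
    using that by auto
  then show "a0 \<bullet> w \<in> span ?S"
    by (intro additive_span_subset[where g = "\<lambda>w. a0 \<bullet> w", OF _ _ subspace_span _ w])
       (simp_all only: mult_add_right mult_scale_right)
qed

lemma ax_in_stable: "stable W \<Longrightarrow> ax i \<in> W"
  by (rule ax_induct) (simp_all add: stable_def)

text \<open>
  The closure principle applied to \<open>y = a\<^sub>i + a\<^bsub>-i\<^esub>\<close>: up to axes, \<open>a\<^sub>0 y\<close> is twice \<open>sig a\<^sub>0 a\<^sub>i\<close>.
\<close>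

lemma stable_mult_sig_a0:
  assumes W: "stable W" and x: "x \<in> W" "t0 x = x"
  shows "x \<bullet> sig a0 (ax i) \<in> W"
proof -
  have sub: "subspace W" using W by (simp add: stable_def)
  let ?y = "ax i + t0 (ax i)"
  have y: "?y \<in> W" "?y \<in> multipliers W" "t0 ?y = ?y"
    using W sub
    by (auto simp: t0_ax t_linear_simps add.commute
        intro!: subspace_add subspace_multipliers ax_in_stable ax_in_multipliers)
  let ?u = "(2 * \<beta>) *s ax 0 + \<beta> *s ?y"
  have "x \<bullet> ax j \<in> W" for j
    using ax_in_multipliers[OF W] x by (simp add: multipliers_def mult_commute)
  then have "x \<bullet> ?u \<in> W"
    using sub by (simp add: t0_ax mult_add_right mult_scale_right subspace_add subspace_scale)
  moreover have "x \<bullet> (a0 \<bullet> ?y) \<in> W"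
    by (rule stable_mult_a0_mult[OF W y x])
  moreover have "2 *s (x \<bullet> sig a0 (ax i)) = x \<bullet> (a0 \<bullet> ?y) - x \<bullet> ?u"
    unfolding a0_mult_add_t0 by (simp add: mult_add_right mult_scale_right ax_0)
  ultimately have "2 *s (x \<bullet> sig a0 (ax i)) \<in> W"
    using sub by (simp add: subspace_diff)
  from subspace_scale[OF sub this, of "inverse 2"] show ?thesis
    using two_nz by simp
qed

lemma stable_swap: "monster_pair.stable scale mult \<alpha> \<beta> a1 a0 W = stable W"
proof -
  interpret sw: monster_pair scale mult \<alpha> \<beta> a1 a0 by (rule swapped)
  show ?thesis by (auto simp: sw.stable_def stable_def)
qed

text \<open>
  The two assumptions make the window around \<open>a\<^sub>0\<close> and the window around \<open>a\<^sub>1\<close> span the same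
  subspace, which is then invariant under what belongs to either axis.
\<close>

lemma dim_le_8_if_window:
  assumes "\<alpha> \<noteq> 2 * \<beta>"
    and 3: "ax 3 \<in> span {ax (- 2), ax (- 1), ax 0, ax 1, ax 2, s, e, d}"
    and 2: "ax (- 2) \<in> span {ax (- 1), ax 0, ax 1, ax 2, ax 3, s, e, d}"
  shows dim_le_8
proof -
  let ?S = "{ax (- 2), ax (- 1), ax 0, ax 1, ax 2, s, e, d}"
  let ?S' = "{ax 3, ax 2, ax 1, ax 0, ax (- 1), s, d, e}"
  let ?W = "span ?S"
  interpret sw: monster_pair scale mult \<alpha> \<beta> a1 a0 by (rule swapped)
  have eq: "?W = span ?S'"
  proof
    show "?W \<subseteq> span ?S'"
      using 2 by (intro span_minimal) (auto intro: span_base simp: insert_commute)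
    show "span ?S' \<subseteq> ?W"
      using 3 by (intro span_minimal) (auto intro: span_base simp: insert_commute)
  qed
  have 0: "t0 w \<in> ?W \<and> a0 \<bullet> w \<in> ?W" if "w \<in> ?W" for w
    using half_stable[OF assms(1)] that by simp
  have 1: "t1 w \<in> ?W \<and> a1 \<bullet> w \<in> ?W" if "w \<in> ?W" for w
    using sw.half_stable[OF assms(1), of w] that eq by (simp add: ax_swap swap_simps)
  have base: "x \<in> ?W" if "x \<in> ?S" for x using that by (rule span_base)
  have W: "stable ?W"
    using 0 1 base[of "ax 0"] base[of "ax 1"] by (simp add: stable_def ax_0 ax_1)
  have "x \<bullet> s \<in> ?W" "x \<bullet> e \<in> ?W" "x \<bullet> d \<in> ?W" if "x \<in> {s, e, d}" for x
  proof -
    have x: "x \<in> ?W" "t0 x = x" "t1 x = x" using that by (auto simp: t_fixed intro: base)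
    show "x \<bullet> s \<in> ?W" "x \<bullet> e \<in> ?W"
      using stable_mult_sig_a0[OF W x(1,2), of 1] stable_mult_sig_a0[OF W x(1,2), of 2]
      by (simp_all add: ax_1 flip: s_def e_def)
    show "x \<bullet> d \<in> ?W"
      using sw.stable_mult_sig_a0[of ?W x 2] W x by (simp add: stable_swap ax_swap d_def)
  qed
  then have Z: "x \<bullet> z \<in> ?W" if "x \<in> {s, e, d}" "z \<in> {s, e, d}" for x z
    using that by blast
  have "?W \<subseteq> span (range ax \<union> {s, e, d})" "{s, e, d} \<subseteq> ?W"
    by (auto intro!: span_mono base)
  then have "?W = UNIV"
    using Z by (rule stable_eq_UNIV[OF W])
  then show ?thesis
    by (intro finite_spanning_list[of "[ax (- 2), ax (- 1), ax 0, ax 1, ax 2, s, e, d]"]) auto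
qed

text \<open>
  The square of \<open>s\<close> modulo the vectors that are common to the windows around \<open>a\<^sub>0\<close> and \<open>a\<^sub>1\<close>. The
  left-hand side is symmetric in the two axes, the right-hand side is not; hence the next lemma.
\<close>

lemma s_mult_s_mod:
  obtains r where "r \<in> span {ax (- 1), ax 0, ax 1, s, e, d}"
    "(4 * (\<alpha> - 2 * \<beta>)) *s (s \<bullet> s) = (\<beta> * (\<alpha> - \<beta>)\<^sup>2 * (\<alpha> - 4 * \<beta>)) *s q + r"
proof -
  obtain x y z where 1: "(2 * (\<alpha> - 2 * \<beta>)) *s (a0 \<bullet> d)
     = (2 * \<beta> * (\<alpha> - \<beta>)) *s (2 *s e + \<beta> *s q) + x *s s + y *s p + z *s ax 0"
    by (rule a0_mult_d_short)
  obtain x' y' z' where 2: "4 *s (s \<bullet> s) = (- 2 * (\<alpha> - \<beta>)) *s (a0 \<bullet> d)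
     + (2 * \<beta> * (\<alpha> - \<beta>)) *s (d + e) + (\<beta> * (\<alpha> - \<beta>)\<^sup>2) *s q + x' *s s + y' *s p + z' *s ax 0"
    by (rule s_mult_s_short)
  let ?r = "(\<alpha> - 2 * \<beta>) *s ((2 * \<beta> * (\<alpha> - \<beta>)) *s (d + e) + x' *s s + y' *s p + z' *s ax 0)
    - (\<alpha> - \<beta>) *s ((4 * \<beta> * (\<alpha> - \<beta>)) *s e + x *s s + y *s p + z *s ax 0)"
  have "?r \<in> span {ax (- 1), ax 0, ax 1, s, e, d}"
    unfolding p_def by (intro span_intros) (auto intro: span_base)
  moreover have "(4 * (\<alpha> - 2 * \<beta>)) *s (s \<bullet> s) = (\<beta> * (\<alpha> - \<beta>)\<^sup>2 * (\<alpha> - 4 * \<beta>)) *s q + ?r"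
  proof (rule eq_if_functionals_eq)
    fix f assume f: "functional f"
    show "f ((4 * (\<alpha> - 2 * \<beta>)) *s (s \<bullet> s)) = f ((\<beta> * (\<alpha> - \<beta>)\<^sup>2 * (\<alpha> - 4 * \<beta>)) *s q + ?r)"
      using arg_cong[OF 1, of f] arg_cong[OF 2, of f] unfolding functional_simps[OF f] by algebra
  qed
  ultimately show thesis by (rule that)
qed

lemma dim_le_8_generic:
  assumes "\<alpha> \<noteq> 2 * \<beta>" "\<alpha> \<noteq> 4 * \<beta>"
  shows dim_le_8
proof -
  interpret sw: monster_pair scale mult \<alpha> \<beta> a1 a0 by (rule swapped)
  let ?A = "\<beta> * (\<alpha> - \<beta>)\<^sup>2 * (\<alpha> - 4 * \<beta>)"
  have A: "?A \<noteq> 0" using params_nz assms by auto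
  obtain r where r: "r \<in> span {ax (- 1), ax 0, ax 1, s, e, d}"
    "(4 * (\<alpha> - 2 * \<beta>)) *s (s \<bullet> s) = ?A *s (ax 2 + ax (- 2)) + r"
    using s_mult_s_mod unfolding q_def by blast
  obtain r' where "r' \<in> span {sw.ax (- 1), sw.ax 0, sw.ax 1, sw.s, sw.e, sw.d}"
    "(4 * (\<alpha> - 2 * \<beta>)) *s (sw.s \<bullet> sw.s) = ?A *s sw.q + r'"
    by (rule sw.s_mult_s_mod)
  then have r': "r' \<in> span {ax 2, ax 1, ax 0, s, d, e}"
    "(4 * (\<alpha> - 2 * \<beta>)) *s (s \<bullet> s) = ?A *s (ax (- 1) + ax 3) + r'"
    by (simp_all add: sw.q_def ax_swap swap_simps)
  have eq: "?A *s ax 3 = ?A *s (ax 2 + ax (- 2)) - ?A *s ax (- 1) + (r - r')" (is "?l1 = ?r1")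
    "?A *s ax (- 2) = ?A *s (ax (- 1) + ax 3) - ?A *s ax 2 + (r' - r)" (is "?l2 = ?r2")
  proof -
    have "f ?l1 = f ?r1 \<and> f ?l2 = f ?r2" if f: "functional f" for f
      using arg_cong[OF r(2), of f] arg_cong[OF r'(2), of f]
      unfolding functional_simps[OF f] by (simp add: ring_distribs) (simp add: algebra_simps)
    then show "?l1 = ?r1" "?l2 = ?r2" using eq_if_functionals_eq by blast+
  qed
  have r_in: "r \<in> span S" if "{ax (- 1), ax 0, ax 1, s, e, d} \<subseteq> S" for S
    using r(1) span_mono[OF that] by blast
  have r'_in: "r' \<in> span S" if "{ax 2, ax 1, ax 0, s, d, e} \<subseteq> S" for S
    using r'(1) span_mono[OF that] by blast
  show ?thesis
  proof (rule dim_le_8_if_window[OF assms(1)])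
    have "?A *s ax 3 \<in> span {ax (- 2), ax (- 1), ax 0, ax 1, ax 2, s, e, d}"
      unfolding eq(1) by (intro span_intros) (auto intro: span_base r_in r'_in)
    then show "ax 3 \<in> span {ax (- 2), ax (- 1), ax 0, ax 1, ax 2, s, e, d}"
      using A by (rule mem_span_if_scale)
    have "?A *s ax (- 2) \<in> span {ax (- 1), ax 0, ax 1, ax 2, ax 3, s, e, d}"
      unfolding eq(2) by (intro span_intros) (auto intro: span_base r_in r'_in)
    then show "ax (- 2) \<in> span {ax (- 1), ax 0, ax 1, ax 2, ax 3, s, e, d}"
      using A by (rule mem_span_if_scale)
  qed
qed

end

context comm_algebra
begin

lemma span_insert_le:
  assumes "c *s u - c' *s v \<in> span A" "c \<noteq> 0"
  shows "span (insert u A) \<subseteq> span (insert v A)"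
proof -
  have "c *s u - c' *s v \<in> span (insert v A)"
    using assms(1) span_mono[of A "insert v A"] by blast
  moreover have "c' *s v \<in> span (insert v A)" by (intro span_scale span_base) simp
  ultimately have "c *s u - c' *s v + c' *s v \<in> span (insert v A)" by (rule span_add)
  then have "c *s u \<in> span (insert v A)" by simp
  then have "u \<in> span (insert v A)" using assms(2) by (rule mem_span_if_scale)
  then show ?thesis
    by (intro span_minimal) (auto intro: span_base)
qed

lemma span_insert_eq:
  assumes "c *s u - c' *s v \<in> span A" "c \<noteq> 0" "c' \<noteq> 0"
  shows "span (insert u A) = span (insert v A)"
proof
  show "span (insert u A) \<subseteq> span (insert v A)" using assms(1,2) by (rule span_insert_le)
  have "c' *s v - c *s u \<in> span A" using span_neg[OF assms(1)] by simp
  then show "span (insert v A) \<subseteq> span (insert u A)" using assms(3) by (rule span_insert_le)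
qed

end

context monster_pair
begin

section \<open>The case \<open>\<alpha> = 2 \<beta>\<close>\<close>

definition window :: "'v set" where
  "window = {ax (- 2), ax (- 1), ax 0, ax 1, ax 2, ax 3, s}"

definition s3 :: 'v where "s3 = sig a0 (ax 3)"

lemma window_base: "ax (- 2) \<in> span window" "ax (- 1) \<in> span window" "ax 0 \<in> span window"
    "ax 1 \<in> span window" "ax 2 \<in> span window" "ax 3 \<in> span window" "s \<in> span window"
  by (auto simp: window_def intro: span_base)

lemma window_swap: "monster_pair.window scale mult \<alpha> \<beta> a1 a0 = window"
proof -
  interpret sw: monster_pair scale mult \<alpha> \<beta> a1 a0 by (rule swapped)
  show ?thesis by (auto simp: sw.window_def window_def ax_swap swap_simps)
qed

text \<open>
  Here \<open>a0_mult_d\<close> says nothing about \<open>a\<^sub>0 d\<close>, but turns into a relation that determines \<open>e\<close>.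
\<close>

lemma e_eq_if_alpha_eq_2_beta:
  assumes "\<alpha> = 2 * \<beta>"
  obtains x y z where "2 *s e = x *s s + y *s p + z *s ax 0 - \<beta> *s q"
proof -
  obtain x y z where 1: "(2 * (\<alpha> - 2 * \<beta>)) *s (a0 \<bullet> d)
     = (2 * \<beta> * (\<alpha> - \<beta>)) *s (2 *s e + \<beta> *s q) + x *s s + y *s p + z *s ax 0"
    by (rule a0_mult_d_short)
  \<comment> \<open>\<open>2 \<beta>\<^sup>2\<close> is the coefficient of \<open>2 e + \<beta> q\<close> in \<open>a0_mult_d\<close>.\<close>
  let ?c = "- inverse (2 * \<beta> * \<beta>)"
  have "2 *s e = (?c * x) *s s + (?c * y) *s p + (?c * z) *s ax 0 - \<beta> *s q"
  proof (rule eq_if_functionals_eq)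
    fix f assume f: "functional f"
    have "0 = 2 * \<beta> * \<beta> * (2 * f e + \<beta> * f q) + x * f s + y * f p + z * f (ax 0)"
      using arg_cong[OF 1, of f] assms unfolding functional_simps[OF f] by simp
    moreover have nz: "2 * \<beta> * \<beta> \<noteq> 0" using params_nz two_nz by simp
    then have "2 * \<beta> * \<beta> * ?c = - 1" by (metis minus_mult_right right_inverse)
    ultimately have "2 * \<beta> * \<beta> * (2 * f e) = 2 * \<beta> * \<beta> * (?c * x * f s + ?c * y * f p
        + ?c * z * f (ax 0) - \<beta> * f q)"
      by algebra
    then show "f (2 *s e) = f ((?c * x) *s s + (?c * y) *s p + (?c * z) *s ax 0 - \<beta> *s q)"
      using nz unfolding functional_simps[OF f] by (simp only: mult_cancel_left simp_thms)
  qed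
  then show thesis by (rule that)
qed

text \<open>
  Since \<open>e\<close> is fixed by \<open>\<tau>\<^sub>1\<close>, its expression by \<open>a\<^bsub>-2\<^esub>, \<dots>, a\<^sub>2, s\<close> may be reflected at \<open>a\<^sub>1\<close>,
  which replaces \<open>a\<^bsub>-2\<^esub>\<close> by \<open>a\<^sub>4\<close>.
\<close>

lemma window_if_alpha_eq_2_beta:
  assumes "\<alpha> = 2 * \<beta>"
  shows "e \<in> span window" "ax 4 \<in> span window"
proof -
  obtain x y z where e: "2 *s e = x *s s + y *s p + z *s ax 0 - \<beta> *s q"
    using e_eq_if_alpha_eq_2_beta[OF assms] .
  have "2 *s e \<in> span window"
    unfolding e by (simp add: p_def q_def span_intros window_base)
  then show e_in: "e \<in> span window" using two_nz by (rule mem_span_if_scale)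
  have "2 *s e = x *s s + y *s (ax 1 + ax 3) + z *s ax 2 - \<beta> *s (ax 0 + ax 4)"
    using arg_cong[OF e, of t1]
    by (simp add: t_linear_simps t1_ax t_fixed p_def q_def add.commute)
  then have "\<beta> *s ax 4 = x *s s + y *s (ax 1 + ax 3) + z *s ax 2 - \<beta> *s ax 0 - 2 *s e"
    by (simp add: scale_right_distrib algebra_simps)
  also have "\<dots> \<in> span window" by (intro span_intros window_base e_in)
  finally show "ax 4 \<in> span window" using params_nz(2) by (rule mem_span_if_scale)
qed

lemma window_if_alpha_eq_2_beta':
  assumes "\<alpha> = 2 * \<beta>"
  shows "d \<in> span window" "ax (- 3) \<in> span window"
proof -
  interpret sw: monster_pair scale mult \<alpha> \<beta> a1 a0 by (rule swapped)
  show "d \<in> span window" "ax (- 3) \<in> span window"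
    using sw.window_if_alpha_eq_2_beta[OF assms] by (simp_all add: window_swap swap_simps ax_swap)
qed

text \<open>
  Modulo the window, the only new vector is \<open>sig a\<^sub>0 a\<^sub>3\<close>: it arises from \<open>a\<^sub>0 d\<close>, because \<open>d\<close>
  involves \<open>a\<^sub>3\<close>. The square of \<open>s\<close> represents the same class, and it has the advantage of being
  symmetric in \<open>a\<^sub>0\<close> and \<open>a\<^sub>1\<close>; this is why the spanning set contains \<open>s \<bullet> s\<close>.
\<close>

lemma s_mult_s_s3:
  assumes "\<alpha> = 2 * \<beta>"
  shows "4 *s (s \<bullet> s) - (\<beta> * \<beta>) *s s3 \<in> span window"
proof -
  interpret sw: monster_pair scale mult \<alpha> \<beta> a1 a0 by (rule swapped)
  note mem = span_intros window_base window_if_alpha_eq_2_beta[OF assms]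
      window_if_alpha_eq_2_beta'[OF assms]
  obtain x y z where "2 *s sw.e = x *s sw.s + y *s sw.p + z *s sw.ax 0 - \<beta> *s sw.q"
    using sw.e_eq_if_alpha_eq_2_beta[OF assms] .
  then have d: "2 *s d = x *s s + y *s (ax 0 + ax 2) + z *s ax 1 - \<beta> *s (ax (- 1) + ax 3)"
    by (simp add: swap_simps ax_swap sw.p_def sw.q_def)
  obtain x' y' z' where ss: "4 *s (s \<bullet> s) = (- 2 * (\<alpha> - \<beta>)) *s (a0 \<bullet> d)
     + (2 * \<beta> * (\<alpha> - \<beta>)) *s (d + e) + (\<beta> * (\<alpha> - \<beta>)\<^sup>2) *s q + x' *s s + y' *s p + z' *s ax 0"
    by (rule s_mult_s_short)
  have a0_ax_3: "a0 \<bullet> ax 3 = s3 + \<beta> *s (ax 0 + ax 3)"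
    by (simp add: s3_def mult_eq_sig[of a0 "ax 3"] ax_0)
  have a0s: "a0 \<bullet> s \<in> span window"
    by (rule a0_mult_s_in_span) (simp add: window_base)
  let ?r = "x *s (a0 \<bullet> s) + y *s (ax 0 + (e + \<beta> *s (ax 0 + ax 2))) + z *s (s + \<beta> *s (ax 0 + ax 1))
      - \<beta> *s (s + \<beta> *s (ax 0 + ax (- 1))) - (\<beta> * \<beta>) *s (ax 0 + ax 3)"
  have "a0 \<bullet> (2 *s d) = ?r - \<beta> *s s3"
    unfolding d
    by (rule eq_if_functionals_eq)
       (simp add: functional_simps mult_add_right product_diff_right mult_scale_right a0_mult_ax
           a0_ax_3 algebra_simps)
  then have X: "2 *s (a0 \<bullet> d) = ?r - \<beta> *s s3" by (simp add: mult_scale_right)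
  let ?r' = "(2 * \<beta> * (\<alpha> - \<beta>)) *s (d + e) + (\<beta> * (\<alpha> - \<beta>)\<^sup>2) *s q + x' *s s + y' *s p + z' *s ax 0
    - \<beta> *s ?r"
  have "4 *s (s \<bullet> s) - (\<beta> * \<beta>) *s s3 = ?r'"
  proof (rule eq_if_functionals_eq)
    fix f assume f: "functional f"
    show "f (4 *s (s \<bullet> s) - (\<beta> * \<beta>) *s s3) = f ?r'"
      using arg_cong[OF X, of f] arg_cong[OF ss, of f] assms
      unfolding functional_simps[OF f] by algebra
  qed
  also have "?r' \<in> span window"
    unfolding p_def q_def by (intro mem a0s)
  finally show ?thesis .
qed

lemma four_nz: "(4::'f) \<noteq> 0"
  using two_nz mult_eq_0_iff[of "2::'f" 2] by simp

lemma span_insert_s3: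
  assumes "\<alpha> = 2 * \<beta>"
  shows "span (insert (s \<bullet> s) window) = span (insert s3 window)"
  using params_nz four_nz by (intro span_insert_eq[OF s_mult_s_s3[OF assms]]) simp_all

lemma half_stable_2_beta:
  assumes "\<alpha> = 2 * \<beta>" and w: "w \<in> span (insert (s \<bullet> s) window)"
  shows "t0 w \<in> span (insert (s \<bullet> s) window)" "a0 \<bullet> w \<in> span (insert (s \<bullet> s) window)"
proof -
  let ?W = "span (insert s3 window)"
  have eq: "span (insert (s \<bullet> s) window) = ?W"
    using assms(1) by (rule span_insert_s3)
  have win: "x \<in> ?W" if "x \<in> span window" for x
    using that span_mono[of window "insert s3 window"] by blast
  note base = win[OF window_base(1)] win[OF window_base(2)] win[OF window_base(3)] win[OF
      window_base(4)]
    win[OF window_base(5)] win[OF window_base(6)] win[OF window_base(7)]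
    win[OF window_if_alpha_eq_2_beta(1)[OF assms(1)]] win[OF window_if_alpha_eq_2_beta(2)[OF
        assms(1)]]
    win[OF window_if_alpha_eq_2_beta'(1)[OF assms(1)]] win[OF window_if_alpha_eq_2_beta'(2)[OF
        assms(1)]]
  have s3: "s3 \<in> ?W" by (rule span_base) simp
  have w': "w \<in> ?W" using w eq by simp
  have "t0 x \<in> ?W" if "x \<in> insert s3 window" for x
    using that t0_sig_a0[of "ax 3"] s3 base by (auto simp: window_def t0_ax t_fixed simp flip:
        s3_def)
  from additive_span_subset[where g = t0, OF _ _ subspace_span this w']
  show "t0 w \<in> span (insert (s \<bullet> s) window)" by (simp add: eq t_linear_simps)
  have "2 *s (a0 \<bullet> s3) \<in> ?W"
    unfolding s3_def a0_mult_sig t0_ax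
    unfolding s3_def[symmetric] by (intro span_intros base s3 base(3)[unfolded ax_0])
  then have a0s3: "a0 \<bullet> s3 \<in> ?W" using two_nz by (rule mem_span_if_scale)
  have a0s: "a0 \<bullet> s \<in> ?W"
    by (rule a0_mult_s_in_span) (simp add: base)
  have a0_ax_3: "a0 \<bullet> ax 3 = s3 + \<beta> *s (ax 0 + ax 3)"
    by (simp add: s3_def mult_eq_sig[of a0 "ax 3"] ax_0)
  have "a0 \<bullet> x \<in> ?W" if "x \<in> insert s3 window" for x
    using that a0s3 a0s base s3 by (auto simp: window_def a0_mult_ax a0_ax_3 span_intros)
  from additive_span_subset[where g = "\<lambda>x. a0 \<bullet> x", OF _ _ subspace_span this w']
  show "a0 \<bullet> w \<in> span (insert (s \<bullet> s) window)" by (simp add: eq bilinear_simps)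
qed

lemma dim_le_8_if_alpha_eq_2_beta:
  assumes "\<alpha> = 2 * \<beta>"
  shows dim_le_8
proof -
  let ?W = "span (insert (s \<bullet> s) window)"
  interpret sw: monster_pair scale mult \<alpha> \<beta> a1 a0 by (rule swapped)
  have eq: "?W = span (insert s3 window)"
    using assms(1) by (rule span_insert_s3)
  have base: "x \<in> ?W" if "x \<in> insert (s \<bullet> s) window" for x using that by (rule span_base)
  have s3: "s3 \<in> ?W" unfolding eq by (rule span_base) simp
  have W: "stable ?W"
    using half_stable_2_beta[OF assms] sw.half_stable_2_beta[OF assms] base[of "ax 0"] base[of
        "ax 1"]
    by (simp add: stable_def window_swap swap_simps) (simp add: window_def ax_0 ax_1)
  have "x \<bullet> s \<in> ?W" "x \<bullet> s3 \<in> ?W" if "x \<in> {s, s3}" for x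
  proof -
    have x: "x \<in> ?W" "t0 x = x"
      using that t0_sig_a0[of "ax 3"] s3 base[of s] by (auto simp: t_fixed window_def simp flip:
          s3_def)
    show "x \<bullet> s \<in> ?W" "x \<bullet> s3 \<in> ?W"
      using stable_mult_sig_a0[OF W x, of 1] stable_mult_sig_a0[OF W x, of 3]
      by (simp_all add: ax_1 flip: s_def s3_def)
  qed
  then have Z: "x \<bullet> z \<in> ?W" if "x \<in> {s, s3}" "z \<in> {s, s3}" for x z
    using that by blast
  have "?W \<subseteq> span (range ax \<union> {s, s3})"
    unfolding eq by (rule span_mono) (auto simp: window_def)
  moreover have "{s, s3} \<subseteq> ?W" using s3 base[of s] by (simp add: window_def)
  ultimately have "?W = UNIV"
    using Z by (rule stable_eq_UNIV[OF W])
  then show ?thesis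
    by (intro finite_spanning_list[of "[s \<bullet> s, ax (- 2), ax (- 1), ax 0, ax 1, ax 2, ax 3, s]"])
      (auto simp: window_def)
qed

end

context monster_pair
begin

section \<open>The case \<open>\<alpha> = 4 \<beta>\<close>\<close>

text \<open>
  Up to the factor \<open>6 \<beta>\<^sup>2\<close>, \<open>k0\<close> is the coefficient of \<open>a\<^sub>1 + a\<^bsub>-1\<^esub>\<close> in \<open>8 (s s)\<close> as computed from
  \<open>a\<^sub>0\<close>, and \<open>k1\<close> is that of \<open>a\<^sub>0 + a\<^sub>2\<close> as computed from \<open>a\<^sub>1\<close>.
\<close>

definition k0 :: 'f where "k0 = 8 * l - 18 * \<beta> + 1"
definition k1 :: 'f where "k1 = 8 * m - 18 * \<beta> + 1"

lemma k0_swap: "monster_pair.k0 scale mult \<alpha> \<beta> a1 a0 = k1"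
  and k1_swap: "monster_pair.k1 scale mult \<alpha> \<beta> a1 a0 = k0"
proof -
  interpret sw: monster_pair scale mult \<alpha> \<beta> a1 a0 by (rule swapped)
  show "sw.k0 = k1" "sw.k1 = k0"
    by (simp_all add: sw.k0_def k1_def sw.k1_def k0_def)
qed

lemma three_nz: "\<alpha> = 4 * \<beta> \<Longrightarrow> (3::'f) \<noteq> 0"
  and not_2_beta: "\<alpha> = 4 * \<beta> \<Longrightarrow> \<alpha> \<noteq> 2 * \<beta>"
proof -
  assume \<alpha>: "\<alpha> = 4 * \<beta>"
  have "\<alpha> = \<beta> + 3 * \<beta>" "\<alpha> = 2 * \<beta> + 2 * \<beta>" unfolding \<alpha> by algebra+
  moreover have "\<beta> + 3 * \<beta> = \<beta>" if "(3::'f) = 0" using that by simp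
  moreover have "2 * \<beta> \<noteq> 0" using params_nz two_nz by simp
  ultimately show "(3::'f) \<noteq> 0" "\<alpha> \<noteq> 2 * \<beta>" using params_nz(5)
    by (metis, metis add_cancel_right_left)
qed

lemma a0_mult_d_4_beta:
  assumes "\<alpha> = 4 * \<beta>"
  obtains z where "(4 * \<beta>) *s (a0 \<bullet> d) = (12 * \<beta>\<^sup>2) *s e + (6 * \<beta> ^ 3) *s q
    + (2 * \<beta> * (30 * \<beta>\<^sup>2 - 3 * \<beta> - 8 * \<beta> * m + 2 * m - 8 * \<beta> * l)) *s p
    + (2 * (60 * \<beta>\<^sup>2 - 6 * \<beta> - 16 * \<beta> * m + 4 * m - 16 * \<beta> * l)) *s s + z *s ax 0"
proof -
  obtain z where 1: "(2 * (\<alpha> - 2 * \<beta>)) *s (a0 \<bullet> d) = (2 * \<beta> * (\<alpha> - \<beta>)) *s (2 *s e + \<beta> *s q)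
     + (8 * (\<alpha> - \<beta>)\<^sup>2 + 2 * bb) *s s + (4 * \<beta> * (\<alpha> - \<beta>)\<^sup>2 + \<beta> * bb) *s p + z *s ax 0"
    using a0_mult_d unfolding ax_0 by blast
  show thesis
  proof (rule that[of z], rule eq_if_functionals_eq)
    fix f assume f: "functional f"
    show "f ((4 * \<beta>) *s (a0 \<bullet> d)) = f ((12 * \<beta>\<^sup>2) *s e + (6 * \<beta> ^ 3) *s q
      + (2 * \<beta> * (30 * \<beta>\<^sup>2 - 3 * \<beta> - 8 * \<beta> * m + 2 * m - 8 * \<beta> * l)) *s p
      + (2 * (60 * \<beta>\<^sup>2 - 6 * \<beta> - 16 * \<beta> * m + 4 * m - 16 * \<beta> * l)) *s s + z *s ax 0)"
      using arg_cong[OF 1, of f] assms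
      unfolding functional_simps[OF f] bb_def gam_def c1_def by algebra
  qed
qed

text \<open>
  The combination \<open>2 e + \<beta> q\<close> occurs in the same proportion in \<open>a\<^sub>0 d\<close> and in \<open>a\<^sub>0 e\<close>, and
  cancels.
\<close>

lemma a0_mult_d_minus_e:
  assumes "\<alpha> = 4 * \<beta>"
  obtains z where "(4 * \<beta>) *s (a0 \<bullet> d - a0 \<bullet> e)
    = (2 * \<beta> * (30 * \<beta>\<^sup>2 - 3 * \<beta> - 8 * \<beta> * m + 2 * m - 8 * \<beta> * l)) *s p
    + (2 * (60 * \<beta>\<^sup>2 - 6 * \<beta> - 16 * \<beta> * m + 4 * m - 16 * \<beta> * l)) *s s + z *s ax 0"
proof -
  obtain z where 1: "(4 * \<beta>) *s (a0 \<bullet> d) = (12 * \<beta>\<^sup>2) *s e + (6 * \<beta> ^ 3) *s q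
    + (2 * \<beta> * (30 * \<beta>\<^sup>2 - 3 * \<beta> - 8 * \<beta> * m + 2 * m - 8 * \<beta> * l)) *s p
    + (2 * (60 * \<beta>\<^sup>2 - 6 * \<beta> - 16 * \<beta> * m + 4 * m - 16 * \<beta> * l)) *s s + z *s ax 0"
    by (rule a0_mult_d_4_beta[OF assms])
  obtain y where 2: "2 *s (a0 \<bullet> e) = (2 * (\<alpha> - \<beta>)) *s e + (\<beta> * (\<alpha> - \<beta>)) *s q + y *s ax 0"
    by (rule a0_mult_e_short)
  show thesis
  proof (rule that[of "z - 2 * \<beta> * y"], rule eq_if_functionals_eq)
    fix f assume f: "functional f"
    show "f ((4 * \<beta>) *s (a0 \<bullet> d - a0 \<bullet> e))
      = f ((2 * \<beta> * (30 * \<beta>\<^sup>2 - 3 * \<beta> - 8 * \<beta> * m + 2 * m - 8 * \<beta> * l)) *s p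
      + (2 * (60 * \<beta>\<^sup>2 - 6 * \<beta> - 16 * \<beta> * m + 4 * m - 16 * \<beta> * l)) *s s + (z - 2 * \<beta> * y) *s ax 0)"
      using arg_cong[OF 1, of f] arg_cong[OF 2, of f] assms
      unfolding functional_simps[OF f] by algebra
  qed
qed

lemma s_mult_s_4_beta:
  assumes "\<alpha> = 4 * \<beta>"
  obtains z where "8 *s (s \<bullet> s) = (12 * \<beta>\<^sup>2) *s (d - 2 *s e) + (6 * \<beta>\<^sup>2 * k0) *s p
    + (2 * (- 120 * \<beta>\<^sup>2 + 48 * \<beta> * l + 32 * \<beta> * m + 8 * \<beta> - 8 * m)) *s s + z *s ax 0"
proof -
  obtain z where 1: "(4 * \<beta>) *s (a0 \<bullet> d) = (12 * \<beta>\<^sup>2) *s e + (6 * \<beta> ^ 3) *s q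
    + (2 * \<beta> * (30 * \<beta>\<^sup>2 - 3 * \<beta> - 8 * \<beta> * m + 2 * m - 8 * \<beta> * l)) *s p
    + (2 * (60 * \<beta>\<^sup>2 - 6 * \<beta> - 16 * \<beta> * m + 4 * m - 16 * \<beta> * l)) *s s + z *s ax 0"
    by (rule a0_mult_d_4_beta[OF assms])
  obtain y where 2:
    "4 *s (s \<bullet> s) = (- 2 * (\<alpha> - \<beta>)) *s (a0 \<bullet> d) + (2 * \<beta> * (\<alpha> - \<beta>)) *s (d + e)
     + (\<beta> * (\<alpha> - \<beta>)\<^sup>2) *s q
     + (4 * (\<alpha> - 2 * \<beta>) * (\<alpha> - \<beta>) + 2 * gg - 2 * gam * (\<alpha> - \<beta>) + 4 * (\<alpha> - \<beta>)\<^sup>2) *s s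
     + ((2 * \<alpha> - 4 * \<beta>) * c1 + \<beta> * (\<alpha> - \<beta>) * (1 + 2 * \<beta>) + \<beta> * gg
        - gam * \<beta> * (\<alpha> - \<beta>) + 2 * \<beta> * (\<alpha> - \<beta>)\<^sup>2) *s p + y *s ax 0"
    using s_mult_s unfolding ax_0 by blast
  show thesis
  proof (rule that[of "2 * y - 3 * z"], rule eq_if_functionals_eq)
    fix f assume f: "functional f"
    show "f (8 *s (s \<bullet> s)) = f ((12 * \<beta>\<^sup>2) *s (d - 2 *s e) + (6 * \<beta>\<^sup>2 * k0) *s p
      + (2 * (- 120 * \<beta>\<^sup>2 + 48 * \<beta> * l + 32 * \<beta> * m + 8 * \<beta> - 8 * m)) *s s
      + (2 * y - 3 * z) *s ax 0)"
      using arg_cong[OF 1, of f] arg_cong[OF 2, of f] assms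
      unfolding functional_simps[OF f] gg_def gam_def c1_def k0_def by algebra
  qed
qed

text \<open>
  Comparison of the values of \<open>s s\<close> computed from \<open>a\<^sub>0\<close> and from \<open>a\<^sub>1\<close>. The sum \<open>a\<^sub>2 + a\<^bsub>-2\<^esub>\<close> and
  its mirror image, which settle the generic case, have coefficient zero here, and \<open>d - e\<close> is
  left.
\<close>

lemma d_minus_e:
  assumes "\<alpha> = 4 * \<beta>"
  obtains z z' where "(36 * \<beta>\<^sup>2) *s (d - e) = (6 * \<beta>\<^sup>2 * k1) *s (ax 0 + ax 2) - (6 * \<beta>\<^sup>2 * k0) *s p
    - ((32 * \<beta> + 16) * (l - m)) *s s + z *s ax 0 + z' *s ax 1"
proof -
  interpret sw: monster_pair scale mult \<alpha> \<beta> a1 a0 by (rule swapped)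
  obtain z where 1: "8 *s (s \<bullet> s) = (12 * \<beta>\<^sup>2) *s (d - 2 *s e) + (6 * \<beta>\<^sup>2 * k0) *s p
    + (2 * (- 120 * \<beta>\<^sup>2 + 48 * \<beta> * l + 32 * \<beta> * m + 8 * \<beta> - 8 * m)) *s s + z *s ax 0"
    by (rule s_mult_s_4_beta[OF assms])
  obtain z' where "8 *s (sw.s \<bullet> sw.s) = (12 * \<beta>\<^sup>2) *s (sw.d - 2 *s sw.e) + (6 * \<beta>\<^sup>2 * sw.k0) *s sw.p
    + (2 * (- 120 * \<beta>\<^sup>2 + 48 * \<beta> * m + 32 * \<beta> * l + 8 * \<beta> - 8 * l)) *s sw.s + z' *s sw.ax 0"
    by (rule sw.s_mult_s_4_beta[OF assms])
  then have 2: "8 *s (s \<bullet> s) = (12 * \<beta>\<^sup>2) *s (e - 2 *s d) + (6 * \<beta>\<^sup>2 * k1) *s (ax 0 + ax 2)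
    + (2 * (- 120 * \<beta>\<^sup>2 + 48 * \<beta> * m + 32 * \<beta> * l + 8 * \<beta> - 8 * l)) *s s + z' *s ax 1"
    unfolding swap_simps k0_swap sw.p_def ax_swap by simp
  show thesis
  proof (rule that[of "- z" z'], rule eq_if_functionals_eq)
    fix f assume f: "functional f"
    show "f ((36 * \<beta>\<^sup>2) *s (d - e)) = f ((6 * \<beta>\<^sup>2 * k1) *s (ax 0 + ax 2) - (6 * \<beta>\<^sup>2 * k0) *s p
      - ((32 * \<beta> + 16) * (l - m)) *s s + (- z) *s ax 0 + z' *s ax 1)"
      using arg_cong[OF 1, of f] arg_cong[OF 2, of f]
      unfolding functional_simps[OF f] by algebra
  qed
qed

lemma coeff_nz: "\<alpha> = 4 * \<beta> \<Longrightarrow> (36 * \<beta>\<^sup>2) \<noteq> 0" "\<alpha> = 4 * \<beta> \<Longrightarrow> 6 * \<beta>\<^sup>2 \<noteq> 0" "\<alpha> = 4 * \<beta> \<Longrightarrow> 6 * \<beta> ^ 3 \<noteq> 0"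
proof -
  assume "\<alpha> = 4 * \<beta>"
  then have "(2::'f) * 3 \<noteq> 0" using three_nz two_nz by (simp only: mult_eq_0_iff simp_thms)
  moreover have "(2::'f) * 3 = 6" "(2::'f) * 3 * (2 * 3) = 36" by simp_all
  ultimately have "(6::'f) \<noteq> 0" "(36::'f) \<noteq> 0" by (metis mult_eq_0_iff)+
  then show "(36 * \<beta>\<^sup>2) \<noteq> 0" "6 * \<beta>\<^sup>2 \<noteq> 0" "6 * \<beta> ^ 3 \<noteq> 0"
    using params_nz by simp_all
qed

text \<open>
  Multiplying \<open>d_minus_e\<close> by \<open>a\<^sub>0\<close> produces \<open>a\<^sub>0 a\<^sub>2\<close>, hence \<open>e\<close>, with coefficient proportional to
  \<open>k1\<close>; by \<open>a0_mult_d_minus_e\<close> all other terms are inner axes and \<open>s\<close>. So \<open>e\<close>, and then \<open>d\<close>, lie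
  in the span of \<open>a\<^bsub>-1\<^esub>, a\<^sub>0, a\<^sub>1, a\<^sub>2, s\<close>. Reflecting \<open>d_minus_e\<close> at \<open>a\<^sub>0\<close> puts \<open>a\<^bsub>-2\<^esub>\<close> there,
  and \<open>a\<^sub>1 e\<close>, in which \<open>a\<^sub>3\<close> occurs, does the same for \<open>a\<^sub>3\<close>.
\<close>

lemma dim_le_8_if_k1_nz:
  assumes "\<alpha> = 4 * \<beta>" "k1 \<noteq> 0"
  shows dim_le_8
proof -
  interpret sw: monster_pair scale mult \<alpha> \<beta> a1 a0 by (rule swapped)
  let ?R = "{ax (- 1), ax 0, ax 1, s}"
  let ?Z = "{ax (- 1), ax 0, ax 1, ax 2, s}"
  note nz = coeff_nz[OF assms(1)] assms(2)
  have R: "x \<in> span ?R" if "x \<in> ?R" for x using that by (rule span_base)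
  have Z: "x \<in> span ?Z" if "x \<in> ?Z" for x using that by (rule span_base)
  obtain z z' where 1: "(36 * \<beta>\<^sup>2) *s (d - e) = (6 * \<beta>\<^sup>2 * k1) *s (ax 0 + ax 2)
      - (6 * \<beta>\<^sup>2 * k0) *s p
    - ((32 * \<beta> + 16) * (l - m)) *s s + z *s ax 0 + z' *s ax 1"
    by (rule d_minus_e[OF assms(1)])
  obtain x u y where 2: "(4 * \<beta>) *s (a0 \<bullet> d - a0 \<bullet> e) = x *s p + u *s s + y *s ax 0"
    using a0_mult_d_minus_e[OF assms(1)] by blast
  \<comment> \<open>What is left of \<open>a\<^sub>0\<close> times \<open>d_minus_e\<close> when the terms with \<open>e\<close> and \<open>a\<^sub>2\<close> are moved to the
    other side; \<open>9 \<beta>\<close> is the quotient of the factors \<open>36 \<beta>\<^sup>2\<close> and \<open>4 \<beta>\<close>.\<close>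
  let ?r = "(9 * \<beta>) *s (x *s p + u *s s + y *s ax 0) - (6 * \<beta>\<^sup>2 * k1 * (1 + \<beta>) + z) *s ax 0
    + (6 * \<beta>\<^sup>2 * k0) *s (2 *s s + (2 * \<beta>) *s ax 0 + \<beta> *s p) + ((32 * \<beta> + 16) * (l - m)) *s (a0 \<bullet> s)
    - z' *s (s + \<beta> *s (ax 0 + ax 1))"
  have "(6 * \<beta>\<^sup>2 * k1) *s (e + \<beta> *s ax 2) = ?r"
  proof (rule eq_if_functionals_eq)
    fix f assume f: "functional f"
    note fs = functional_simps[OF f] functional_simps[OF functional_mult[OF f, of a0]]
    have "f (a0 \<bullet> p) = f (2 *s s + (2 * \<beta>) *s ax 0 + \<beta> *s p)"
      using a0_mult_p by (simp add: ax_0)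
    then show "f ((6 * \<beta>\<^sup>2 * k1) *s (e + \<beta> *s ax 2)) = f ?r"
      using arg_cong[OF 1, of "\<lambda>v. f (a0 \<bullet> v)"] arg_cong[OF 2, of f]
      unfolding fs a0_mult_ax by algebra
  qed
  moreover have "?r \<in> span ?R"
    unfolding p_def by (intro span_intros R a0_mult_s_in_span) (simp_all add: R)
  ultimately have "(6 * \<beta>\<^sup>2 * k1) *s (e + \<beta> *s ax 2) \<in> span ?R" by simp
  then have r: "e + \<beta> *s ax 2 \<in> span ?R"
    using nz by (intro mem_span_if_scale[of "6 * \<beta>\<^sup>2 * k1" "e + \<beta> *s ax 2"]) simp_all
  then have "e + \<beta> *s ax 2 \<in> span ?Z"
    using span_mono[of ?R ?Z] by blast
  from span_diff[OF this span_scale[OF Z[of "ax 2"], of \<beta>]] have e: "e \<in> span ?Z" by simp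
  have "(36 * \<beta>\<^sup>2) *s (d - e) \<in> span ?Z"
    unfolding 1 p_def by (simp add: span_intros Z)
  then have "d - e \<in> span ?Z" using nz(1) by (rule mem_span_if_scale)
  from span_add[OF this e] have d: "d \<in> span ?Z" by simp
  have m2: "ax (- 2) \<in> span ?Z"
  proof -
    have "(6 * \<beta>\<^sup>2 * k1) *s ax (- 2) = (6 * \<beta>\<^sup>2 * k1) *s ax 2 + z' *s (ax 1 - ax (- 1))"
    proof (rule eq_if_functionals_eq)
      fix f assume f: "functional f"
      note fs = functional_simps[OF f] functional_simps[OF functional_t0[OF f]]
      show "f ((6 * \<beta>\<^sup>2 * k1) *s ax (- 2)) = f ((6 * \<beta>\<^sup>2 * k1) *s ax 2 + z' *s (ax 1 - ax (- 1)))"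
        using arg_cong[OF 1, of "\<lambda>v. f (t0 v)"] arg_cong[OF 1, of f]
        unfolding fs t0_ax t_fixed p_fixed minus_zero by algebra
    qed
    moreover have "(6 * \<beta>\<^sup>2 * k1) *s ax 2 + z' *s (ax 1 - ax (- 1)) \<in> span ?Z"
      by (simp add: span_intros Z)
    ultimately show ?thesis
      using nz by (intro mem_span_if_scale[of "6 * \<beta>\<^sup>2 * k1" "ax (- 2)"]) simp_all
  qed
  have 3: "ax 3 \<in> span ?Z"
  proof -
    have a1: "a1 \<bullet> ax 1 = ax 1" "a1 \<bullet> ax 0 = s + \<beta> *s (ax 1 + ax 0)"
      "a1 \<bullet> ax 2 = s + \<beta> *s (ax 1 + ax 2)" "a1 \<bullet> ax (- 1) = d + \<beta> *s (ax 1 + ax (- 1))"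
      using sw.a0_mult_ax by (simp_all add: ax_swap swap_simps)
    have a1s: "a1 \<bullet> s \<in> span ?Z"
      using sw.a0_mult_s_in_span[of ?Z] by (simp add: ax_swap swap_simps Z)
    have "a1 \<bullet> x \<in> span ?Z" if "x \<in> ?R" for x
      using that a1s by (auto simp: a1 span_intros Z d)
    from additive_span_subset[where g = "\<lambda>x. a1 \<bullet> x", OF _ _ subspace_span this r]
    have "a1 \<bullet> (e + \<beta> *s ax 2) \<in> span ?Z" by (simp add: bilinear_simps)
    from span_diff[OF this span_scale[of "a1 \<bullet> ax 2" ?Z \<beta>]]
    have a1e: "a1 \<bullet> e \<in> span ?Z" by (simp add: mult_add_right mult_scale_right a1 span_intros Z)
    obtain x u y where "(4 * \<beta>) *s (a1 \<bullet> sw.d) = (12 * \<beta>\<^sup>2) *s sw.e + (6 * \<beta> ^ 3) *s sw.q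
        + x *s sw.p + u *s sw.s + y *s sw.ax 0"
      using sw.a0_mult_d_4_beta[OF assms(1)] by blast
    then have "(4 * \<beta>) *s (a1 \<bullet> e) = (12 * \<beta>\<^sup>2) *s d + (6 * \<beta> ^ 3) *s (ax (- 1) + ax 3)
        + x *s (ax 0 + ax 2) + u *s s + y *s ax 1"
      by (simp add: swap_simps ax_swap sw.p_def sw.q_def)
    then have "(6 * \<beta> ^ 3) *s ax 3 = (4 * \<beta>) *s (a1 \<bullet> e) - (12 * \<beta>\<^sup>2) *s d - (6 * \<beta> ^ 3) *s ax (- 1)
        - x *s (ax 0 + ax 2) - u *s s - y *s ax 1"
      by (simp add: scale_right_distrib)
    moreover have "\<dots> \<in> span ?Z" by (simp add: span_intros Z a1e d)
    ultimately show ?thesis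
      using nz(3) by (intro mem_span_if_scale[of "6 * \<beta> ^ 3" "ax 3"]) simp_all
  qed
  have "\<alpha> \<noteq> 2 * \<beta>" using assms(1) by (rule not_2_beta)
  then show ?thesis
    using 3 m2 span_mono[of ?Z "{ax (- 2), ax (- 1), ax 0, ax 1, ax 2, s, e, d}"]
      span_mono[of ?Z "{ax (- 1), ax 0, ax 1, ax 2, ax 3, s, e, d}"]
    by (intro dim_le_8_if_window) auto
qed

lemma dim_le_8_if_k0_nz:
  assumes "\<alpha> = 4 * \<beta>" "k0 \<noteq> 0"
  shows dim_le_8
proof -
  interpret sw: monster_pair scale mult \<alpha> \<beta> a1 a0 by (rule swapped)
  show ?thesis using sw.dim_le_8_if_k1_nz assms unfolding k1_swap by blast
qed

text \<open>
  In this case \<open>\<tau>\<^sub>0\<close> fixes both generators, so it is the identity and the sequence of axes is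
  short.
\<close>

lemma dim_le_8_if_fixed:
  assumes "\<alpha> \<noteq> 2 * \<beta>" "ax (- 1) = ax 1"
  shows dim_le_8
proof (rule dim_le_8_if_window[OF assms(1)])
  have "t0 a1 = a1" using assms(2) t0_ax[of 1] by (simp add: ax_1)
  then have "ax (- 2) = ax 2" using t0_id[of "ax 2"] by (simp add: t0_ax)
  then show "ax (- 2) \<in> span {ax (- 1), ax 0, ax 1, ax 2, ax 3, s, e, d}"
    by (auto intro: span_base)
  have "ax 3 = ax 1" using arg_cong[OF assms(2), of t1] by (simp add: t1_ax)
  then show "ax 3 \<in> span {ax (- 2), ax (- 1), ax 0, ax 1, ax 2, s, e, d}"
    by (auto intro: span_base)
qed

lemma dim_le_8_if_fixed':
  assumes "\<alpha> \<noteq> 2 * \<beta>" "ax 2 = ax 0"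
  shows dim_le_8
proof -
  interpret sw: monster_pair scale mult \<alpha> \<beta> a1 a0 by (rule swapped)
  show ?thesis using sw.dim_le_8_if_fixed assms by (simp add: ax_swap)
qed

text \<open>
  If \<open>k0\<close> and \<open>k1\<close> vanish, then \<open>d - e\<close> is a combination of \<open>a\<^sub>0\<close> and \<open>a\<^sub>1\<close> that is fixed by both
  involutions, while neither axis is fixed by the involution of the other.
\<close>

lemma e_eq_d:
  assumes "\<alpha> = 4 * \<beta>" "k0 = 0" "k1 = 0" "ax (- 1) \<noteq> ax 1" "ax 2 \<noteq> ax 0"
  shows "l = m" "e = d"
proof -
  have "8 * (l - m) = 0" using assms(2,3) unfolding k0_def k1_def by algebra
  moreover have "(8::'f) \<noteq> 0" using two_nz power_eq_0_iff[of "2::'f" 3] by simp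
  ultimately show "l = m" by simp
  obtain z z' where "(36 * \<beta>\<^sup>2) *s (d - e) = (6 * \<beta>\<^sup>2 * k1) *s (ax 0 + ax 2) - (6 * \<beta>\<^sup>2 * k0) *s p
    - ((32 * \<beta> + 16) * (l - m)) *s s + z *s ax 0 + z' *s ax 1"
    by (rule d_minus_e[OF assms(1)])
  then have 1: "(36 * \<beta>\<^sup>2) *s (d - e) = z *s ax 0 + z' *s ax 1"
    using assms(2,3) \<open>l = m\<close> by simp
  have "t0 ((36 * \<beta>\<^sup>2) *s (d - e)) = (36 * \<beta>\<^sup>2) *s (d - e)"
    "t1 ((36 * \<beta>\<^sup>2) *s (d - e)) = (36 * \<beta>\<^sup>2) *s (d - e)"
    by (simp_all add: t_linear_simps t_fixed)
  then have "z' *s ax (- 1) = z' *s ax 1" "z *s ax 2 = z *s ax 0"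
    unfolding 1 by (simp_all add: t_linear_simps t0_ax t1_ax)
  then have "z' = 0" "z = 0" using assms(4,5) by auto
  show "e = d" using 1 \<open>z = 0\<close> \<open>z' = 0\<close> coeff_nz[OF assms(1)] by simp
qed

text \<open>
  For \<open>e = d\<close> the left-hand side of \<open>a0_mult_d_minus_e\<close> is zero. With the values of \<open>l\<close> and \<open>m\<close>
  forced by \<open>k0 = k1 = 0\<close>, four times the coefficient that decides about \<open>p\<close> equals
  \<open>(1 - 12 \<beta>) (2 \<beta> - 1)\<close>.
\<close>

lemma p_in_span:
  assumes "\<alpha> = 4 * \<beta>" "k0 = 0" "k1 = 0" "e = d" "12 * \<beta> \<noteq> 1" "2 * \<beta> \<noteq> 1"
  shows "p \<in> span {ax 0, s}"
proof -
  let ?\<xi> = "30 * \<beta>\<^sup>2 - 3 * \<beta> - 8 * \<beta> * m + 2 * m - 8 * \<beta> * l"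
  obtain y z where 1: "(4 * \<beta>) *s (a0 \<bullet> d - a0 \<bullet> e) = (2 * \<beta> * ?\<xi>) *s p + y *s s + z *s ax 0"
    using a0_mult_d_minus_e[OF assms(1)] by blast
  have \<xi>: "4 * ?\<xi> = (1 - 12 * \<beta>) * (2 * \<beta> - 1)"
    using assms(2,3) unfolding k0_def k1_def by algebra
  have "4 * ?\<xi> \<noteq> 0" unfolding \<xi> using assms(5,6) by simp
  then have "?\<xi> \<noteq> 0" by (metis mult_not_zero)
  then have nz: "2 * \<beta> * ?\<xi> \<noteq> 0" using params_nz two_nz by simp
  have "(2 * \<beta> * ?\<xi>) *s p = - (y *s s) - z *s ax 0"
    using 1 assms(4) by (simp add: algebra_simps eq_neg_iff_add_eq_0)
  moreover have "- (y *s s) - z *s ax 0 \<in> span {ax 0, s}"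
    by (intro span_intros) (auto intro: span_base)
  ultimately show ?thesis using nz by (intro mem_span_if_scale[of "2 * \<beta> * ?\<xi>" p]) simp_all
qed

lemma dim_le_8_if_not_special:
  assumes "\<alpha> = 4 * \<beta>" "k0 = 0" "k1 = 0" "e = d" "12 * \<beta> \<noteq> 1" "2 * \<beta> \<noteq> 1"
  shows dim_le_8
proof (rule dim_le_8_if_window)
  interpret sw: monster_pair scale mult \<alpha> \<beta> a1 a0 by (rule swapped)
  show "\<alpha> \<noteq> 2 * \<beta>" using assms(1) by (rule not_2_beta)
  have "t1 p \<in> span {ax 2, s}"
    by (rule additive_span_subset[where g = t1, OF _ _ subspace_span _ p_in_span[OF assms]])
       (auto simp: t_linear_simps t1_ax t_fixed intro: span_base)
  then have "t1 p \<in> span {ax (- 2), ax (- 1), ax 0, ax 1, ax 2, s, e, d}"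
    using span_mono[of "{ax 2, s}" "{ax (- 2), ax (- 1), ax 0, ax 1, ax 2, s, e, d}"] by blast
  from span_diff[OF this span_base[of "ax 1"]]
  show "ax 3 \<in> span {ax (- 2), ax (- 1), ax 0, ax 1, ax 2, s, e, d}"
    by (simp add: p_def t_linear_simps t1_ax)
  have p': "ax 0 + ax 2 \<in> span {ax 1, s}"
    using sw.p_in_span[OF assms(1), unfolded k0_swap k1_swap swap_simps,
        OF assms(3,2) assms(4)[symmetric] assms(5,6)]
    unfolding sw.p_def ax_swap by simp
  have "t0 (ax 0 + ax 2) \<in> span {ax (- 1), s}"
    by (rule additive_span_subset[where g = t0, OF _ _ subspace_span _ p'])
       (auto simp: t_linear_simps t0_ax t_fixed intro: span_base)
  then have "t0 (ax 0 + ax 2) \<in> span {ax (- 1), ax 0, ax 1, ax 2, ax 3, s, e, d}"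
    using span_mono[of "{ax (- 1), s}" "{ax (- 1), ax 0, ax 1, ax 2, ax 3, s, e, d}"] by blast
  from span_diff[OF this span_base[of "ax 0"]]
  show "ax (- 2) \<in> span {ax (- 1), ax 0, ax 1, ax 2, ax 3, s, e, d}"
    by (simp add: t_linear_simps t0_ax)
qed

section \<open>The exceptional parameters \<open>\<alpha> = 4 \<beta>\<close>, \<open>12 \<beta> = 1\<close>\<close>

text \<open>
  Together with \<open>s3\<close>, these are the images of \<open>sig a\<^sub>0 a\<^sub>3\<close> under the dihedral group and the swap.
\<close>

definition g1 :: 'v where "g1 = sig (ax 1) (ax (- 2))"
definition g2 :: 'v where "g2 = sig (ax (- 1)) (ax 2)"
definition p3 :: 'v where "p3 = ax 3 + ax (- 3)"

lemma t_g: "t0 s3 = s3" "t0 g1 = g2" "t0 g2 = g1" "t1 s3 = g2" "t1 g1 = g1" "t1 g2 = s3"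
proof -
  show "t0 s3 = s3" unfolding s3_def by (rule t0_sig_a0)
  show "t0 g1 = g2" "t0 g2 = g1" by (simp_all add: g1_def g2_def t0_sig t0_ax)
  have "s3 = sig (ax 0) (ax 3)" by (simp only: s3_def ax_0)
  then show "t1 s3 = g2" by (simp add: g2_def t1_sig t1_ax sig_commute[of "ax 2"])
  then show "t1 g2 = s3" using A1.tau_tau by metis
  show "t1 g1 = g1" unfolding g1_def ax_1 by (rule t1_sig_a1)
qed

lemma g_swap: "monster_pair.s3 scale mult \<alpha> \<beta> a1 a0 = g1"
    "monster_pair.g1 scale mult \<alpha> \<beta> a1 a0 = s3"
  "monster_pair.g2 scale mult \<alpha> \<beta> a1 a0 = g2"
proof -
  interpret sw: monster_pair scale mult \<alpha> \<beta> a1 a0 by (rule swapped)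
  show "sw.s3 = g1" "sw.g1 = s3" "sw.g2 = g2"
    by (simp_all add: sw.s3_def sw.g1_def sw.g2_def s3_def g1_def g2_def ax_swap ax_1 ax_0)
       (simp add: sig_commute)
qed

lemma a0_mult_p3: "a0 \<bullet> p3 = 2 *s s3 + (2 * \<beta>) *s a0 + \<beta> *s p3"
  using a0_mult_add_t0[of "ax 3"] by (simp add: p3_def s3_def t0_ax)

lemma p_mult_q: "p \<bullet> q = 2 *s s + g1 + g2 + (2 * \<beta>) *s (p + q)"
proof -
  have 1: "sig (ax 1) (ax 2) = s" "sig (ax (- 1)) (ax (- 2)) = s"
    using sig_adjacent[of 1] sig_adjacent[of "- 2"] by (simp_all add: sig_commute)
  have "p \<bullet> q = ax 1 \<bullet> ax 2 + ax 1 \<bullet> ax (- 2) + ax (- 1) \<bullet> ax 2 + ax (- 1) \<bullet> ax (- 2)"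
    by (simp add: p_def q_def bilinear_simps algebra_simps)
  then show ?thesis
    unfolding mult_eq_sig[of "ax i" "ax j" for i j] 1 g1_def[symmetric] g2_def[symmetric]
    by (intro eq_if_functionals_eq) (simp add: functional_simps p_def q_def algebra_simps)
qed

lemma s_mult_q: "2 *s (s \<bullet> q) = (4 * (\<alpha> - \<beta>)) *s s + (\<beta> * (\<alpha> - \<beta>)) *s (p + p3) + (2 * c0) *s q"
proof -
  let ?r = "(2 * (\<alpha> - \<beta>)) *s s + (\<beta> * (\<alpha> - \<beta>)) *s (ax 1 + ax 3) + (2 * c0) *s ax 2"
  have "t1 (2 *s (a0 \<bullet> s)) = ?r"
    unfolding a0_mult_s using t1_ax[of 0]
    by (simp add: t_linear_simps t_fixed p_def t1_ax c0_def ax_0)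
  then have 1: "2 *s (ax 2 \<bullet> s) = ?r"
    using t1_ax[of 0] by (simp add: t_linear_simps A1.tau_mult t_fixed ax_0)
  have "2 *s (s \<bullet> q) = 2 *s (ax 2 \<bullet> s) + t0 (2 *s (ax 2 \<bullet> s))"
    by (simp add: q_def t_linear_simps A0.tau_mult t_fixed t0_ax bilinear_simps
        scale_right_distrib mult_commute[of s])
  also have "\<dots> = ?r + t0 ?r" by (simp only: 1)
  also have "\<dots> = (4 * (\<alpha> - \<beta>)) *s s + (\<beta> * (\<alpha> - \<beta>)) *s (p + p3) + (2 * c0) *s q"
    by (rule eq_if_functionals_eq)
       (simp add: functional_simps t_linear_simps t_fixed p_def q_def p3_def t0_ax algebra_simps)
  finally show ?thesis .
qed

lemma d_mult_p: "2 *s (d \<bullet> p) = (4 * (\<alpha> - \<beta>)) *s d + (\<beta> * (\<alpha> - \<beta>)) *s (p + p3)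
   + (2 * ((\<alpha> - 1) * (\<beta> - A1.lam (ax (- 1))) - \<beta>\<^sup>2)) *s p"
proof -
  interpret sw: monster_pair scale mult \<alpha> \<beta> a1 a0 by (rule swapped)
  let ?r = "(2 * (\<alpha> - \<beta>)) *s d + (\<beta> * (\<alpha> - \<beta>)) *s (ax (- 1) + ax 3)
     + (2 * ((\<alpha> - 1) * (\<beta> - A1.lam (ax (- 1))) - \<beta>\<^sup>2)) *s ax 1"
  have 1: "2 *s (a1 \<bullet> d) = ?r"
    using sw.a0_mult_sig[of "ax (- 1)"] by (simp add: t1_ax ax_1 flip: d_def)
  have "2 *s (d \<bullet> p) = 2 *s (a1 \<bullet> d) + t0 (2 *s (a1 \<bullet> d))"
    using t0_ax[of 1]
    by (simp add: p_def ax_1 t_linear_simps A0.tau_mult t_fixed bilinear_simps scale_right_distrib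
        mult_commute[of d])
  also have "\<dots> = ?r + t0 ?r" by (simp only: 1)
  also have "\<dots> = (4 * (\<alpha> - \<beta>)) *s d + (\<beta> * (\<alpha> - \<beta>)) *s (p + p3)
   + (2 * ((\<alpha> - 1) * (\<beta> - A1.lam (ax (- 1))) - \<beta>\<^sup>2)) *s p"
    by (rule eq_if_functionals_eq)
       (simp add: functional_simps t_linear_simps t_fixed p_def p3_def t0_ax algebra_simps)
  finally show ?thesis .
qed

end

text \<open>
  The remaining situation. Numerically \<open>\<alpha> = 1/3\<close> and \<open>\<beta> = 1/12\<close>; constants are written as
  polynomials in \<open>\<beta>\<close>, normalized by \<open>12 \<beta> = 1\<close>, so that the identities have integral coefficients
  and hold in all admissible characteristics.
\<close>

locale special_pair = monster_pair scale mult \<alpha> \<beta> a0 a1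
  for scale :: "'f::field \<Rightarrow> 'v::ab_group_add \<Rightarrow> 'v" (infixr "*s" 75)
    and mult :: "'v \<Rightarrow> 'v \<Rightarrow> 'v" (infixl "\<bullet>" 70)
    and \<alpha> \<beta> :: 'f and a0 a1 :: 'v +
  assumes al: "\<alpha> = 4 * \<beta>" and be: "12 * \<beta> = 1" and be_half: "2 * \<beta> \<noteq> 1"
    and k0_0: "k0 = 0" and k1_0: "k1 = 0" and e_d: "e = d"
begin

lemma special_swapped: "special_pair scale mult \<alpha> \<beta> a1 a0"
  unfolding special_pair_def special_pair_axioms_def k0_swap k1_swap swap_simps
  using swapped al be be_half k0_0 k1_0 e_d[symmetric] by (intro conjI)

text \<open>
  In characteristic \<open>5\<close> the numbers \<open>1/12\<close> and \<open>1/2\<close> coincide.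
\<close>

lemma five_nz: "(5::'f) \<noteq> 0"
proof
  assume "(5::'f) = 0"
  moreover have "12 * \<beta> = 2 * \<beta> + 5 * (2 * \<beta>)" by algebra
  ultimately show False using be be_half by simp
qed

lemma l_special: "l = 9 * \<beta>\<^sup>2" "m = 9 * \<beta>\<^sup>2"
proof -
  have b: "8 * l - 18 * \<beta> + 1 = 0" "8 * m - 18 * \<beta> + 1 = 0"
    using k0_0 k1_0 by (simp_all only: k0_def k1_def)
  have "l = 9 * \<beta>\<^sup>2" if "8 * l - 18 * \<beta> + 1 = 0" for l
  proof -
    have "l = 18 * \<beta>\<^sup>2 * (8 * l - 18 * \<beta> + 1) + 9 * \<beta>\<^sup>2"
      using be by algebra
    then show ?thesis using that by simp
  qed
  then show "l = 9 * \<beta>\<^sup>2" "m = 9 * \<beta>\<^sup>2" using b by blast+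
qed

lemma special_constants: "c0 = - 3 * \<beta>\<^sup>2" "c1 = - 3 * \<beta>\<^sup>2" "gam = 18 * \<beta>\<^sup>2" "bb = - 36 * \<beta>\<^sup>2"
proof -
  show c0: "c0 = - 3 * \<beta>\<^sup>2" and c1: "c1 = - 3 * \<beta>\<^sup>2"
    using be al unfolding c0_def c1_def l_special by algebra+
  show gam: "gam = 18 * \<beta>\<^sup>2"
    using be al unfolding gam_def l_special by algebra
  show "bb = - 36 * \<beta>\<^sup>2"
    using be al unfolding bb_def c1 gam l_special by algebra
qed

text \<open>
  For \<open>e = d\<close> both \<open>a0_mult_d\<close> and \<open>a0_mult_sig\<close> evaluate \<open>a\<^sub>0 d\<close>. At these parameters all terms
  but those in \<open>a\<^sub>0\<close> agree, and the coefficient of \<open>a\<^sub>0\<close> determines the value of the coefficient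
  function at \<open>a\<^sub>2\<close>.
\<close>

lemma lam_ax_2_special: "A0.lam (ax 2) = 9 * \<beta>\<^sup>2"
proof -
  obtain L where L: "A0.lam (ax 2) = L" by blast
  have lam_d: "A0.lam d = L - \<beta> * (1 + L)"
    by (simp only: e_d[symmetric] e_def sig_def A0.lam_diff A0.parts_add A0.parts_scale
        A0.lam_mult_a A0.lam_a L)
  have q: "ax 2 + t0 (ax 2) = q" by (simp add: q_def t0_ax)
  note a0e = a0_mult_sig[of "ax 2", folded e_def, unfolded q L]
  let ?C = "8 * (3 * \<beta>) * (- 3 * \<beta>\<^sup>2) + 4 * \<beta> * (3 * \<beta>) + 4 * \<beta>\<^sup>2 * (3 * \<beta>)
        + 2 * \<beta> * (4 * (- 3 * \<beta>\<^sup>2) - (2 * \<beta>) * (1 + 2 * \<beta>))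
        + 18 * \<beta>\<^sup>2 * (8 * \<beta>\<^sup>2 + 2 * (1 - 4 * \<beta>) * (9 * \<beta>\<^sup>2))
        - 32 * \<beta>\<^sup>2 * (9 * \<beta>\<^sup>2) * (2 * \<beta> - 18 * \<beta>\<^sup>2)
        - 4 * \<beta> * (18 * \<beta>\<^sup>2 * (1 + 2 * \<beta>) + 2 * (L - \<beta> * (1 + L)) - 324 * \<beta> ^ 4)
        - 4 * \<beta> * ((4 * \<beta> - 1) * (\<beta> - L) - \<beta>\<^sup>2)"
  \<comment> \<open>The factor \<open>10 \<beta>\<close>, that is \<open>5/6\<close>, is the coefficient with which the unknown \<open>L\<close> occurs.\<close>
  have C: "?C = - (10 * \<beta> * (L - 9 * \<beta>\<^sup>2))" using be by algebra
  have "?C *s a0 = 0"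
  proof (rule eq_if_functionals_eq)
    fix f assume f: "functional f"
    show "f (?C *s a0) = f 0"
      using arg_cong[OF a0_mult_d, of f] arg_cong[OF a0e, of f] al
      unfolding functional_simps[OF f] lam_d e_d l_special special_constants by algebra
  qed
  then have "10 * \<beta> * (L - 9 * \<beta>\<^sup>2) = 0" using A0.a_nz
    unfolding C by (simp only: scale_eq_0_iff simp_thms neg_equal_0_iff_equal)
  moreover have "(10::'f) = 2 * 5" by simp
  ultimately have "L = 9 * \<beta>\<^sup>2" using five_nz two_nz params_nz
    by (simp only: mult_eq_0_iff simp_thms right_minus_eq)
  then show ?thesis using L by simp
qed

lemma lam_q_special: "A0.lam q = 18 * \<beta>\<^sup>2"
proof -
  have "A0.lam (ax (- 2)) = A0.lam (t0 (ax 2))" by (simp add: t0_ax)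
  then show ?thesis using lam_ax_2_special by (simp add: q_def A0.parts_add A0.lam_tau)
qed

lemma special_V_p: "A0.V p = 2 *s s + (6 * \<beta>\<^sup>2) *s a0 + \<beta> *s p"
proof -
  have "2 * \<beta> - 2 * l = 6 * \<beta>\<^sup>2" unfolding l_special using be by algebra
  then show ?thesis unfolding V_p by simp
qed

lemma special_U_q: "A0.U q = (3 * \<beta>) *s q - 2 *s e - \<beta> *s a0"
proof (rule eq_if_functionals_eq)
  fix f assume f: "functional f"
  have c: "(\<alpha> - 1) * (18 * \<beta>\<^sup>2) = - \<beta>" using be al by algebra
  show "f (A0.U q) = f ((3 * \<beta>) *s q - 2 *s e - \<beta> *s a0)"
    using al unfolding A0.U_def lam_q_special a0_mult_q functional_simps[OF f] c by algebra
qed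

lemma special_products:
  assumes f: "functional f"
  shows "2 * f (s \<bullet> q) = 12 * \<beta> * f s + 3 * \<beta>\<^sup>2 * (f p + f p3) - 6 * \<beta>\<^sup>2 * f q"
    "2 * f (e \<bullet> p) = 12 * \<beta> * f e + 3 * \<beta>\<^sup>2 * (f p + f p3) - 6 * \<beta>\<^sup>2 * f p"
    "f (p \<bullet> q) = 2 * f s + f g1 + f g2 + 2 * \<beta> * (f p + f q)"
    "2 * f (a0 \<bullet> s) = 6 * \<beta> * f s + 3 * \<beta>\<^sup>2 * f p - 6 * \<beta>\<^sup>2 * f a0"
    "2 * f (a0 \<bullet> e) = 6 * \<beta> * f e + 3 * \<beta>\<^sup>2 * f q - 6 * \<beta>\<^sup>2 * f a0"
    "f (a0 \<bullet> p) = 2 * f s + 2 * \<beta> * f a0 + \<beta> * f p"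
    "f (a0 \<bullet> q) = 2 * f e + 2 * \<beta> * f a0 + \<beta> * f q"
    "f (a0 \<bullet> p3) = 2 * f s3 + 2 * \<beta> * f a0 + \<beta> * f p3"
proof -
  interpret sw: special_pair scale mult \<alpha> \<beta> a1 a0 by (rule special_swapped)
  note fs = functional_simps[OF f]
  have m2: "A1.lam (ax (- 1)) = 9 * \<beta>\<^sup>2"
    using sw.lam_ax_2_special by (simp add: ax_swap)
  have q: "ax 2 + t0 (ax 2) = q" by (simp add: q_def t0_ax)
  have c: "2 * ((\<alpha> - 1) * (\<beta> - 9 * \<beta>\<^sup>2) - \<beta>\<^sup>2) = - (6 * \<beta>\<^sup>2)"
    using be al by algebra
  have c': "\<alpha> - \<beta> = 3 * \<beta>" using al by algebra
  show "2 * f (s \<bullet> q) = 12 * \<beta> * f s + 3 * \<beta>\<^sup>2 * (f p + f p3) - 6 * \<beta>\<^sup>2 * f q"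
    using arg_cong[OF s_mult_q, of f] unfolding fs c0_def l_special c c' by algebra
  show "2 * f (e \<bullet> p) = 12 * \<beta> * f e + 3 * \<beta>\<^sup>2 * (f p + f p3) - 6 * \<beta>\<^sup>2 * f p"
    using arg_cong[OF d_mult_p, of f] unfolding fs m2 e_d c c' by algebra
  show "2 * f (a0 \<bullet> s) = 6 * \<beta> * f s + 3 * \<beta>\<^sup>2 * f p - 6 * \<beta>\<^sup>2 * f a0"
    using arg_cong[OF a0_mult_s, of f] unfolding fs l_special c c' by algebra
  show "2 * f (a0 \<bullet> e) = 6 * \<beta> * f e + 3 * \<beta>\<^sup>2 * f q - 6 * \<beta>\<^sup>2 * f a0"
    using arg_cong[OF a0_mult_sig[of "ax 2", folded e_def, unfolded q lam_ax_2_special], of f]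
    unfolding fs c c' by algebra
  show "f (p \<bullet> q) = 2 * f s + f g1 + f g2 + 2 * \<beta> * (f p + f q)"
    "f (a0 \<bullet> p) = 2 * f s + 2 * \<beta> * f a0 + \<beta> * f p"
    "f (a0 \<bullet> q) = 2 * f e + 2 * \<beta> * f a0 + \<beta> * f q"
    "f (a0 \<bullet> p3) = 2 * f s3 + 2 * \<beta> * f a0 + \<beta> * f p3"
    by (simp_all only: p_mult_q a0_mult_p a0_mult_q a0_mult_p3 fs)
qed

text \<open>
  The identity \<open>mult_a_U\<close> for the pair \<open>q, p\<close>, and its difference from \<open>mult_a_V_mult\<close> for \<open>p, q\<close>.
  The scalar \<open>\<kappa>\<close> comes from a product of two \<open>\<alpha>\<close>-parts and affects multiples of \<open>a\<^sub>0\<close> only.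
\<close>

lemma special_fusion_raw:
  obtains \<kappa> where "\<And>f. functional f \<Longrightarrow> 3 * \<beta> * f (a0 \<bullet> (p \<bullet> q)) - 2 * f (a0 \<bullet> (e \<bullet> p))
      - \<beta> * f (a0 \<bullet> (a0 \<bullet> p))
      = 3 * \<beta> * (2 * f (s \<bullet> q) + 6 * \<beta>\<^sup>2 * f (a0 \<bullet> q) + \<beta> * f (p \<bullet> q))
       - 2 * (2 * f (s \<bullet> e) + 6 * \<beta>\<^sup>2 * f (a0 \<bullet> e) + \<beta> * f (e \<bullet> p))
       - \<beta> * (2 * f (a0 \<bullet> s) + 6 * \<beta>\<^sup>2 * f a0 + \<beta> * f (a0 \<bullet> p))"
    "\<And>f. functional f \<Longrightarrow> 2 * f (a0 \<bullet> (s \<bullet> q)) + 6 * \<beta>\<^sup>2 * f (a0 \<bullet> (a0 \<bullet> q)) + \<beta> * f (a0 \<bullet> (p \<bullet> q))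
      = 3 * \<beta> * f (a0 \<bullet> (p \<bullet> q)) - 2 * f (a0 \<bullet> (e \<bullet> p)) - \<beta> * f (a0 \<bullet> (a0 \<bullet> p))
       + 2 * \<beta>\<^sup>2 * (2 * f s + 6 * \<beta>\<^sup>2 * f a0 + \<beta> * f p) + \<kappa> * f a0"
proof -
  define \<kappa> where "\<kappa> = \<alpha> * (A0.lam (p \<bullet> q) - A0.lam p * A0.lam q)"
  have 1: "a0 \<bullet> (A0.U q \<bullet> p) = A0.U q \<bullet> A0.V p"
    by (rule A0.mult_a_U[OF q_fixed p_fixed])
  have c: "\<alpha>\<^sup>2 * (18 * \<beta>\<^sup>2) = 2 * \<beta>\<^sup>2" unfolding al using be by algebra
  have "a0 \<bullet> (A0.V p \<bullet> q) = A0.V p \<bullet> A0.U q + (\<alpha>\<^sup>2 * (18 * \<beta>\<^sup>2)) *s A0.V p + \<kappa> *s a0"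
    unfolding A0.mult_a_V_mult[OF p_fixed q_fixed] \<kappa>_def lam_q_special ..
  then have 2: "a0 \<bullet> (A0.V p \<bullet> q) = a0 \<bullet> (A0.U q \<bullet> p) + (2 * \<beta>\<^sup>2) *s A0.V p + \<kappa> *s a0"
    unfolding 1 c mult_commute[of "A0.V p" "A0.U q"] .
  show thesis
  proof (rule that)
    fix f assume f: "functional f"
    note simps = mult_add_left product_diff_left mult_scale_left mult_add_right product_diff_right
        mult_scale_right functional_simps[OF f] A0.a_idem
        mult_commute[of q s] mult_commute[of q a0] mult_commute[of q p] mult_commute[of e s]
        mult_commute[of p a0] mult_commute[of e a0]
    show "3 * \<beta> * f (a0 \<bullet> (p \<bullet> q)) - 2 * f (a0 \<bullet> (e \<bullet> p)) - \<beta> * f (a0 \<bullet> (a0 \<bullet> p))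
      = 3 * \<beta> * (2 * f (s \<bullet> q) + 6 * \<beta>\<^sup>2 * f (a0 \<bullet> q) + \<beta> * f (p \<bullet> q))
       - 2 * (2 * f (s \<bullet> e) + 6 * \<beta>\<^sup>2 * f (a0 \<bullet> e) + \<beta> * f (e \<bullet> p))
       - \<beta> * (2 * f (a0 \<bullet> s) + 6 * \<beta>\<^sup>2 * f a0 + \<beta> * f (a0 \<bullet> p))"
      using arg_cong[OF 1, of f] unfolding special_V_p special_U_q unfolding simps by algebra
    show "2 * f (a0 \<bullet> (s \<bullet> q)) + 6 * \<beta>\<^sup>2 * f (a0 \<bullet> (a0 \<bullet> q)) + \<beta> * f (a0 \<bullet> (p \<bullet> q))
      = 3 * \<beta> * f (a0 \<bullet> (p \<bullet> q)) - 2 * f (a0 \<bullet> (e \<bullet> p)) - \<beta> * f (a0 \<bullet> (a0 \<bullet> p))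
       + 2 * \<beta>\<^sup>2 * (2 * f s + 6 * \<beta>\<^sup>2 * f a0 + \<beta> * f p) + \<kappa> * f a0"
      using arg_cong[OF 2, of f] unfolding special_V_p special_U_q unfolding simps .
  qed
qed

text \<open>
  The second identity is free of \<open>s e\<close> and hence determines \<open>a\<^sub>0 (p q)\<close>, in which the unknown part
  is \<open>a\<^sub>0 (g1 + g2)\<close>. Its coefficient \<open>2 \<beta>\<close> is cancelled by multiplication with \<open>6\<close>.
\<close>

lemma a0_mult_g_sum:
  obtains y where "a0 \<bullet> (g1 + g2) = (5 * \<beta>\<^sup>2) *s (p + q) + (3 * \<beta>\<^sup>2) *s p3
    + (10 * \<beta>) *s (s + e) + (6 * \<beta>) *s s3 + y *s a0"
proof -
  obtain \<kappa> where raw: "\<And>f. functional f \<Longrightarrow>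
      2 * f (a0 \<bullet> (s \<bullet> q)) + 6 * \<beta>\<^sup>2 * f (a0 \<bullet> (a0 \<bullet> q)) + \<beta> * f (a0 \<bullet> (p \<bullet> q))
      = 3 * \<beta> * f (a0 \<bullet> (p \<bullet> q)) - 2 * f (a0 \<bullet> (e \<bullet> p)) - \<beta> * f (a0 \<bullet> (a0 \<bullet> p))
       + 2 * \<beta>\<^sup>2 * (2 * f s + 6 * \<beta>\<^sup>2 * f a0 + \<beta> * f p) + \<kappa> * f a0"
    using special_fusion_raw by blast
  let ?y = "- 36 * \<beta> ^ 4 - 68 * \<beta> ^ 3 + 2 * \<beta>\<^sup>2 - \<kappa>"
  have "a0 \<bullet> (g1 + g2) = (5 * \<beta>\<^sup>2) *s (p + q) + (3 * \<beta>\<^sup>2) *s p3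
    + (10 * \<beta>) *s (s + e) + (6 * \<beta>) *s s3 + (6 * ?y) *s a0"
  proof (rule eq_if_functionals_eq)
    fix f assume f: "functional f"
    have 1: "2 * \<beta> * (f (a0 \<bullet> g1) + f (a0 \<bullet> g2)) = 20 * \<beta>\<^sup>2 * f s + 10 * \<beta> ^ 3 * f p
        + 6 * \<beta> ^ 3 * f p3
        + (24 * \<beta> ^ 4 + 8 * \<beta> ^ 3) * f q + (48 * \<beta> ^ 3 + 16 * \<beta>\<^sup>2) * f e + 12 * \<beta>\<^sup>2 * f s3
            + ?y * f a0"
    proof -
      note P = special_products[OF f] and Q = special_products[OF functional_mult[OF f, of a0]]
      have pq: "f (a0 \<bullet> (p \<bullet> q)) = 2 * f (a0 \<bullet> s) + (f (a0 \<bullet> g1) + f (a0 \<bullet> g2))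
          + 2 * \<beta> * (f (a0 \<bullet> p) + f (a0 \<bullet> q))"
        using Q(3) by algebra
      have ep: "2 * f (a0 \<bullet> (e \<bullet> p)) = 6 * \<beta> * (2 * f (a0 \<bullet> e)) + 3 * \<beta>\<^sup>2 * (f (a0 \<bullet> p)
          + f (a0 \<bullet> p3))
          - 6 * \<beta>\<^sup>2 * f (a0 \<bullet> p)"
        using Q(2) by algebra
      have sq: "2 * f (a0 \<bullet> (s \<bullet> q)) = 6 * \<beta> * (2 * f (a0 \<bullet> s)) + 3 * \<beta>\<^sup>2 * (f (a0 \<bullet> p)
          + f (a0 \<bullet> p3))
          - 6 * \<beta>\<^sup>2 * f (a0 \<bullet> q)"
        using Q(1) by algebra
      have aap: "f (a0 \<bullet> (a0 \<bullet> p)) = 2 * f (a0 \<bullet> s) + 2 * \<beta> * f a0 + \<beta> * f (a0 \<bullet> p)"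
        using Q(6) unfolding A0.a_idem .
      have aaq: "f (a0 \<bullet> (a0 \<bullet> q)) = 2 * f (a0 \<bullet> e) + 2 * \<beta> * f a0 + \<beta> * f (a0 \<bullet> q)"
        using Q(7) unfolding A0.a_idem .
      show ?thesis
        using raw[OF f] unfolding pq ep sq aap aaq P by algebra
    qed
    \<comment> \<open>Multiplying equation 1 by \<open>6\<close> turns its left factor into \<open>12 \<beta> = 1\<close>; these are the
      resulting coefficients.\<close>
    have c: "24 * \<beta> ^ 4 + 8 * \<beta> ^ 3 = 10 * \<beta> ^ 3" "48 * \<beta> ^ 3 + 16 * \<beta>\<^sup>2 = 20 * \<beta>\<^sup>2"
      "60 * \<beta> ^ 3 = 5 * \<beta>\<^sup>2" "36 * \<beta> ^ 3 = 3 * \<beta>\<^sup>2" "120 * \<beta>\<^sup>2 = 10 * \<beta>" "72 * \<beta>\<^sup>2 = 6 * \<beta>"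
      using be by algebra+
    have "f (a0 \<bullet> g1) + f (a0 \<bullet> g2) = 6 * (2 * \<beta> * (f (a0 \<bullet> g1) + f (a0 \<bullet> g2)))"
      using be by algebra
    also have "\<dots> = (120 * \<beta>\<^sup>2) * f s + (60 * \<beta> ^ 3) * f p + (36 * \<beta> ^ 3) * f p3
        + (60 * \<beta> ^ 3) * f q + (120 * \<beta>\<^sup>2) * f e + (72 * \<beta>\<^sup>2) * f s3 + 6 * ?y * f a0"
      unfolding 1 c(1,2) by algebra
    finally show "f (a0 \<bullet> (g1 + g2)) = f ((5 * \<beta>\<^sup>2) *s (p + q) + (3 * \<beta>\<^sup>2) *s p3
    + (10 * \<beta>) *s (s + e) + (6 * \<beta>) *s s3 + (6 * ?y) *s a0)"
      unfolding c mult_add_right functional_simps[OF f] by algebra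
  qed
  then show thesis by (rule that)
qed

lemma s_mult_e:
  obtains z where "4 *s (s \<bullet> e) = (3 * \<beta>\<^sup>2) *s (g1 + g2) - (15 * \<beta> ^ 3) *s (p + q) - (24 * \<beta>\<^sup>2) *s s
    - (18 * \<beta>\<^sup>2) *s e - (12 * \<beta>\<^sup>2) *s s3 + z *s a0"
proof -
  obtain y where Y: "a0 \<bullet> (g1 + g2) = (5 * \<beta>\<^sup>2) *s (p + q) + (3 * \<beta>\<^sup>2) *s p3
    + (10 * \<beta>) *s (s + e) + (6 * \<beta>) *s s3 + y *s a0"
    by (rule a0_mult_g_sum)
  have raw: "3 * \<beta> * f (a0 \<bullet> (p \<bullet> q)) - 2 * f (a0 \<bullet> (e \<bullet> p)) - \<beta> * f (a0 \<bullet> (a0 \<bullet> p))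
      = 3 * \<beta> * (2 * f (s \<bullet> q) + 6 * \<beta>\<^sup>2 * f (a0 \<bullet> q) + \<beta> * f (p \<bullet> q))
       - 2 * (2 * f (s \<bullet> e) + 6 * \<beta>\<^sup>2 * f (a0 \<bullet> e) + \<beta> * f (e \<bullet> p))
       - \<beta> * (2 * f (a0 \<bullet> s) + 6 * \<beta>\<^sup>2 * f a0 + \<beta> * f (a0 \<bullet> p))" if "functional f" for f
    using special_fusion_raw that by blast
  let ?z = "72 * \<beta> ^ 4 - 48 * \<beta> ^ 3 + 2 * \<beta>\<^sup>2 - 3 * \<beta> * y"
  have "4 *s (s \<bullet> e) = (3 * \<beta>\<^sup>2) *s (g1 + g2) - (15 * \<beta> ^ 3) *s (p + q) - (24 * \<beta>\<^sup>2) *s s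
    - (18 * \<beta>\<^sup>2) *s e - (12 * \<beta>\<^sup>2) *s s3 + ?z *s a0"
  proof (rule eq_if_functionals_eq)
    fix f assume f: "functional f"
    show "f (4 *s (s \<bullet> e)) = f ((3 * \<beta>\<^sup>2) *s (g1 + g2) - (15 * \<beta> ^ 3) *s (p + q) - (24 * \<beta>\<^sup>2) *s s
    - (18 * \<beta>\<^sup>2) *s e - (12 * \<beta>\<^sup>2) *s s3 + ?z *s a0)"
    proof -
      note P = special_products[OF f] and Q = special_products[OF functional_mult[OF f, of a0]]
      have Yf: "f (a0 \<bullet> g1) + f (a0 \<bullet> g2) = 5 * \<beta>\<^sup>2 * (f p + f q) + 3 * \<beta>\<^sup>2 * f p3
          + 10 * \<beta> * (f s + f e) + 6 * \<beta> * f s3 + y * f a0"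
        using arg_cong[OF Y, of f] unfolding mult_add_right functional_simps[OF f] .
      have pq: "f (a0 \<bullet> (p \<bullet> q)) = 2 * f (a0 \<bullet> s) + (f (a0 \<bullet> g1) + f (a0 \<bullet> g2))
          + 2 * \<beta> * (f (a0 \<bullet> p) + f (a0 \<bullet> q))"
        using Q(3) by algebra
      have ep: "2 * f (a0 \<bullet> (e \<bullet> p)) = 6 * \<beta> * (2 * f (a0 \<bullet> e)) + 3 * \<beta>\<^sup>2 * (f (a0 \<bullet> p)
          + f (a0 \<bullet> p3))
          - 6 * \<beta>\<^sup>2 * f (a0 \<bullet> p)"
        using Q(2) by algebra
      have aap: "f (a0 \<bullet> (a0 \<bullet> p)) = 2 * f (a0 \<bullet> s) + 2 * \<beta> * f a0 + \<beta> * f (a0 \<bullet> p)"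
        using Q(6) unfolding A0.a_idem .
      have "4 * f (s \<bullet> e) = - (3 * \<beta> * f (a0 \<bullet> (p \<bullet> q)) - 2 * f (a0 \<bullet> (e \<bullet> p))
          - \<beta> * f (a0 \<bullet> (a0 \<bullet> p)))
          + 3 * \<beta> * (2 * f (s \<bullet> q) + 6 * \<beta>\<^sup>2 * f (a0 \<bullet> q) + \<beta> * f (p \<bullet> q))
          - 6 * \<beta>\<^sup>2 * (2 * f (a0 \<bullet> e)) - \<beta> * (2 * f (e \<bullet> p))
          - \<beta> * (2 * f (a0 \<bullet> s) + 6 * \<beta>\<^sup>2 * f a0 + \<beta> * f (a0 \<bullet> p))"
        using raw[OF f] by algebra
      also have "\<dots> = 3 * \<beta>\<^sup>2 * (f g1 + f g2) - 15 * \<beta> ^ 3 * (f p + f q) - 24 * \<beta>\<^sup>2 * f s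
          - 18 * \<beta>\<^sup>2 * f e - 12 * \<beta>\<^sup>2 * f s3 + ?z * f a0"
        unfolding pq ep aap Yf P by algebra
      finally show ?thesis unfolding functional_simps[OF f] .
    qed
  qed
  then show thesis by (rule that)
qed

text \<open>
  Comparison of the values of \<open>s e = s d\<close> computed from \<open>a\<^sub>0\<close> and from \<open>a\<^sub>1\<close>. The difference
  \<open>s3 - g1\<close> occurs with coefficient \<open>15 \<beta>\<^sup>2\<close>, and neither \<open>3\<close> nor \<open>5\<close> vanishes here.
\<close>

lemma s3_minus_g1:
  obtains h h' where "s3 - g1 = \<beta> *s (ax 3 - ax (- 2) + h *s ax 0 - h' *s ax 1)"
proof -
  interpret sw: special_pair scale mult \<alpha> \<beta> a1 a0 by (rule special_swapped)
  obtain z where 1: "4 *s (s \<bullet> e) = (3 * \<beta>\<^sup>2) *s (g1 + g2) - (15 * \<beta> ^ 3) *s (p + q)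
      - (24 * \<beta>\<^sup>2) *s s
    - (18 * \<beta>\<^sup>2) *s e - (12 * \<beta>\<^sup>2) *s s3 + z *s a0"
    by (rule s_mult_e)
  obtain z' where "4 *s (sw.s \<bullet> sw.e) = (3 * \<beta>\<^sup>2) *s (sw.g1 + sw.g2) - (15 * \<beta> ^ 3) *s (sw.p + sw.q)
    - (24 * \<beta>\<^sup>2) *s sw.s - (18 * \<beta>\<^sup>2) *s sw.e - (12 * \<beta>\<^sup>2) *s sw.s3 + z' *s a1"
    by (rule sw.s_mult_e)
  then have 2: "4 *s (s \<bullet> e) = (3 * \<beta>\<^sup>2) *s (s3 + g2)
    - (15 * \<beta> ^ 3) *s (ax 0 + ax 2 + (ax (- 1) + ax 3)) - (24 * \<beta>\<^sup>2) *s s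
    - (18 * \<beta>\<^sup>2) *s e - (12 * \<beta>\<^sup>2) *s g1 + z' *s a1"
    unfolding g_swap swap_simps e_d[symmetric] sw.p_def sw.q_def ax_swap by simp
  have "(15::'f) = 3 * 5" by simp
  then have nz: "15 * \<beta>\<^sup>2 \<noteq> 0"
    using three_nz[OF al] five_nz params_nz
    by (simp only: mult_eq_0_iff power_eq_0_iff simp_thms)
  then have "15 * \<beta>\<^sup>2 * \<beta> \<noteq> 0" using params_nz by simp
  then have "\<exists>x. (15 * \<beta>\<^sup>2 * \<beta>) * x = t" for t
    by (intro exI[of _ "t / (15 * \<beta>\<^sup>2 * \<beta>)"]) simp
  then obtain h h' where hh: "(15 * \<beta>\<^sup>2 * \<beta>) * h = z + 15 * \<beta> ^ 3"
      "(15 * \<beta>\<^sup>2 * \<beta>) * h' = z' + 15 * \<beta> ^ 3"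
    by metis
  have "(15 * \<beta>\<^sup>2) *s (s3 - g1) = (15 * \<beta>\<^sup>2) *s (\<beta> *s (ax 3 - ax (- 2) + h *s ax 0 - h' *s ax 1))"
  proof (rule eq_if_functionals_eq)
    fix f assume f: "functional f"
    have "15 * \<beta>\<^sup>2 * (f s3 - f g1) = 15 * \<beta> ^ 3 * (f (ax 3) - f (ax (- 2))) + (z
        + 15 * \<beta> ^ 3) * f a0
        - (z' + 15 * \<beta> ^ 3) * f a1"
      using arg_cong[OF 1, of f] arg_cong[OF 2, of f]
      unfolding functional_simps[OF f] p_def q_def ax_0 ax_1 by algebra
    also have "\<dots> = 15 * \<beta>\<^sup>2 * (\<beta> * (f (ax 3) - f (ax (- 2)) + h * f a0 - h' * f a1))"
      unfolding hh[symmetric] by algebra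
    finally show "f ((15 * \<beta>\<^sup>2) *s (s3 - g1)) = f ((15 * \<beta>\<^sup>2) *s (\<beta> *s (ax 3 - ax (- 2)
        + h *s ax 0 - h' *s ax 1)))"
      unfolding functional_simps[OF f] ax_0 ax_1 .
  qed
  then have "s3 - g1 = \<beta> *s (ax 3 - ax (- 2) + h *s ax 0 - h' *s ax 1)"
    using nz by (simp only: scale_cancel_left simp_thms)
  then show thesis by (rule that)
qed

lemma s3_minus_g2:
  assumes D: "s3 - g1 = \<beta> *s (ax 3 - ax (- 2) + h *s ax 0 - h' *s ax 1)"
  shows "s3 - g2 = \<beta> *s (ax (- 3) - ax 2 + h *s ax 0 - h' *s ax (- 1))"
    and "g2 - g1 = \<beta> *s (ax (- 1) - ax 4 + h *s ax 2 - h' *s ax 1)"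
  using arg_cong[OF D, of t0] arg_cong[OF D, of t1]
  by (simp_all add: t_linear_simps t_g t0_ax t1_ax)

text \<open>
  The relation \<open>D\<close> expresses \<open>s3 - g1\<close> by axes; its reflections at \<open>a\<^sub>0\<close> and \<open>a\<^sub>1\<close> express
  \<open>s3 - g2\<close> and \<open>g2 - g1\<close>. As the first difference is the sum of the other two, a relation between
  axes results.
\<close>

lemma ax_4_eq:
  assumes D: "s3 - g1 = \<beta> *s (ax 3 - ax (- 2) + h *s ax 0 - h' *s ax 1)"
  shows "ax 4 = ax (- 2) - ax 3 + ax (- 3) - (1 - h) *s ax 2 - (h' - 1) *s ax (- 1)" (is "_ = ?r")
proof -
  have "\<beta> *s ax 4 = \<beta> *s ?r"
  proof (rule eq_if_functionals_eq)
    fix f assume f: "functional f"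
    show "f (\<beta> *s ax 4) = f (\<beta> *s ?r)"
      using arg_cong[OF D, of f] arg_cong[OF s3_minus_g2(1)[OF D], of f] arg_cong[OF
          s3_minus_g2(2)[OF D], of f]
      unfolding functional_simps[OF f] by algebra
  qed
  then show ?thesis using params_nz by simp
qed

text \<open>
  Multiply \<open>D\<close> by \<open>a\<^sub>0\<close>. On the left, \<open>a\<^sub>0 g1\<close> is known from \<open>a\<^sub>0 (g1 + g2)\<close> and from the
  \<open>\<beta>\<close>-eigenvector \<open>g1 - g2\<close>, and the terms in \<open>s3\<close> cancel; on the right, \<open>a\<^sub>0 a\<^sub>3\<close> contributes
  \<open>s3\<close>.
\<close>

lemma s3_in_span:
  assumes D: "s3 - g1 = \<beta> *s (ax 3 - ax (- 2) + h *s ax 0 - h' *s ax 1)"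
  shows "s3 \<in> span (insert (ax (- 3)) (insert e window))"
proof -
  obtain y where Y: "a0 \<bullet> (g1 + g2) = (5 * \<beta>\<^sup>2) *s (p + q) + (3 * \<beta>\<^sup>2) *s p3
    + (10 * \<beta>) *s (s + e) + (6 * \<beta>) *s s3 + y *s a0"
    by (rule a0_mult_g_sum)
  obtain z where a0s3: "2 *s (a0 \<bullet> s3) = (2 * (\<alpha> - \<beta>)) *s s3 + (\<beta> * (\<alpha> - \<beta>)) *s p3 + z *s a0"
    using a0_mult_sig[of "ax 3"] unfolding t0_ax s3_def[symmetric] p3_def[symmetric] by blast
  \<comment> \<open>\<open>\<tau>\<^sub>0\<close> exchanges \<open>g1\<close> and \<open>g2\<close>, so their difference is a \<open>\<beta>\<close>-eigenvector.\<close>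
  have "t0 (g1 - g2) = - (g1 - g2)" by (simp add: t_linear_simps t_g)
  then have odd: "a0 \<bullet> (g1 - g2) = \<beta> *s (g1 - g2)"
    using A0.E_mult by (simp only: A0.tau_negated_iff)
  have a0_ax_3: "a0 \<bullet> ax 3 = s3 + \<beta> *s (ax 0 + ax 3)"
    by (simp add: s3_def mult_eq_sig[of a0 "ax 3"] ax_0)
  let ?r = "(3 * \<beta>\<^sup>2) *s p3 + z *s ax 0 - ((5 * \<beta>\<^sup>2) *s (p + q) + (3 * \<beta>\<^sup>2) *s p3 + (10 * \<beta>) *s (s
      + e) + y *s ax 0)
    - (\<beta> * \<beta>) *s (ax (- 3) - ax 2 - h' *s ax (- 1) - ax 3 + ax (- 2) + h' *s ax 1)
    - (2 * \<beta>) *s (\<beta> *s (ax 0 + ax 3) - (e + \<beta> *s (ax 0 + ax (- 2))) + h *s ax 0 - h' *s (s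
        + \<beta> *s (ax 0 + ax 1)))"
  have "(2 * \<beta>) *s s3 = ?r"
  proof (rule eq_if_functionals_eq)
    fix f assume f: "functional f"
    note fs = functional_simps[OF f]
    have 1: "f (a0 \<bullet> s3) - f (a0 \<bullet> g1) = \<beta> * (f s3 + \<beta> * (f (ax 0) + f (ax 3))
        - (f e + \<beta> * (f (ax 0) + f (ax (- 2)))) + h * f (ax 0) - h' * (f s + \<beta> * (f (ax 0)
            + f (ax 1))))"
      using arg_cong[OF D, of "\<lambda>v. f (a0 \<bullet> v)"]
      unfolding mult_add_right product_diff_right mult_scale_right a0_mult_ax a0_ax_3 fs .
    have 2: "f g1 - f g2 = \<beta> * (f (ax (- 3)) - f (ax 2) - h' * f (ax (- 1)) - f (ax 3)
        + f (ax (- 2)) + h' * f (ax 1))"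
      using arg_cong[OF D, of f] arg_cong[OF s3_minus_g2(1)[OF D], of f] unfolding fs by algebra
    have 3: "f (a0 \<bullet> g1) + f (a0 \<bullet> g2) = 5 * \<beta>\<^sup>2 * (f p + f q) + 3 * \<beta>\<^sup>2 * f p3
        + 10 * \<beta> * (f s + f e) + 6 * \<beta> * f s3 + y * f (ax 0)"
      using arg_cong[OF Y, of f] unfolding mult_add_right fs ax_0 .
    have 4: "f (a0 \<bullet> g1) - f (a0 \<bullet> g2) = \<beta> * (f g1 - f g2)"
      using arg_cong[OF odd, of f] unfolding product_diff_right fs .
    have 5: "2 * f (a0 \<bullet> s3) = 6 * \<beta> * f s3 + 3 * \<beta>\<^sup>2 * f p3 + z * f (ax 0)"
      using arg_cong[OF a0s3, of f] al unfolding fs ax_0 by algebra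
    have "2 * (f (a0 \<bullet> s3) - f (a0 \<bullet> g1))
        = 2 * f (a0 \<bullet> s3) - (f (a0 \<bullet> g1) + f (a0 \<bullet> g2)) - (f (a0 \<bullet> g1) - f (a0 \<bullet> g2))"
      by algebra
    then show "f ((2 * \<beta>) *s s3) = f ?r"
      unfolding 1 3 4 5 2 fs by algebra
  qed
  moreover have "?r \<in> span (insert (ax (- 3)) (insert e window))"
    unfolding p_def q_def p3_def window_def by (intro span_intros) (auto intro: span_base)
  ultimately have "(2 * \<beta>) *s s3 \<in> span (insert (ax (- 3)) (insert e window))" by simp
  then show ?thesis by (rule mem_span_if_scale) (use params_nz two_nz in simp)
qed

lemma half_stable_special:
  assumes s3: "s3 \<in> span (insert e window)" and 3: "ax (- 3) \<in> span (insert e window)"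
    and w: "w \<in> span (insert e window)"
  shows "t0 w \<in> span (insert e window)" "a0 \<bullet> w \<in> span (insert e window)"
proof -
  let ?S = "insert e window"
  have mem: "e \<in> span ?S" "s \<in> span ?S" "ax (- 2) \<in> span ?S" "ax (- 1) \<in> span ?S" "ax 0 \<in> span ?S"
      "ax 1 \<in> span ?S" "ax 2 \<in> span ?S" "ax 3 \<in> span ?S"
    by (rule span_base, simp add: window_def)+
  have "t0 x \<in> span ?S" if "x \<in> ?S" for x
    using that mem 3 by (auto simp: window_def t0_ax t_fixed)
  from additive_span_subset[where g = t0, OF _ _ subspace_span this w]
  show "t0 w \<in> span ?S" by (simp add: t_linear_simps)
  have a0s: "a0 \<bullet> s \<in> span ?S" and a0e: "a0 \<bullet> e \<in> span ?S"
    using mem by (simp_all add: a0_mult_s_in_span a0_mult_e_in_span)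
  have a0_ax_3: "a0 \<bullet> ax 3 = s3 + \<beta> *s (ax 0 + ax 3)"
    by (simp add: s3_def mult_eq_sig[of a0 "ax 3"] ax_0)
  have "a0 \<bullet> x \<in> span ?S" if "x \<in> ?S" for x
    using that a0s a0e mem s3 by (auto simp: window_def a0_mult_ax a0_ax_3 span_intros)
  from additive_span_subset[where g = "\<lambda>x. a0 \<bullet> x", OF _ _ subspace_span this w]
  show "a0 \<bullet> w \<in> span ?S" by (simp add: bilinear_simps)
qed

lemma dim_le_8_if_ax_4_in_span:
  assumes D: "s3 - g1 = \<beta> *s (ax 3 - ax (- 2) + h *s ax 0 - h' *s ax 1)"
    and 3: "ax (- 3) \<in> span (insert e window)" and 4: "ax 4 \<in> span (insert e window)"
  shows dim_le_8
proof -
  interpret sw: special_pair scale mult \<alpha> \<beta> a1 a0 by (rule special_swapped)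
  let ?S = "insert e window"
  have mem: "e \<in> span ?S" "s \<in> span ?S" "ax (- 2) \<in> span ?S" "ax (- 1) \<in> span ?S" "ax 0 \<in> span ?S"
      "ax 1 \<in> span ?S" "ax 2 \<in> span ?S" "ax 3 \<in> span ?S"
    by (rule span_base, simp add: window_def)+
  have "span (insert (ax (- 3)) ?S) \<subseteq> span ?S"
    using 3 by (intro span_minimal) (auto intro: span_base)
  then have s3: "s3 \<in> span ?S" using s3_in_span[OF D] by blast
  have "g1 = s3 - \<beta> *s (ax 3 - ax (- 2) + h *s ax 0 - h' *s ax 1)"
    unfolding D[symmetric] by simp
  then have g1: "g1 \<in> span ?S" by (simp add: span_intros mem s3)
  have 0: "t0 w \<in> span ?S" "a0 \<bullet> w \<in> span ?S" if w: "w \<in> span ?S" for w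
    using half_stable_special[OF s3 3 w] by simp_all
  have S_swap: "insert sw.e sw.window = ?S"
    by (simp only: window_swap swap_simps e_d)
  have 1: "t1 w \<in> span ?S" "a1 \<bullet> w \<in> span ?S" if w: "w \<in> span ?S" for w
    using sw.half_stable_special[unfolded S_swap g_swap ax_swap, OF g1 _ w] 4 by simp_all
  have W: "stable (span ?S)"
    using 0 1 mem(5,6) by (simp add: stable_def ax_0 ax_1)
  have "x \<bullet> s \<in> span ?S" "x \<bullet> e \<in> span ?S" if "x \<in> {s, e}" for x
  proof -
    have x: "x \<in> span ?S" "t0 x = x" using that mem by (auto simp: t_fixed)
    show "x \<bullet> s \<in> span ?S" "x \<bullet> e \<in> span ?S"
      using stable_mult_sig_a0[OF W x, of 1] stable_mult_sig_a0[OF W x, of 2]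
      by (simp_all only: ax_1 s_def[symmetric] e_def[symmetric])
  qed
  then have Z: "x \<bullet> z \<in> span ?S" if "x \<in> {s, e}" "z \<in> {s, e}" for x z
    using that by blast
  have "span ?S \<subseteq> span (range ax \<union> {s, e})"
    by (rule span_mono) (auto simp: window_def)
  moreover have "{s, e} \<subseteq> span ?S" using mem by simp
  ultimately have "span ?S = UNIV"
    using Z by (rule stable_eq_UNIV[OF W])
  then show ?thesis
    by (intro finite_spanning_list[of "[e, ax (- 2), ax (- 1), ax 0, ax 1, ax 2, ax 3, s]"])
      (auto simp: window_def)
qed

text \<open>
  The product of \<open>v\<close> with the relation between the axes. Its coefficients do not add up to zero
  unless \<open>h = h'\<close>, which is where the multiple of \<open>v\<close> comes from.
\<close>

lemma sig_relation:
  assumes D: "s3 - g1 = \<beta> *s (ax 3 - ax (- 2) + h *s ax 0 - h' *s ax 1)"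
  shows "sig v (ax 4) = sig v (ax (- 2)) - sig v (ax 3) + sig v (ax (- 3)) - (1 - h) *s sig v (ax 2)
    - (h' - 1) *s sig v (ax (- 1)) - (\<beta> * (h' - h)) *s v"
proof (rule eq_if_functionals_eq)
  fix f assume f: "functional f"
  note fs = functional_simps[OF f] functional_simps[OF functional_mult[OF f]]
  show "f (sig v (ax 4)) = f (sig v (ax (- 2)) - sig v (ax 3) + sig v (ax (- 3)) - (1
      - h) *s sig v (ax 2)
    - (h' - 1) *s sig v (ax (- 1)) - (\<beta> * (h' - h)) *s v)"
    using arg_cong[OF ax_4_eq[OF D], of f] arg_cong[OF ax_4_eq[OF D], of "\<lambda>x. f (v \<bullet> x)"]
    unfolding sig_def fs by algebra
qed

lemma sig_0_4:
  assumes D: "s3 - g1 = \<beta> *s (ax 3 - ax (- 2) + h *s ax 0 - h' *s ax 1)"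
  shows "sig (ax 0) (ax 4) = h *s e - (h' - 1) *s s - (\<beta> * (h' - h)) *s ax 0"
proof -
  have "sig (ax 0) (ax (- 2)) = e" "sig (ax 0) (ax (- 3)) = sig (ax 0) (ax 3)"
    "sig (ax 0) (ax 2) = e" "sig (ax 0) (ax (- 1)) = s"
    using sig_reflect[of 0 2] sig_reflect[of 0 3] sig_even[of 0] sig_adjacent[of "- 1"]
    by (simp_all add: sig_commute)
  then show ?thesis
    unfolding sig_relation[OF D] by (simp add: scale_left_diff_distrib)
qed

lemma sig_self: "sig (ax i) (ax i) = (1 - 2 * \<beta>) *s ax i"
  by (rule eq_if_functionals_eq) (simp add: functional_simps sig_def ax_idem algebra_simps)

lemma sig_2_m3:
  assumes D: "s3 - g1 = \<beta> *s (ax 3 - ax (- 2) + h *s ax 0 - h *s ax 1)"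
  shows "sig (ax 2) (ax (- 3)) = (1 - h) *s e + h *s s + ((1 - h) * (1 - 2 * \<beta>)) *s ax 2 + (h
      - 1) *s g2"
proof -
  have "t1 (sig (ax 0) (ax 4)) = h *s e - (h - 1) *s s"
    unfolding sig_0_4[OF D] by (simp add: t_linear_simps t_fixed)
  then have 1: "sig (ax 2) (ax (- 2)) = h *s e - (h - 1) *s s"
    by (simp add: t1_sig t1_ax)
  have 2: "sig (ax 2) (ax 4) = e" "sig (ax 2) (ax 3) = s" "sig (ax 2) (ax (- 1)) = g2"
    "sig (ax 2) (ax 2) = (1 - 2 * \<beta>) *s ax 2"
    using sig_even[of 2] sig_adjacent[of 2]
    by (simp_all add: g2_def sig_self sig_commute[of "ax 2" "ax (- 1)"])
  show ?thesis
  proof (rule eq_if_functionals_eq)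
    fix f assume f: "functional f"
    show "f (sig (ax 2) (ax (- 3))) = f ((1 - h) *s e + h *s s + ((1 - h) * (1 - 2 * \<beta>)) *s ax 2
        + (h - 1) *s g2)"
      using arg_cong[OF sig_relation[OF D, of "ax 2"], of f]
      unfolding 1 2 functional_simps[OF f] by algebra
  qed
qed

text \<open>
  By \<open>dim_le_8_if_ax_4_in_span\<close> it suffices to find \<open>a\<^sub>4\<close> or \<open>a\<^bsub>-3\<^esub>\<close> in the span of
  \<open>a\<^bsub>-2\<^esub>, \<dots>, a\<^sub>3, s, e\<close>. The relation gives the values of \<open>sig\<close> between distant axes, and these
  must not depend on how they are computed. For \<open>a\<^sub>0, a\<^sub>4\<close>, invariance under the reflection at
  \<open>a\<^sub>2\<close> gives \<open>h = h'\<close> or \<open>a\<^sub>4 = a\<^sub>0\<close>. For \<open>a\<^sub>2, a\<^bsub>-3\<^esub>\<close>, evaluated from either end, it expresses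
  \<open>a\<^bsub>-3\<^esub>\<close> unless \<open>h = 1\<close>. For \<open>a\<^sub>3, a\<^bsub>-3\<^esub>\<close> it finally gives \<open>a\<^bsub>-3\<^esub> = a\<^sub>3\<close>.
\<close>

lemma special_dim_le_8: dim_le_8
proof -
  interpret sw: special_pair scale mult \<alpha> \<beta> a1 a0 by (rule special_swapped)
  obtain h h' where D: "s3 - g1 = \<beta> *s (ax 3 - ax (- 2) + h *s ax 0 - h' *s ax 1)"
    by (rule s3_minus_g1)
  let ?S = "insert e window"
  have mem: "e \<in> span ?S" "s \<in> span ?S" "ax (- 2) \<in> span ?S" "ax (- 1) \<in> span ?S" "ax 0 \<in> span ?S"
      "ax 1 \<in> span ?S" "ax 2 \<in> span ?S" "ax 3 \<in> span ?S"
    by (rule span_base, simp add: window_def)+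
  have if_m3: dim_le_8 if 3: "ax (- 3) \<in> span ?S"
  proof (rule dim_le_8_if_ax_4_in_span[OF D 3])
    show "ax 4 \<in> span ?S" unfolding ax_4_eq[OF D] by (intro span_intros mem 3)
  qed
  have if_4: dim_le_8 if 4: "ax 4 \<in> span ?S"
  proof (rule if_m3)
    have "ax (- 3) = ax 4 - ax (- 2) + ax 3 + (1 - h) *s ax 2 + (h' - 1) *s ax (- 1)"
      unfolding ax_4_eq[OF D] by simp
    then show "ax (- 3) \<in> span ?S" by (simp add: span_intros mem 4)
  qed
  show ?thesis
  proof (cases "h' = h")
    case False
    \<comment> \<open>The reflection at \<open>a\<^sub>2\<close>; it exchanges \<open>a\<^sub>0\<close> and \<open>a\<^sub>4\<close>.\<close>
    let ?T = "\<lambda>v. t1 (t0 (t1 v))"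
    have "?T (sig (ax 0) (ax 4)) = sig (ax 0) (ax 4)"
      by (simp add: t0_sig t1_sig t0_ax t1_ax sig_commute[of "ax 4"])
    then have "(\<beta> * (h' - h)) *s ax 4 = (\<beta> * (h' - h)) *s ax 0"
      unfolding sig_0_4[OF D] by (simp add: t_linear_simps t_fixed t0_ax t1_ax)
    then have "ax 4 = ax 0" using False params_nz by simp
    then show ?thesis using if_4 mem by simp
  next
    case True
    then have D: "s3 - g1 = \<beta> *s (ax 3 - ax (- 2) + h *s ax 0 - h *s ax 1)" using D by simp
    have "g1 - s3 = \<beta> *s (ax (- 2) - ax 3 + h *s ax 1 - h *s ax 0)"
    proof (rule eq_if_functionals_eq)
      fix f assume f: "functional f"
      show "f (g1 - s3) = f (\<beta> *s (ax (- 2) - ax 3 + h *s ax 1 - h *s ax 0))"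
        using arg_cong[OF D, of f] unfolding functional_simps[OF f] by algebra
    qed
    then have D': "sw.s3 - sw.g1 = \<beta> *s (sw.ax 3 - sw.ax (- 2) + h *s sw.ax 0 - h *s sw.ax 1)"
      unfolding g_swap ax_swap by simp
    have "sig (ax (- 1)) (ax 4) = (1 - h) *s e + h *s s + ((1 - h) * (1 - 2 * \<beta>)) *s ax (- 1) + (h
        - 1) *s g2"
      using sw.sig_2_m3[OF D'] unfolding g_swap swap_simps ax_swap e_d[symmetric] by simp
    \<comment> \<open>The mirror image of \<open>sig_2_m3\<close> concerns \<open>a\<^bsub>-1\<^esub>, a\<^sub>4\<close>; a translation by \<open>-2\<close> leads back to
      \<open>a\<^bsub>-3\<^esub>, a\<^sub>2\<close>.\<close>
    from arg_cong[OF this, of "\<lambda>v. t0 (t1 v)"]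
    have 1: "sig (ax 2) (ax (- 3)) = (1 - h) *s e + h *s s + ((1 - h) * (1 - 2 * \<beta>)) *s ax (- 3)
        + (h - 1) *s s3"
      by (simp add: t0_sig t1_sig t_linear_simps t0_ax t1_ax t_fixed t_g sig_commute[of "ax 2"])
    have 2: "((1 - h) * (9 * \<beta>)) *s ax (- 3) = (1 - h) *s ((9 * \<beta>) *s ax 2 + (\<beta> * h) *s (ax 0
        - ax (- 1)))"
    proof (rule eq_if_functionals_eq)
      fix f assume f: "functional f"
      have "1 = 12 * \<beta>" using be by simp
      then show "f (((1 - h) * (9 * \<beta>)) *s ax (- 3)) = f ((1 - h) *s ((9 * \<beta>) *s ax 2
          + (\<beta> * h) *s (ax 0 - ax (- 1))))"
        using arg_cong[OF 1, of f] arg_cong[OF sig_2_m3[OF D], of f] arg_cong[OF s3_minus_g2(1)[OF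
            D], of f]
        unfolding functional_simps[OF f] by algebra
    qed
    show ?thesis
    proof (cases "h = 1")
      case False
      have "(9::'f) = 3 * 3" by simp
      then have "9 * \<beta> \<noteq> 0"
        using three_nz[OF al] params_nz by (simp only: mult_eq_0_iff simp_thms)
      then have nz: "(1 - h) * (9 * \<beta>) \<noteq> 0" using False by simp
      have "((1 - h) * (9 * \<beta>)) *s ax (- 3) \<in> span ?S"
        unfolding 2 by (intro span_intros mem)
      then have "ax (- 3) \<in> span ?S" using nz by (rule mem_span_if_scale)
      then show ?thesis by (rule if_m3)
    next
      case True
      have "sig (ax 2) (ax (- 3)) = s" using sig_2_m3[OF D] True by simp
      from arg_cong[OF this, of t0] have 3: "sig (ax 3) (ax (- 2)) = s"
        by (simp add: t0_sig t0_ax t_fixed sig_commute)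
      have 4: "sig (ax 3) (ax 4) = s" using sig_adjacent[of 3] by simp
      have 5: "sig (ax 3) (ax (- 3)) = (1 - 2 * \<beta>) *s ax 3"
        using sig_relation[OF D, of "ax 3"] unfolding 3 4 True sig_self by simp
      have "t0 (sig (ax 3) (ax (- 3))) = sig (ax 3) (ax (- 3))"
        by (simp add: t0_sig t0_ax sig_commute)
      then have "(1 - 2 * \<beta>) *s ax (- 3) = (1 - 2 * \<beta>) *s ax 3"
        unfolding 5 by (simp add: t_linear_simps t0_ax)
      then have "ax (- 3) = ax 3" using be_half by simp
      then show ?thesis using if_m3 mem by simp
    qed
  qed
qed

end

context monster_pair
begin

section \<open>The dimension bound\<close>

lemma dim_le_8:
  assumes "(\<alpha>, \<beta>) \<noteq> (2, 1 / 2)"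
  shows dim_le_8
proof -
  consider "\<alpha> = 2 * \<beta>" | "\<alpha> \<noteq> 2 * \<beta>" "\<alpha> \<noteq> 4 * \<beta>" | "\<alpha> = 4 * \<beta>" by blast
  then show ?thesis
  proof cases
    case 1
    then show ?thesis by (rule dim_le_8_if_alpha_eq_2_beta)
  next
    case 2
    then show ?thesis by (rule dim_le_8_generic)
  next
    case 3
    have "\<alpha> \<noteq> 2 * \<beta>" using 3 by (rule not_2_beta)
    have half: "2 * \<beta> \<noteq> 1"
    proof
      assume \<beta>: "2 * \<beta> = 1"
      then have "\<alpha> = 2" using 3 by algebra
      moreover have "\<beta> = 1 / 2" using \<beta> two_nz by (simp add: field_simps)
      ultimately show False using assms by blast
    qed
    consider "k0 \<noteq> 0" | "k1 \<noteq> 0" | "ax (- 1) = ax 1" | "ax 2 = ax 0"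
      | "k0 = 0" "k1 = 0" "ax (- 1) \<noteq> ax 1" "ax 2 \<noteq> ax 0" by blast
    then show ?thesis
    proof cases
      case 1
      with 3 show ?thesis by (rule dim_le_8_if_k0_nz)
    next
      case 2
      with 3 show ?thesis by (rule dim_le_8_if_k1_nz)
    next
      case a: 3
      with \<open>\<alpha> \<noteq> 2 * \<beta>\<close> show ?thesis by (rule dim_le_8_if_fixed)
    next
      case 4
      with \<open>\<alpha> \<noteq> 2 * \<beta>\<close> show ?thesis by (rule dim_le_8_if_fixed')
    next
      case 5
      have "e = d" using 3 5 by (rule e_eq_d)
      show ?thesis
      proof (cases "12 * \<beta> = 1")
        case True
        interpret special_pair scale mult \<alpha> \<beta> a0 a1
          using 3 True half 5(1,2) \<open>e = d\<close> by unfold_locales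
        show ?thesis by (rule special_dim_le_8)
      next
        case False
        from 3 5(1,2) \<open>e = d\<close> False half show ?thesis by (rule dim_le_8_if_not_special)
      qed
    qed
  qed
qed

end

theorem theorem1p1:
  fixes scale :: "'f::field \<Rightarrow> 'v::ab_group_add \<Rightarrow> 'v"
    and mult :: "'v \<Rightarrow> 'v \<Rightarrow> 'v"
    and \<alpha> \<beta> :: 'f
  assumes "CHAR('f) \<noteq> 2"
    and "distinct [0, 1, \<alpha>, \<beta>]"
    and "(\<alpha>, \<beta>) \<noteq> (2, 1 / 2)"
    and "two_generated_monster_algebra scale mult \<alpha> \<beta>"
  shows "(\<exists>B. finite B \<and> module.span scale B = (UNIV :: 'v set)) \<and>
         vector_space.dim scale (UNIV :: 'v set) \<le> 8"
proof -
  interpret two_generated_monster_algebra scale mult \<alpha> \<beta> by fact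
  have "(2::'f) \<noteq> 0"
  proof
    assume "(2::'f) = 0"
    then have "CHAR('f) dvd 2"
      using of_nat_eq_0_iff_char_dvd[where 'a = 'f, of 2] by simp
    then have "CHAR('f) = 1 \<or> CHAR('f) = 2"
      using two_is_prime_nat prime_nat_iff by blast
    then show False using assms(1) by simp
  qed
  moreover obtain a b where "monster_axis \<alpha> \<beta> a" "monster_axis \<alpha> \<beta> b"
      "subalgebra hull {a, b} = UNIV"
    using two_generated by blast
  ultimately interpret monster_pair scale mult \<alpha> \<beta> a b
    using assms(2) by unfold_locales
  show ?thesis using assms(3) by (rule dim_le_8)
qed

end
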